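(* Let $m,p\in\mathbb{N}_0$ and let the real parameters $A=((a_i,\alpha_i))_{1\le i\le p}$, $B=((b_j,\beta_j))_{1\le j\le m}$ satisfy the parameter assumptions (1)-(4) of the context, and let $K=\prod_{j=1}^m\Gamma(b_j+\beta_j)\big/\prod_{i=1}^p\Gamma(a_i+\alpha_i)$. Let $Y_{A,B}$ be a positive random variable with density $\tau\mapsto\frac1K H^{m,0}_{p,m}(\tau)$ on $(0,\infty)$ and let $B^{\mathbb{H}}=\{B^{\mathbb{H}}_t,\,t\ge0\}$ be a fractional Brownian motion with Hurst parameter $\mathbb{H}\in(0,1)$, both defined on the same probability space $(\Omega,\mathcal{A},\mathbb{P})$. If $Y_{A,B}$ and $B^{\mathbb{H}}$ are independent, then the following three processes have the same finite-dimensional distributions: $$\{X_t^{\mathbb{H},A,B},\,t\ge0\}\overset{\mathrm{f.d.d.}}{=}\{\sqrt{Y_{A,B}}\,B^{\mathbb{H}}_t,\,t\ge0\}\overset{\mathrm{f.d.d.}}{=}\{B^{\mathbb{H}}_{t\,(Y_{A,B})^{1/(2\mathbb{H})}},\,t\ge0\},$$ where $X^{\mathbb{H},A,B}$ is the generalized Fox-$H$ process on $(\mathcal{S}',\mathcal{C}_\sigma(\mathcal{S}'),\mu_\Psi)$ (see context).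
   Context: **Parameter assumptions.** $m,p\in\mathbb{N}_0$ and: (1) $a_i\in\mathbb{R}$, $\alpha_i>0$, $a_i+\alpha_i>0$ for $i=1,\dots,p$; (2) $b_j\in\mathbb{R}$, $\beta_j>0$, $b_j+\beta_j>0$ for $j=1,\dots,m$; (3) with $a^*:=\sum_{j=1}^m\beta_j-\sum_{i=1}^p\alpha_i$ and $\mu:=\sum_{j=1}^m b_j-\sum_{i=1}^p a_i+(p-m)/2$, either $a^*>0$, or $a^*=0$ and $\mu<-1$; (4) the Fox-$H$ function $$H^{m,0}_{p,m}(\tau):=\frac{1}{2\pi \mathrm{i}}\int_{\gamma-\mathrm{i}\infty}^{\gamma+\mathrm{i}\infty}\frac{\prod_{j=1}^m\Gamma(b_j+\beta_js)}{\prod_{i=1}^p\Gamma(a_i+\alpha_is)}\,\tau^{-s}\,\mathrm{d}s,\quad \tau>0,$$ (with $\gamma>\max_j(-b_j/\beta_j)$, e.g. $\gamma=1$) is non-negative on $(0,\infty)$. Empty sums are $0$, empty products are $1$. Known fact: under these assumptions $\varrho_H:=\frac1K H^{m,0}_{p,m}$ is a probability density on $(0,\infty)$ with finite moments of all orders and Laplace transform $s\mapsto\frac1K\,{}_m\Psi_p(-s)$, $s\ge0$. **Generalized Wright function.** ${}_m\Psi_p(z):=\sum_{k\ge0}\frac{\prod_{j=1}^m\Gamma(b_j+\beta_j+\beta_jk)}{\prod_{i=1}^p\Gamma(a_i+\alpha_i+\alpha_ik)}\frac{z^k}{k!}$ (entire if $a^*<1$). For $s>0$, in general, ${}_m\Psi_p(-s)$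 is understood through its Fox-$H$ representation ${}_m\Psi_p(-s)=\frac{1}{2\pi \mathrm{i}}\int_{c-\mathrm{i}\infty}^{c+\mathrm{i}\infty}\Gamma(u)\frac{\prod_j\Gamma(b_j+\beta_j-\beta_ju)}{\prod_i\Gamma(a_i+\alpha_i-\alpha_iu)}s^{-u}\,\mathrm{d}u$ with $0<c<\min_j(b_j+\beta_j)/\beta_j$, and ${}_m\Psi_p(0)=K$. **The measure.** Let $\mathcal{S}=\mathcal{S}(\mathbb{R})$ be the real Schwartz space, $\mathcal{S}'$ its dual with pairing $\langle\cdot,\cdot\rangle$ extending the inner product of $L^2(\mathbb{R},\mathrm{d}x)$, and $\mathcal{C}_\sigma(\mathcal{S}')$ the cylinder $\sigma$-algebra. The generalized Fox-$H$ measure $\mu_\Psi$ is the unique probability measure on $(\mathcal{S}',\mathcal{C}_\sigma(\mathcal{S}'))$ with $\int_{\mathcal{S}'}e^{\mathrm{i}\langle\omega,\varphi\rangle}\,\mathrm{d}\mu_\Psi(\omega)=\frac1K\,{}_m\Psi_p\big(-\frac12\langle\varphi,\varphi\rangle\big)$, $\varphi\in\mathcal{S}$. One has $\|\langle\cdot,\varphi\rangle\|_{L^2(\mu_\Psi)}=c\,|\varphi|_{L^2(\mathbb{R})}$ for a constant $c$; hence $\langle\cdot,f\rangle\in L^2(\mu_\Psi)$ is defined for $f\in L^2(\mathbb{R})$ as the $L^2(\mu_\Psi)$-limit of $\langle\cdot,\varphi_n\rangle$, $\varphi_n\in\mathcal{S}$, $\varphi_n\to f$ in $L^2(\mathbb{R})$.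 **Fractional operator.** $M_-^{\mathbb{H}}f=K_{\mathbb{H}}D_-^{1/2-\mathbb{H}}f$ if $\mathbb{H}<1/2$, $M_-^{1/2}f=f$, $M_-^{\mathbb{H}}f=K_{\mathbb{H}}I_-^{\mathbb{H}-1/2}f$ if $\mathbb{H}>1/2$, where for $\sigma\in(0,1)$ $(I_-^\sigma f)(x)=\frac{1}{\Gamma(\sigma)}\int_x^\infty f(t)(t-x)^{\sigma-1}\mathrm{d}t$, $(D_-^\sigma f)(x)=-\frac{1}{\Gamma(1-\sigma)}\frac{\mathrm{d}}{\mathrm{d}x}\int_x^\infty f(t)(t-x)^{-\sigma}\mathrm{d}t$, and $K_{\mathbb{H}}=\Gamma(\mathbb{H}+\tfrac12)\big(\int_0^\infty((1+s)^{\mathbb{H}-1/2}-s^{\mathbb{H}-1/2})^2\mathrm{d}s+\frac{1}{2\mathbb{H}}\big)^{-1/2}$. Known: $M_-^{\mathbb{H}}\mathbf{1}_{[0,t)}\in L^2(\mathbb{R})$ and $(M_-^{\mathbb{H}}\mathbf{1}_{[0,t)},M_-^{\mathbb{H}}\mathbf{1}_{[0,s)})_{L^2}=\frac12(t^{2\mathbb{H}}+s^{2\mathbb{H}}-|t-s|^{2\mathbb{H}})$. **Generalized Fox-$H$ process.** $X_t^{\mathbb{H},A,B}:=\langle\cdot,M_-^{\mathbb{H}}\mathbf{1}_{[0,t)}\rangle$, $t\ge0$. Fractional Brownian motion with Hurst parameter $\mathbb{H}$ is the continuous centered Gaussian process with covariance $\frac12(t^{2\mathbb{H}}+s^{2\mathbb{H}}-|t-s|^{2\mathbb{H}})$.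 *)

theory Defs
  imports "HOL-Probability.Probability" "HOL-Complex_Analysis.Complex_Analysis"
begin

section \<open>Fox-H and generalized Wright functions\<close>

text \<open>The parameters are families \<open>(a i, \<alpha> i)\<close> for \<open>i \<in> {1..p}\<close> and \<open>(b j, \<beta> j)\<close> for
  \<open>j \<in> {1..m}\<close>; values outside these ranges are irrelevant.\<close>

definition fox_astar :: "nat \<Rightarrow> nat \<Rightarrow> (nat \<Rightarrow> real) \<Rightarrow> (nat \<Rightarrow> real) \<Rightarrow> real" where
  "fox_astar m p \<alpha> \<beta> = (\<Sum>j=1..m. \<beta> j) - (\<Sum>i=1..p. \<alpha> i)"

definition fox_mu :: "nat \<Rightarrow> nat \<Rightarrow> (nat \<Rightarrow> real) \<Rightarrow> (nat \<Rightarrow> real) \<Rightarrow> real" where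
  "fox_mu m p a b = (\<Sum>j=1..m. b j) - (\<Sum>i=1..p. a i) + (real p - real m) / 2"

text \<open>The contour integral of \<open>f\<close> along the upward vertical line with real part \<open>c\<close>
  (parametrized by \<open>s = c + \<i> t\<close>, \<open>ds = \<i> dt\<close>), as a Lebesgue integral. Under the standing
  parameter assumptions the Mellin-Barnes integrals below converge absolutely.\<close>

definition vertical_line_integral :: "real \<Rightarrow> (complex \<Rightarrow> complex) \<Rightarrow> complex" where
  "vertical_line_integral c f = (LINT t|lborel. f (Complex c t) * \<i>)"

text \<open>Since \<open>Gamma\<close> is \<open>0\<close> at its poles and \<open>x / 0 = 0\<close>, the quotients below have the
  correct value \<open>0\<close> at a pole of a factor of the denominator.\<close>

definition fox_H :: "real \<Rightarrow> nat \<Rightarrow> nat \<Rightarrow> (nat \<Rightarrow> real) \<Rightarrow> (nat \<Rightarrow> real) \<Rightarrow> (nat \<Rightarrow> real) \<Rightarrow>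
    (nat \<Rightarrow> real) \<Rightarrow> real \<Rightarrow> complex" where
  "fox_H \<gamma> m p a \<alpha> b \<beta> \<tau> = 1 / (2 * of_real pi * \<i>) *
     vertical_line_integral \<gamma> (\<lambda>s.
       (\<Prod>j=1..m. Gamma (of_real (b j) + of_real (\<beta> j) * s)) /
       (\<Prod>i=1..p. Gamma (of_real (a i) + of_real (\<alpha> i) * s)) * of_real \<tau> powr (- s))"

definition fox_K :: "nat \<Rightarrow> nat \<Rightarrow> (nat \<Rightarrow> real) \<Rightarrow> (nat \<Rightarrow> real) \<Rightarrow> (nat \<Rightarrow> real) \<Rightarrow>
    (nat \<Rightarrow> real) \<Rightarrow> real" where
  "fox_K m p a \<alpha> b \<beta> = (\<Prod>j=1..m. Gamma (b j + \<beta> j)) / (\<Prod>i=1..p. Gamma (a i + \<alpha> i))"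

text \<open>The generalized Wright function on the half-line \<open>z \<le> 0\<close>. Its power series need not
  converge (it diverges for \<open>z \<noteq> 0\<close> if \<open>fox_astar m p \<alpha> \<beta> > 1\<close>), so for \<open>z < 0\<close> it is given by
  its Fox-H representation on a line \<open>Re u = c\<close> with \<open>0 < c < (b j + \<beta> j) / \<beta> j\<close> for all
  \<open>j\<close>.\<close>

definition wright_Psi :: "real \<Rightarrow> nat \<Rightarrow> nat \<Rightarrow> (nat \<Rightarrow> real) \<Rightarrow> (nat \<Rightarrow> real) \<Rightarrow>
    (nat \<Rightarrow> real) \<Rightarrow> (nat \<Rightarrow> real) \<Rightarrow> real \<Rightarrow> complex" where
  "wright_Psi c m p a \<alpha> b \<beta> z =
     (if z = 0 then of_real (fox_K m p a \<alpha> b \<beta>)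
      else 1 / (2 * of_real pi * \<i>) *
        vertical_line_integral c (\<lambda>u. Gamma u *
          ((\<Prod>j=1..m. Gamma (of_real (b j + \<beta> j) - of_real (\<beta> j) * u)) /
           (\<Prod>i=1..p. Gamma (of_real (a i + \<alpha> i) - of_real (\<alpha> i) * u))) *
          of_real (- z) powr (- u)))"

section \<open>Tempered distributions and the generalized Fox-H measure\<close>

definition schwartz :: "(real \<Rightarrow> real) set" where
  "schwartz = {f. (\<forall>n x. (deriv ^^ n) f field_differentiable at x) \<and>
                  (\<forall>k n. bounded (range (\<lambda>x. x ^ k * (deriv ^^ n) f x)))}"

definition schwartz_seminorm :: "nat \<Rightarrow> nat \<Rightarrow> (real \<Rightarrow> real) \<Rightarrow> real" where
  "schwartz_seminorm k n f = (SUP x. \<bar>x ^ k * (deriv ^^ n) f x\<bar>)"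

definition schwartz_topology :: "(real \<Rightarrow> real) topology" where
  "schwartz_topology = topology_generated_by
     {{g \<in> schwartz. schwartz_seminorm k n (\<lambda>x. g x - f x) < r} | f k n r. f \<in> schwartz}"

text \<open>Functionals on the set \<open>schwartz\<close> are represented by extensional functions
  (\<open>undefined\<close> off \<open>schwartz\<close>), so that equal functionals are equal as HOL functions.\<close>

definition tempered :: "((real \<Rightarrow> real) \<Rightarrow> real) set" where
  "tempered = {\<omega> \<in> extensional schwartz.
     (\<forall>f\<in>schwartz. \<forall>g\<in>schwartz. \<forall>r s. \<omega> (\<lambda>x. r * f x + s * g x) = r * \<omega> f + s * \<omega> g) \<and>
     continuous_map schwartz_topology euclideanreal \<omega>}"

text \<open>The cylinder \<open>\<sigma>\<close>-algebra, i.e. the one generated by the evaluations \<open>\<omega> \<mapsto> \<omega> \<phi>\<close>.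
  (Only the measurable structure of the product below is meaningful.)\<close>

definition cylinder_algebra :: "((real \<Rightarrow> real) \<Rightarrow> real) measure" where
  "cylinder_algebra = restrict_space (Pi\<^sub>M schwartz (\<lambda>_. borel)) tempered"

definition fox_H_measure :: "real \<Rightarrow> nat \<Rightarrow> nat \<Rightarrow> (nat \<Rightarrow> real) \<Rightarrow> (nat \<Rightarrow> real) \<Rightarrow>
    (nat \<Rightarrow> real) \<Rightarrow> (nat \<Rightarrow> real) \<Rightarrow> ((real \<Rightarrow> real) \<Rightarrow> real) measure \<Rightarrow> bool" where
  "fox_H_measure c m p a \<alpha> b \<beta> M \<longleftrightarrow>
     prob_space M \<and> sets M = sets cylinder_algebra \<and>
     (\<forall>\<phi>\<in>schwartz. (LINT \<omega>|M. exp (\<i> * of_real (\<omega> \<phi>))) =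
        1 / of_real (fox_K m p a \<alpha> b \<beta>) *
        wright_Psi c m p a \<alpha> b \<beta> (- (1 / 2) * (LBINT x. \<phi> x * \<phi> x)))"

text \<open>\<open>Z\<close> is a version of the random variable \<open>\<langle>\<cdot>, f\<rangle>\<close>, the limit in \<open>L\<^sup>2(M)\<close> of \<open>\<langle>\<cdot>, \<phi>\<^sub>n\<rangle>\<close> for
  Schwartz functions \<open>\<phi>\<^sub>n \<rightarrow> f\<close> in \<open>L\<^sup>2(\<real>)\<close>. By the isometry property of \<open>\<phi> \<mapsto> \<langle>\<cdot>, \<phi>\<rangle>\<close> the limit does not
  depend on the approximating sequence.\<close>

definition is_L2_pairing :: "((real \<Rightarrow> real) \<Rightarrow> real) measure \<Rightarrow> (real \<Rightarrow> real) \<Rightarrow>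
    (((real \<Rightarrow> real) \<Rightarrow> real) \<Rightarrow> real) \<Rightarrow> bool" where
  "is_L2_pairing M f Z \<longleftrightarrow> Z \<in> borel_measurable M \<and>
     (\<exists>\<phi>. (\<forall>n. \<phi> n \<in> schwartz) \<and>
        (\<lambda>n. \<integral>\<^sup>+x. ennreal ((\<phi> n x - f x)\<^sup>2) \<partial>lborel) \<longlonglongrightarrow> 0 \<and>
        (\<lambda>n. \<integral>\<^sup>+\<omega>. ennreal ((\<omega> (\<phi> n) - Z \<omega>)\<^sup>2) \<partial>M) \<longlonglongrightarrow> 0)"

section \<open>The fractional operator and the generalized Fox-H process\<close>

definition frac_I_minus :: "real \<Rightarrow> (real \<Rightarrow> real) \<Rightarrow> real \<Rightarrow> real" where
  "frac_I_minus \<sigma> f x = 1 / Gamma \<sigma> * (LBINT t:{x..}. f t * (t - x) powr (\<sigma> - 1))"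

text \<open>For the indicator functions below the derivative exists for all but finitely many \<open>x\<close>.\<close>

definition frac_D_minus :: "real \<Rightarrow> (real \<Rightarrow> real) \<Rightarrow> real \<Rightarrow> real" where
  "frac_D_minus \<sigma> f x =
     - 1 / Gamma (1 - \<sigma>) * deriv (\<lambda>y. LBINT t:{y..}. f t * (t - y) powr (- \<sigma>)) x"

definition frac_K :: "real \<Rightarrow> real" where
  "frac_K H = Gamma (H + 1 / 2) *
     ((LBINT s:{0..}. ((1 + s) powr (H - 1 / 2) - s powr (H - 1 / 2))\<^sup>2) + 1 / (2 * H))
       powr (- 1 / 2)"

definition frac_M_minus :: "real \<Rightarrow> (real \<Rightarrow> real) \<Rightarrow> real \<Rightarrow> real" where
  "frac_M_minus H f =
     (if H < 1 / 2 then (\<lambda>x. frac_K H * frac_D_minus (1 / 2 - H) f x)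
      else if H = 1 / 2 then f
      else (\<lambda>x. frac_K H * frac_I_minus (H - 1 / 2) f x))"

definition is_fox_H_process :: "real \<Rightarrow> ((real \<Rightarrow> real) \<Rightarrow> real) measure \<Rightarrow>
    (real \<Rightarrow> ((real \<Rightarrow> real) \<Rightarrow> real) \<Rightarrow> real) \<Rightarrow> bool" where
  "is_fox_H_process H M X \<longleftrightarrow>
     (\<forall>t\<ge>0. is_L2_pairing M (frac_M_minus H (indicator {0..<t})) (X t))"

section \<open>Gaussian processes and finite-dimensional distributions\<close>

definition gaussian_rv :: "'w measure \<Rightarrow> ('w \<Rightarrow> real) \<Rightarrow> bool" where
  "gaussian_rv P Z \<longleftrightarrow> Z \<in> borel_measurable P \<and>
     ((\<exists>c. AE \<omega> in P. Z \<omega> = c) \<or>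
      (\<exists>\<mu> \<sigma>. \<sigma> > 0 \<and> distributed P lborel Z (\<lambda>x. ennreal (normal_density \<mu> \<sigma> x))))"

definition gaussian_process :: "'w measure \<Rightarrow> 't set \<Rightarrow> ('t \<Rightarrow> 'w \<Rightarrow> real) \<Rightarrow> bool" where
  "gaussian_process P T X \<longleftrightarrow>
     (\<forall>I c. finite I \<and> I \<subseteq> T \<longrightarrow> gaussian_rv P (\<lambda>\<omega>. \<Sum>t\<in>I. c t * X t \<omega>))"

definition fractional_Brownian_motion :: "'w measure \<Rightarrow> real \<Rightarrow> (real \<Rightarrow> 'w \<Rightarrow> real) \<Rightarrow> bool" where
  "fractional_Brownian_motion P H B \<longleftrightarrow>
     gaussian_process P {0..} B \<and>
     (\<forall>\<omega>\<in>space P. continuous_on {0..} (\<lambda>t. B t \<omega>)) \<and>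
     (\<forall>t\<ge>0. (LINT \<omega>|P. B t \<omega>) = 0) \<and>
     (\<forall>t\<ge>0. \<forall>s\<ge>0. (LINT \<omega>|P. B t \<omega> * B s \<omega>) =
        1 / 2 * (t powr (2 * H) + s powr (2 * H) - \<bar>t - s\<bar> powr (2 * H)))"

definition same_fdd :: "'t set \<Rightarrow> 'v measure \<Rightarrow> ('t \<Rightarrow> 'v \<Rightarrow> real) \<Rightarrow>
    'w measure \<Rightarrow> ('t \<Rightarrow> 'w \<Rightarrow> real) \<Rightarrow> bool" where
  "same_fdd T M X N Y \<longleftrightarrow>
     (\<forall>t\<in>T. X t \<in> borel_measurable M) \<and> (\<forall>t\<in>T. Y t \<in> borel_measurable N) \<and>
     (\<forall>I. finite I \<and> I \<subseteq> T \<longrightarrow>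
        distr M (Pi\<^sub>M I (\<lambda>_. borel)) (\<lambda>\<omega>. \<lambda>t\<in>I. X t \<omega>) =
        distr N (Pi\<^sub>M I (\<lambda>_. borel)) (\<lambda>\<omega>. \<lambda>t\<in>I. Y t \<omega>))"

end

theory Submission
  imports Defs
begin

text \<open>By the uniqueness theorem for characteristic functions, it suffices that each of the three
  processes satisfies \<open>E exp (i \<Sum> c\<^sub>t Z\<^sub>t) = E exp (- Q(c) Y / 2)\<close>, where \<open>Q\<close> is the covariance form of
  fractional Brownian motion. For the two processes built from \<open>B\<close> this follows by conditioning on
  \<open>Y\<close>, as \<open>Q\<close> is homogeneous of degree \<open>2\<close> in \<open>c\<close> and of degree \<open>2 H\<close> in time. For \<open>X\<close> it follows from
  the characteristic functional of the measure, because the Mandelbrot-Van Ness kernels realize \<open>Q\<close> as a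
  Gram matrix in \<open>L\<^sup>2(\<real>)\<close>, once the Wright function is known to be the Laplace transform of \<open>Y\<close>.

  For the latter, Fubini applies to the Mellin-Barnes integral of the density on the line
  \<open>Re z = \<gamma>\<close> only after multiplication by \<open>\<tau>\<^sup>N\<close> with \<open>N + 1 > \<gamma>\<close>. This yields \<open>E (Y\<^sup>N exp (- s Y))\<close>, whose
  contour integral carries an exponentially decaying factor \<open>\<Gamma>(N + 1 - z)\<close> and so can be moved to
  \<open>Re z = 1 - c\<close>. Integrating \<open>N\<close> times over \<open>[s, \<infinity>)\<close> removes the power of \<open>Y\<close>. Only crude bounds on the
  Gamma function are needed: the kernel is integrable on the line \<open>Re z = \<gamma>\<close>
  since otherwise the density would vanish identically.\<close>


section \<open>The Gamma function on vertical strips\<close>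

text \<open>The obstacle is that the kernel of the density may lack exponential decay: each Gamma
  factor contributes the rate pi/2 times its coefficient, with a sign, and the total is -(pi/2)
  \<open>fox_astar\<close>, which may be 0. Crude bounds therefore do not allow its contour to be
  moved, while the given \<open>\<gamma>\<close> may lie to the right of 1, where the factor Gamma(1
  - z) of the Laplace transform has poles. The weight \<tau>^N repairs this: it pushes the first
  pole to N + 1, and the factor Gamma(N + 1 - z) brings an additional rate -pi/2, of which bounds
  with an arbitrarily small loss in the exponent leave enough.

  For the finite-dimensional laws, uniqueness is reduced to one dimension. There the obstacle is
  that the factors left by the other coordinates are complex weights, while a law needs a
  nonnegative one.

  Conditioning on Y takes place over the sigma-algebra generated by the paths of B, as only this is
  independent of Y. Continuity of the paths then supplies joint measurability in time and
  path.\<close>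

text \<open>Monotonicity of \<open>\<bar>\<Gamma>(x + i y)\<bar> / \<Gamma>(x)\<close> in \<open>x\<close> transfers the exact value of \<open>\<bar>\<Gamma>(1/2 + i y)\<bar>\<close> to vertical
  strips, at the cost of a polynomial factor.\<close>

lemma norm_rGamma_ratio_mono:
  assumes "0 < x" "x \<le> x'"
  shows "norm (rGamma (Complex x' y)) * rGamma x \<le> norm (rGamma (Complex x y)) * rGamma x'"
proof (rule LIMSEQ_le)
  show "(\<lambda>n. norm (rGamma_series (Complex x' y) n) * rGamma_series x n)
      \<longlonglongrightarrow> norm (rGamma (Complex x' y)) * rGamma x"
    by (intro tendsto_intros rGamma_series_LIMSEQ)
  show "(\<lambda>n. norm (rGamma_series (Complex x y) n) * rGamma_series x' n)
      \<longlonglongrightarrow> norm (rGamma (Complex x y)) * rGamma x'"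
    by (intro tendsto_intros rGamma_series_LIMSEQ)
  \<comment> \<open>One factor of Gauss's product. After squaring, the common term (x + k)^2 (x' +
    k)^2 cancels and y^2 (x + k)^2 <= y^2 (x' + k)^2 remains.\<close>
  have *: "norm (Complex x' y + of_nat k) * (x + of_nat k) \<le> norm (Complex x y + of_nat k) * (x' + of_nat k)"
    for k :: nat
  proof (rule power2_le_imp_le)
    have "((x' + k)\<^sup>2 + y\<^sup>2) * (x + k)\<^sup>2 \<le> ((x + k)\<^sup>2 + y\<^sup>2) * (x' + k)\<^sup>2"
      using assms by (simp add: algebra_simps mult_left_mono power_mono)
    then show "(norm (Complex x' y + of_nat k) * (x + of_nat k))\<^sup>2
        \<le> (norm (Complex x y + of_nat k) * (x' + of_nat k))\<^sup>2"
      by (simp add: power_mult_distrib cmod_power2)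
  qed (use assms in auto)
  have **: "norm (pochhammer (Complex x' y) n) * pochhammer x n \<le>
      norm (pochhammer (Complex x y) n) * pochhammer x' n" for n
    unfolding pochhammer_prod prod_norm [symmetric] prod.distrib [symmetric]
    by (rule prod_mono) (use * assms in \<open>auto intro!: mult_nonneg_nonneg\<close>)
  \<comment> \<open>The powers of n have norm \<open>exp (x * ln n)\<close> and
    \<open>exp (x' * ln n)\<close>, so both sides carry the same denominator.\<close>
  have "norm (rGamma_series (Complex x' y) n) * rGamma_series x n \<le>
      norm (rGamma_series (Complex x y) n) * rGamma_series x' n" for n
    using divide_right_mono[OF **[of "n + 1"], of "fact n * fact n * exp (x * ln n) * exp (x' * ln n)"]
    by (simp add: rGamma_series_def norm_divide norm_mult norm_exp_eq_Re mult_ac)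
  then show "\<exists>N. \<forall>n\<ge>N. norm (rGamma_series (Complex x' y) n) * rGamma_series x n \<le>
      norm (rGamma_series (Complex x y) n) * rGamma_series x' n" by blast
qed

text \<open>On Re z = 1/2 the reflection z -> 1 - z is complex conjugation, so the reflection
  formula evaluates \<open>Gamma z * cnj (Gamma z)\<close>.\<close>

lemma norm_Gamma_half_square: "(norm (Gamma (Complex (1/2) y)))\<^sup>2 = pi / cosh (pi * y)"
proof -
  let ?z = "Complex (1/2) y"
  have cnj: "1 - ?z = cnj ?z" by (simp add: complex_eq_iff)
  have "sin (of_real pi * ?z) = sin (of_real (pi/2) + \<i> * of_real (pi * y))"
    by (rule arg_cong[of _ _ sin]) (simp add: complex_eq_iff)
  also have "\<dots> = cos (\<i> * of_real (pi * y))"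
    unfolding sin_add by (subst sin_of_real, subst cos_of_real) simp
  also have "\<dots> = of_real (cosh (pi * y))"
    by (simp add: cosh_def cos_exp_eq exp_of_real flip: of_real_minus of_real_mult)
  finally have s: "sin (of_real pi * ?z) = of_real (cosh (pi * y))" .
  have "of_real ((norm (Gamma ?z))\<^sup>2) = Gamma ?z * cnj (Gamma ?z)"
    by (rule complex_norm_square)
  also have "\<dots> = Gamma ?z * Gamma (1 - ?z)" by (simp only: cnj_Gamma cnj)
  also have "\<dots> = of_real pi / sin (of_real pi * ?z)" by (rule Gamma_reflection_complex)
  also have "\<dots> = of_real (pi / cosh (pi * y))" by (simp add: s)
  finally show ?thesis by (simp only: of_real_eq_iff)
qed

lemma norm_Gamma_half_bounds:
  shows "norm (Gamma (Complex (1/2) y)) \<le> sqrt (2 * pi) * exp (- (pi/2) * \<bar>y\<bar>)"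
    and "norm (rGamma (Complex (1/2) y)) \<le> exp ((pi/2) * \<bar>y\<bar>)"
proof -
  have c: "cosh (pi * y) = (exp (pi * \<bar>y\<bar>) + exp (- (pi * \<bar>y\<bar>))) / 2"
    by (cases "y \<ge> 0") (simp_all add: cosh_field_def)
  have p: "cosh (pi * y) > 0" by (rule cosh_real_pos)
  have e2: "(exp ((pi/2) * \<bar>y\<bar>))\<^sup>2 = exp (pi * \<bar>y\<bar>)"
    by (simp add: power2_eq_square flip: exp_add)
  have "(norm (Gamma (Complex (1/2) y)))\<^sup>2 \<le> 2 * pi / exp (pi * \<bar>y\<bar>)"
    unfolding norm_Gamma_half_square using p by (simp add: field_simps c)
  also have "\<dots> = (sqrt (2 * pi) * exp (- (pi/2) * \<bar>y\<bar>))\<^sup>2"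
    by (simp add: power_mult_distrib exp_minus field_simps e2[symmetric])
  finally show "norm (Gamma (Complex (1/2) y)) \<le> sqrt (2 * pi) * exp (- (pi/2) * \<bar>y\<bar>)"
    by (rule power2_le_imp_le) simp
  have "(norm (rGamma (Complex (1/2) y)))\<^sup>2 = cosh (pi * y) / pi"
    unfolding rGamma_inverse_Gamma norm_inverse power_inverse norm_Gamma_half_square by simp
  also have "\<dots> \<le> exp (pi * \<bar>y\<bar>) / 1"
  proof (rule frac_le)
    have "exp (- (pi * \<bar>y\<bar>)) \<le> exp (pi * \<bar>y\<bar>)" by simp
    then show "cosh (pi * y) \<le> exp (pi * \<bar>y\<bar>)" unfolding c by simp
  qed (use pi_ge_two in auto)
  finally show "norm (rGamma (Complex (1/2) y)) \<le> exp ((pi/2) * \<bar>y\<bar>)"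
    unfolding div_by_1 e2[symmetric] by (rule power2_le_imp_le) simp
qed

section \<open>Calculus of exponential rates on vertical strips\<close>

text \<open>A negative \<open>\<theta>\<close> expresses decay. Polynomial factors are not recorded:
  they cost an arbitrarily small increase of the rate, so that rates simply add under
  products.\<close>

definition strip_bound :: "real \<Rightarrow> real \<Rightarrow> real \<Rightarrow> (complex \<Rightarrow> complex) \<Rightarrow> bool" where
  "strip_bound l u \<theta> f \<longleftrightarrow>
     (\<exists>C\<ge>0. \<forall>x y. l \<le> x \<longrightarrow> x \<le> u \<longrightarrow> norm (f (Complex x y)) \<le> C * exp (\<theta> * \<bar>y\<bar>))"

lemma strip_boundI:
  assumes "\<And>x y. l \<le> x \<Longrightarrow> x \<le> u \<Longrightarrow> norm (f (Complex x y)) \<le> C * exp (\<theta> * \<bar>y\<bar>)"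
  shows "strip_bound l u \<theta> f"
proof -
  have "norm (f (Complex x y)) \<le> \<bar>C\<bar> * exp (\<theta> * \<bar>y\<bar>)" if "l \<le> x" "x \<le> u" for x y
    by (rule order_trans[OF assms[OF that]]) (simp add: mult_right_mono)
  then show ?thesis unfolding strip_bound_def by (intro exI[of _ "\<bar>C\<bar>"]) auto
qed

lemma strip_boundE:
  assumes "strip_bound l u \<theta> f"
  obtains C where "C \<ge> 0" "\<And>x y. l \<le> x \<Longrightarrow> x \<le> u \<Longrightarrow> norm (f (Complex x y)) \<le> C * exp (\<theta> * \<bar>y\<bar>)"
  using assms that unfolding strip_bound_def by (elim exE conjE) simp

lemma strip_bound_mult:
  assumes "strip_bound l u \<theta> f" "strip_bound l u \<eta> g"
  shows "strip_bound l u (\<theta> + \<eta>) (\<lambda>z. f z * g z)"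
proof -
  from assms(1) obtain C where C: "C \<ge> 0" "\<And>x y. l \<le> x \<Longrightarrow> x \<le> u \<Longrightarrow> norm (f (Complex x y)) \<le> C * exp (\<theta> * \<bar>y\<bar>)"
    by (rule strip_boundE) (rule that)
  from assms(2) obtain D where D: "D \<ge> 0" "\<And>x y. l \<le> x \<Longrightarrow> x \<le> u \<Longrightarrow> norm (g (Complex x y)) \<le> D * exp (\<eta> * \<bar>y\<bar>)"
    by (rule strip_boundE) (rule that)
  show ?thesis
  proof (rule strip_boundI[of _ _ _ "C * D"])
    fix x y assume "l \<le> x" "x \<le> u"
    with mult_mono[OF C(2) D(2), of x x y y] C(1)
    show "norm (f (Complex x y) * g (Complex x y)) \<le> C * D * exp ((\<theta> + \<eta>) * \<bar>y\<bar>)"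
      by (simp add: norm_mult exp_add distrib_right distrib_left mult_ac)
  qed
qed

lemma strip_bound_const: "strip_bound l u 0 (\<lambda>_. c)"
  by (rule strip_boundI[of _ _ _ "norm c"]) simp

lemma strip_bound_prod:
  assumes "finite I" "\<And>i. i \<in> I \<Longrightarrow> strip_bound l u (\<theta> i) (f i)"
  shows "strip_bound l u (\<Sum>i\<in>I. \<theta> i) (\<lambda>z. \<Prod>i\<in>I. f i z)"
  using assms by (induction I rule: finite_induct) (auto intro!: strip_bound_const strip_bound_mult)

text \<open>Only the imaginary part enters the rate: the real shift is free, and
  \<open>\<beta>\<close> dilates it.\<close>

lemma strip_bound_affine:
  assumes "strip_bound l' u' \<theta> f"
    and "\<And>x. l \<le> x \<Longrightarrow> x \<le> u \<Longrightarrow> l' \<le> a + \<beta> * x \<and> a + \<beta> * x \<le> u'"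
  shows "strip_bound l u (\<theta> * \<bar>\<beta>\<bar>) (\<lambda>z. f (of_real a + of_real \<beta> * z))"
proof -
  from assms(1) obtain C where C: "C \<ge> 0" "\<And>x y. l' \<le> x \<Longrightarrow> x \<le> u' \<Longrightarrow> norm (f (Complex x y)) \<le> C * exp (\<theta> * \<bar>y\<bar>)"
    by (rule strip_boundE) (rule that)
  have eq: "of_real a + of_real \<beta> * Complex x y = Complex (a + \<beta> * x) (\<beta> * y)" for x y
    by (simp add: complex_eq_iff)
  show ?thesis
  proof (rule strip_boundI[of _ _ _ C])
    fix x y assume "l \<le> x" "x \<le> u"
    with C(2)[of "a + \<beta> * x" "\<beta> * y"] assms(2)
    show "norm (f (of_real a + of_real \<beta> * Complex x y)) \<le> C * exp (\<theta> * \<bar>\<beta>\<bar> * \<bar>y\<bar>)"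
      by (simp add: eq abs_mult mult.assoc)
  qed
qed

lemma strip_bound_shift:
  assumes "strip_bound (l + a) (u + a) \<theta> f"
  shows "strip_bound l u \<theta> (\<lambda>z. f (z + of_real a))"
  using strip_bound_affine[OF assms, of l u a 1] by (simp add: add.commute)

text \<open>Linear growth fits under any positive rate because \<open>\<epsilon> * \<bar>y\<bar>
  \<le> exp (\<epsilon> * \<bar>y\<bar>)\<close>; hence the summand \<open>1 / \<epsilon>\<close> in
  the constant.\<close>

lemma strip_bound_linear:
  assumes "\<epsilon> > 0"
  shows "strip_bound l u \<epsilon> (\<lambda>z. z + w)"
proof (rule strip_boundI[of _ _ _ "\<bar>l\<bar> + \<bar>u\<bar> + norm w + 1 / \<epsilon>"])
  fix x y assume x: "l \<le> x" "x \<le> u"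
  have "norm (Complex x y + w) \<le> \<bar>x\<bar> + \<bar>y\<bar> + norm w"
    using cmod_le[of "Complex x y"] norm_triangle_ineq[of "Complex x y" w] by simp
  also have "\<dots> \<le> (\<bar>l\<bar> + \<bar>u\<bar> + norm w) * 1 + 1 / \<epsilon> * (\<epsilon> * \<bar>y\<bar>)"
    using x assms by simp
  also have "\<dots> \<le> (\<bar>l\<bar> + \<bar>u\<bar> + norm w) * exp (\<epsilon> * \<bar>y\<bar>) + 1 / \<epsilon> * exp (\<epsilon> * \<bar>y\<bar>)"
  proof (intro add_mono mult_left_mono)
    show "\<epsilon> * \<bar>y\<bar> \<le> exp (\<epsilon> * \<bar>y\<bar>)" using exp_ge_add_one_self[of "\<epsilon> * \<bar>y\<bar>"] by linarith
  qed (use assms in auto)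
  finally show "norm (Complex x y + w) \<le> (\<bar>l\<bar> + \<bar>u\<bar> + norm w + 1 / \<epsilon>) * exp (\<epsilon> * \<bar>y\<bar>)"
    by (simp add: distrib_right)
qed

lemma strip_bound_pochhammer:
  assumes "\<epsilon> > 0"
  shows "strip_bound l u \<epsilon> (\<lambda>z. pochhammer z n)"
proof (cases "n = 0")
  case True
  have "strip_bound l u (0 + \<epsilon>) (\<lambda>z. 1)"
    by (rule strip_boundI[of _ _ _ 1]) (use assms in simp)
  with True show ?thesis by simp
next
  case False
  \<comment> \<open>The budget \<open>\<epsilon>\<close> is shared equally by the n linear factors,
    which is why n = 0 is treated apart.\<close>
  then have "strip_bound l u (\<Sum>i\<in>{0..<n}. \<epsilon> / n) (\<lambda>z. \<Prod>i\<in>{0..<n}. z + of_nat i)"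
    using assms by (intro strip_bound_prod strip_bound_linear) auto
  then show ?thesis using False by (simp add: pochhammer_prod)
qed

text \<open>The ratio comparison bounds \<open>rGamma\<close> by its values on a line further to the
  left. The strip is therefore first moved to the right of 1/2, and the recurrence of
  \<open>rGamma\<close> brings it back at the cost of the excess
  \<open>\<theta> - pi/2\<close>.\<close>

lemma strip_bound_rGamma:
  assumes "\<theta> > pi/2"
  shows "strip_bound l u \<theta> rGamma"
proof -
  obtain n :: nat where n: "l + n \<ge> 1/2" 
    using real_arch_simple[of "1/2 - l"] by (auto simp: algebra_simps)
  have "compact (rGamma ` {l + n..u + n})"
    by (intro compact_continuous_image continuous_intros) auto
  then obtain D where D: "\<And>x. l + n \<le> x \<Longrightarrow> x \<le> u + n \<Longrightarrow> norm (rGamma x) \<le> (D :: real)"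
    by (meson atLeastAtMost_iff bounded_iff compact_imp_bounded imageI)
  have "strip_bound (l + n) (u + n) (pi/2) rGamma"
  proof (rule strip_boundI[of _ _ _ "D / rGamma (1/2)"])
    fix x y assume x: "l + real n \<le> x" "x \<le> u + real n"
    have r: "rGamma (1/2 :: real) > 0" by (simp add: rGamma_inverse_Gamma Gamma_real_pos)
    have "norm (rGamma (Complex x y)) * rGamma (1/2) \<le> norm (rGamma (Complex (1/2) y)) * rGamma x"
      using x n by (intro norm_rGamma_ratio_mono) auto
    also have "\<dots> \<le> exp ((pi/2) * \<bar>y\<bar>) * D"
      using norm_Gamma_half_bounds(2)[of y] D[OF x] x n
      by (intro mult_mono) (auto simp: rGamma_inverse_Gamma Gamma_real_pos less_imp_le)
    finally show "norm (rGamma (Complex x y)) \<le> D / rGamma (1/2) * exp ((pi/2) * \<bar>y\<bar>)"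
      using r by (simp add: field_simps)
  qed
  then have "strip_bound l u (pi/2) (\<lambda>z. rGamma (z + of_real (real n)))" by (rule strip_bound_shift)
  with strip_bound_pochhammer[of "\<theta> - pi/2" l u n] assms
  have "strip_bound l u (\<theta> - pi/2 + pi/2) (\<lambda>z. pochhammer z n * rGamma (z + of_nat n))"
    by (intro strip_bound_mult) auto
  then show ?thesis by (simp add: pochhammer_rGamma[symmetric])
qed


lemma Re_pos_not_nonpos_Int: "Re z > 0 \<Longrightarrow> z \<notin> \<int>\<^sub>\<le>\<^sub>0"
  by (auto elim!: nonpos_Ints_cases)

lemma strip_bound_Gamma:
  assumes "\<theta> > -pi/2" "l > 0"
  shows "strip_bound l u \<theta> Gamma"
proof -
  have \<theta>: "\<theta> + pi/2 > 0" using assms by simp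
  obtain n :: nat where n: "1/2 + n \<ge> u"
    using real_arch_simple[of "u - 1/2"] by (auto simp: algebra_simps)
  have "compact (Gamma ` {l..u})"
    using assms(2) by (intro compact_continuous_image continuous_intros) (auto dest: nonpos_Ints_nonpos)
  then obtain D where D: "\<And>x. l \<le> x \<Longrightarrow> x \<le> u \<Longrightarrow> norm (Gamma x) \<le> (D :: real)"
    by (meson atLeastAtMost_iff bounded_iff compact_imp_bounded imageI)
  \<comment> \<open>The strip degenerates to the line Re z = 1/2; the slack
    \<open>\<theta> + pi/2\<close> pays for the polynomial factor.\<close>
  obtain E where E: "E \<ge> 0" "\<And>x y. 1/2 \<le> x \<Longrightarrow> x \<le> 1/2 \<Longrightarrow>
      norm (pochhammer (Complex x y) n) \<le> E * exp ((\<theta> + pi/2) * \<bar>y\<bar>)"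
    by (rule strip_boundE[OF strip_bound_pochhammer[OF \<theta>]]) (rule that)
  define r where "r = rGamma (1/2 + n :: real)"
  have r: "r > 0" by (simp add: r_def rGamma_inverse_Gamma)
  show ?thesis
  proof (rule strip_boundI[of _ _ _ "D * r * E * sqrt (2 * pi)"])
    fix x y assume x: "l \<le> x" "x \<le> u"
    have x0: "x > 0" using x assms by linarith
    have G: "Gamma x > 0" by (rule Gamma_real_pos[OF x0])
    define h w where "h = Complex (1/2) y" and "w = Complex (1/2 + n) y"
    define z where "z = Complex x y"
    have zn: "w = h + of_nat n" by (simp add: complex_eq_iff h_def w_def)
    have "h \<notin> \<int>\<^sub>\<le>\<^sub>0" "w \<notin> \<int>\<^sub>\<le>\<^sub>0" "z \<notin> \<int>\<^sub>\<le>\<^sub>0"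
      using x0 by (auto intro!: Re_pos_not_nonpos_Int simp: h_def w_def z_def)
    then have rn: "rGamma w \<noteq> 0" "rGamma z \<noteq> 0" "rGamma h \<noteq> 0"
      by (simp_all add: rGamma_eq_zero_iff)
    have "norm (rGamma w) * rGamma x \<le> norm (rGamma z) * r"
      unfolding r_def z_def w_def using x n x0 by (intro norm_rGamma_ratio_mono) auto
    then have "norm (rGamma w) / Gamma x \<le> norm (rGamma z) * r"
      by (simp only: rGamma_inverse_Gamma[of x] divide_inverse)
    then have "inverse (norm (rGamma z)) \<le> Gamma x * r * inverse (norm (rGamma w))"
      using G rn by (simp add: field_simps)
    then have "norm (Gamma z) \<le> Gamma x * r * norm (Gamma w)"
      by (simp only: Gamma_def norm_inverse)
    also have "Gamma w = pochhammer h n * Gamma h"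
    proof -
      have e: "rGamma h = pochhammer h n * rGamma w" unfolding zn by (rule pochhammer_rGamma)
      with rn have "pochhammer h n \<noteq> 0" by auto
      with rn show ?thesis unfolding Gamma_def e by simp
    qed
    also have "Gamma x * r * norm (pochhammer h n * Gamma h) \<le>
        D * r * ((E * exp ((\<theta> + pi/2) * \<bar>y\<bar>)) * (sqrt (2 * pi) * exp (- (pi/2) * \<bar>y\<bar>)))"
    proof (rule mult_mono)
      show "norm (pochhammer h n * Gamma h) \<le>
          (E * exp ((\<theta> + pi/2) * \<bar>y\<bar>)) * (sqrt (2 * pi) * exp (- (pi/2) * \<bar>y\<bar>))"
        unfolding norm_mult h_def
        by (rule mult_mono[OF E(2) norm_Gamma_half_bounds(1)]) (use E(1) in auto)
      show "Gamma x * r \<le> D * r"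
        using D[OF x] r by (intro mult_right_mono) auto
      show "0 \<le> D * r"
        using order_trans[OF norm_ge_zero D[OF x]] r by (intro mult_nonneg_nonneg) auto
    qed auto
    also have "\<dots> = D * r * E * sqrt (2 * pi) * exp ((\<theta> + pi/2) * \<bar>y\<bar> + - (pi/2) * \<bar>y\<bar>)"
      unfolding exp_add by (simp only: mult_ac)
    also have "(\<theta> + pi/2) * \<bar>y\<bar> + - (pi/2) * \<bar>y\<bar> = \<theta> * \<bar>y\<bar>" by (simp add: algebra_simps)
    finally show "norm (Gamma (Complex x y)) \<le> D * r * E * sqrt (2 * pi) * exp (\<theta> * \<bar>y\<bar>)"
      unfolding z_def .
  qed
qed

section \<open>Integrals along vertical lines and contour shifts\<close>

text \<open>The terms 1 and (\<theta> |y|)^2 / 2 of the exponential series dominate 1 + y^2 up to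
  the factor 1 + 2 / \<theta>^2, which gives an integrable majorant.\<close>

lemma integrable_exp_abs:
  assumes "\<theta> > 0"
  shows "integrable lborel (\<lambda>y. exp (- \<theta> * \<bar>y\<bar>) :: real)"
proof -
  have i: "integrable lborel (\<lambda>y. (1 + 2 / \<theta>\<^sup>2) * inverse (1 + y\<^sup>2) :: real)"
    using integrable_inverse_1_plus_square by (simp add: set_integrable_def)
  show ?thesis
  proof (rule Bochner_Integration.integrable_bound[OF i])
    show "AE y in lborel. norm (exp (- \<theta> * \<bar>y\<bar>)) \<le> norm ((1 + 2 / \<theta>\<^sup>2) * inverse (1 + y\<^sup>2))"
    proof (rule AE_I2)
      fix y :: real
      have q: "1 + \<theta> * \<bar>y\<bar> + (\<theta> * \<bar>y\<bar>)\<^sup>2 / 2 \<le> exp (\<theta> * \<bar>y\<bar>)"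
        using assms by (intro exp_lower_Taylor_quadratic) simp
      have "1 \<le> exp (\<theta> * \<bar>y\<bar>)" using assms by simp
      moreover have "y\<^sup>2 \<le> 2 / \<theta>\<^sup>2 * exp (\<theta> * \<bar>y\<bar>)"
      proof -
        have "\<theta>\<^sup>2 * y\<^sup>2 / 2 \<le> exp (\<theta> * \<bar>y\<bar>)" 
          using q mult_nonneg_nonneg[of \<theta> "\<bar>y\<bar>"] assms unfolding power_mult_distrib power2_abs
          by linarith
        then show ?thesis using assms by (simp add: field_simps)
      qed
      ultimately have "1 + y\<^sup>2 \<le> (1 + 2 / \<theta>\<^sup>2) * exp (\<theta> * \<bar>y\<bar>)"
        unfolding distrib_right mult_1_left by (rule add_mono)
      moreover have "1 + y\<^sup>2 > 0" by (simp add: add_pos_nonneg)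
      ultimately have "exp (- \<theta> * \<bar>y\<bar>) \<le> (1 + 2 / \<theta>\<^sup>2) * inverse (1 + y\<^sup>2)"
        by (simp add: exp_minus field_simps)
      then show "norm (exp (- \<theta> * \<bar>y\<bar>)) \<le> norm ((1 + 2 / \<theta>\<^sup>2) * inverse (1 + y\<^sup>2))"
        by (simp add: abs_of_nonneg)
    qed
  qed simp
qed

lemma strip_bound_integrable:
  assumes "strip_bound l u (- \<theta>) F" "\<theta> > 0" "l \<le> x" "x \<le> u"
    and [measurable]: "(\<lambda>y. F (Complex x y)) \<in> borel_measurable lborel"
  shows "integrable lborel (\<lambda>y. F (Complex x y))"
proof -
  obtain C where C: "C \<ge> 0" "\<And>x y. l \<le> x \<Longrightarrow> x \<le> u \<Longrightarrow> norm (F (Complex x y)) \<le> C * exp (- \<theta> * \<bar>y\<bar>)"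
    using assms(1) by (rule strip_boundE) (rule that)
  have "integrable lborel (\<lambda>y. C * exp (- \<theta> * \<bar>y\<bar>))"
    by (intro integrable_mult_right integrable_exp_abs assms)
  then show ?thesis
    by (rule Bochner_Integration.integrable_bound) (use C assms in \<open>auto intro!: AE_I2\<close>)
qed

lemma continuous_on_Complex_line:
  assumes "continuous_on S F" "\<And>y. Complex x y \<in> S"
  shows "continuous_on A (\<lambda>y. F (Complex x y))"
proof -
  have "continuous_on A (\<lambda>y. of_real x + \<i> * of_real y :: complex)"
    by (intro continuous_intros)
  moreover have "(\<lambda>y. of_real x + \<i> * of_real y) = Complex x"
    by (auto simp: complex_eq_iff)
  ultimately have "continuous_on A (Complex x)" by (simp only:)
  from continuous_on_compose2[OF assms(1) this] assms(2) show ?thesis by auto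
qed

text \<open>Cauchy's theorem on rectangles of height 2 n; the horizontal edges contribute O(exp (-
  \<theta> n)).\<close>

lemma vertical_line_shift:
  assumes hol: "F holomorphic_on {z. l \<le> Re z \<and> Re z \<le> u}" and le: "l \<le> u"
    and sb: "strip_bound l u (- \<theta>) F" and \<theta>: "\<theta> > 0"
  shows "(LINT y|lborel. F (Complex l y)) = (LINT y|lborel. F (Complex u y))"
proof -
  let ?S = "{z. l \<le> Re z \<and> Re z \<le> u}"
  obtain C where C: "C \<ge> 0" "\<And>x y. l \<le> x \<Longrightarrow> x \<le> u \<Longrightarrow> norm (F (Complex x y)) \<le> C * exp (- \<theta> * \<bar>y\<bar>)"
    using sb by (rule strip_boundE) (rule that)
  have cont: "continuous_on ?S F" using hol by (rule holomorphic_on_imp_continuous_on)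
  have cl: "continuous_on A (\<lambda>y. F (Complex x y))" if "l \<le> x" "x \<le> u" for x A
    by (rule continuous_on_Complex_line[OF cont]) (use that in auto)
  have conv: "convex ?S"
    by (intro convex_Int[of "{z. l \<le> Re z}" "{z. Re z \<le> u}", simplified Int_def mem_Collect_eq]
        convex_halfspace_Re_ge convex_halfspace_Re_le)
  \<comment> \<open>The gauge integral is used here, since contour integrals over vertical segments
    are expressed by it; \<open>lim\<close> identifies its limit with the Lebesgue integral.\<close>
  define J where "J n x = integral {-real n..real n} (\<lambda>y. F (Complex x y))" for n x
  have lim: "(\<lambda>n. J n x) \<longlonglongrightarrow> (LINT y|lborel. F (Complex x y))" if x: "l \<le> x" "x \<le> u" for x
  proof -
    have [measurable]: "(\<lambda>y. F (Complex x y)) \<in> borel_measurable borel"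
      by (rule borel_measurable_continuous_onI[OF cl[OF x]])
    have int: "integrable lborel (\<lambda>y. F (Complex x y))"
      by (rule strip_bound_integrable[OF sb \<theta> x]) simp
    have J: "J n x = (LINT y|lborel. indicator {-real n..real n} y *\<^sub>R F (Complex x y))" for n
      using set_borel_integral_eq_integral(2)[OF set_integrable_subset[of lborel UNIV "\<lambda>y. F (Complex x y)" "{-real n..real n}"]] int
      by (simp add: J_def set_lebesgue_integral_def set_integrable_def)
    show ?thesis unfolding J
    proof (rule integral_dominated_convergence[where w = "\<lambda>y. norm (F (Complex x y))"])
      show "AE y in lborel. (\<lambda>n. indicator {-real n..real n} y *\<^sub>R F (Complex x y)) \<longlonglongrightarrow> F (Complex x y)"
      proof (rule AE_I2)
        fix y :: real
        obtain N :: nat where N: "\<bar>y\<bar> \<le> N" using real_arch_simple by blast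
        have "eventually (\<lambda>n. indicator {-real n..real n} y *\<^sub>R F (Complex x y) = F (Complex x y)) sequentially"
          using eventually_ge_at_top[of N]
        proof eventually_elim
          case (elim n)
          then have "\<bar>y\<bar> \<le> n" using N by linarith
          then show ?case by (simp add: indicator_def abs_le_iff)
        qed
        then show "(\<lambda>n. indicator {-real n..real n} y *\<^sub>R F (Complex x y)) \<longlonglongrightarrow> F (Complex x y)"
          by (rule tendsto_eventually)
      qed
      show "AE y in lborel. norm (indicator {- real n..real n} y *\<^sub>R F (Complex x y)) \<le> norm (F (Complex x y))" for n
        by (rule AE_I2) (simp add: indicator_def)
    qed (use int in auto)
  qed
  \<comment> \<open>The factor 2 counts the horizontal edges, of length u - l and at height |Im z| =
    n. With \<open>n > 0\<close> the vertical edges are nondegenerate.\<close>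
  have bound: "norm (J n u - J n l) \<le> 2 * (C * exp (- \<theta> * n) * (u - l))" if n: "n > 0" for n
  proof -
    let ?a = "Complex l (- real n)" and ?b = "Complex u (- real n)"
    let ?c = "Complex u n" and ?d = "Complex l n"
    have seg: "closed_segment z w \<subseteq> ?S" if "z \<in> ?S" "w \<in> ?S" for z w
      using conv that by (rule closed_segment_subset[rotated 2])
    have ci: "F contour_integrable_on linepath z w" if "z \<in> ?S" "w \<in> ?S" for z w
      by (rule contour_integrable_continuous_linepath)
        (use cont continuous_on_subset seg[OF that] in blast)
    have in_S: "?a \<in> ?S" "?b \<in> ?S" "?c \<in> ?S" "?d \<in> ?S" using le by auto
    have rect: "rectpath ?a ?c = linepath ?a ?b +++ linepath ?b ?c +++ linepath ?c ?d +++ linepath ?d ?a"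
      by (simp add: rectpath_def Let_def)
    have "(F has_contour_integral 0) (rectpath ?a ?c)"
    proof (rule Cauchy_theorem_convex_simple[OF hol conv])
      show "path_image (rectpath ?a ?c) \<subseteq> ?S"
        unfolding rect using seg in_S by (auto simp: path_image_join)
    qed auto
    then have "contour_integral (rectpath ?a ?c) F = 0" by (rule contour_integral_unique)
    then have sum: "contour_integral (linepath ?a ?b) F + (contour_integral (linepath ?b ?c) F +
        (contour_integral (linepath ?c ?d) F + contour_integral (linepath ?d ?a) F)) = 0"
      unfolding rect using ci in_S by (simp add: contour_integrable_join)
    have v1: "contour_integral (linepath ?b ?c) F = \<i> * J n u"
      unfolding J_def by (rule contour_integral_linepath_same_Re) (use n in auto)
    have "contour_integral (linepath ?a ?d) F = \<i> * J n l"
      unfolding J_def by (rule contour_integral_linepath_same_Re) (use n in auto)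
    then have v2: "contour_integral (linepath ?d ?a) F = - (\<i> * J n l)"
      using contour_integral_reverse_linepath[OF continuous_on_subset[OF cont seg[OF in_S(1,4)]]]
      by (metis minus_minus)
    have h: "norm (contour_integral (linepath z w) F) \<le> C * exp (- \<theta> * n) * (u - l)"
      if zw: "z \<in> ?S" "w \<in> ?S" "Im z = Im w" "\<bar>Im z\<bar> = n" "\<bar>Re w - Re z\<bar> = u - l" for z w
    proof -
      have "norm (F x) \<le> C * exp (- \<theta> * n)" if xs: "x \<in> closed_segment z w" for x
      proof -
        have "x \<in> ?S" using seg[OF zw(1,2)] xs by blast
        moreover have "Im x = Im z"
        proof -
          obtain v where "x = (1 - v) *\<^sub>R z + v *\<^sub>R w" using xs by (auto simp: in_segment)
          then have "Im x = (1 - v) * Im z + v * Im z" using zw(3) by simp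
          then show ?thesis by (simp add: left_diff_distrib)
        qed
        ultimately show ?thesis using C(2)[of "Re x" "Im x", unfolded complex_surj] zw(4) by simp
      qed
      then have "norm (contour_integral (linepath z w) F) \<le> C * exp (- \<theta> * n) * norm (w - z)"
        using C(1) by (intro contour_integral_bound_linepath ci zw) auto
      moreover have "norm (w - z) = u - l" using zw(3,5) by (simp add: cmod_def)
      ultimately show ?thesis by simp
    qed
    have "\<i> * (J n u - J n l) = - (contour_integral (linepath ?a ?b) F + contour_integral (linepath ?c ?d) F)"
      using sum unfolding v1 v2 by (simp add: algebra_simps eq_neg_iff_add_eq_0)
    then have "norm (\<i> * (J n u - J n l)) = norm (contour_integral (linepath ?a ?b) F + contour_integral (linepath ?c ?d) F)"
      by (simp only: norm_minus_cancel)
    also have "\<dots> \<le> C * exp (- \<theta> * n) * (u - l) + C * exp (- \<theta> * n) * (u - l)"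
      by (intro norm_triangle_le add_mono h) (use le in auto)
    finally show ?thesis by (simp add: norm_mult mult_ac)
  qed
  have "(\<lambda>n. 2 * (C * exp (- \<theta> * real n) * (u - l))) \<longlonglongrightarrow> 0"
    using \<theta> by real_asymp
  moreover have "eventually (\<lambda>n. norm (J n u - J n l) \<le> 2 * (C * exp (- \<theta> * n) * (u - l))) sequentially"
    using eventually_gt_at_top[of 0] by eventually_elim (rule bound)
  ultimately have "(\<lambda>n. J n u - J n l) \<longlonglongrightarrow> 0"
    by (rule Lim_null_comparison[rotated])
  moreover have "(\<lambda>n. J n u - J n l) \<longlonglongrightarrow> (LINT y|lborel. F (Complex u y)) - (LINT y|lborel. F (Complex l y))"
    by (intro tendsto_diff lim) (use le in auto)
  ultimately show ?thesis using LIMSEQ_unique by fastforce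
qed

section \<open>Mellin-Barnes integrals and the Laplace transform of the Fox-H density\<close>

lemma complex_powr_of_real_pos: "x > 0 \<Longrightarrow> of_real x powr w = exp (w * of_real (ln x))" for w :: complex
  by (simp add: powr_def Ln_of_real)

text \<open>Euler's integral under the dilation \<tau> -> s \<tau>. Powers are written as
  exponentials of a multiple of \<open>ln\<close>, which makes measurability and norms
  immediate.\<close>

lemma has_bochner_integral_Gamma:
  assumes z: "Re z > 0" and s: "s > 0"
  shows "has_bochner_integral lborel
      (\<lambda>\<tau>. indicator {0<..} \<tau> *\<^sub>R (exp ((z - 1) * of_real (ln \<tau>)) * of_real (exp (- s * \<tau>))))
      (Gamma z * exp (- z * of_real (ln s)))"
proof -
  let ?g = "\<lambda>\<tau>::real. indicator {0<..} \<tau> *\<^sub>R (exp ((z - 1) * of_real (ln \<tau>)) * of_real (exp (- \<tau>)))"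
  let ?f = "\<lambda>t. of_real t powr (z - 1) / of_real (exp t)"
  have eq: "?g = (\<lambda>t. indicator {0<..} t *\<^sub>R ?f t)"
    by (auto simp: fun_eq_iff indicator_def complex_powr_of_real_pos exp_minus divide_inverse simp flip: exp_of_real)
  have m: "?g \<in> borel_measurable lborel" by measurable
  have ai: "set_integrable lebesgue {0<..} ?f" by (rule absolutely_integrable_Gamma_integral'[OF z])
  then have "integrable (completion lborel) ?g" by (simp only: eq set_integrable_def)
  then have int: "integrable lborel ?g" using integrable_completion[OF m] by simp
  have "integral\<^sup>L lborel ?g = integral\<^sup>L (completion lborel) ?g" by (rule integral_completion[OF m, symmetric])
  also have "\<dots> = (LINT t:{0<..}|lebesgue. ?f t)" by (simp only: eq set_lebesgue_integral_def)
  also have "\<dots> = integral {0<..} ?f" by (rule set_lebesgue_integral_eq_integral(2)[OF ai])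
  also have "\<dots> = Gamma z" using Gamma_integral_complex'[OF z] by (rule integral_unique)
  finally have "has_bochner_integral lborel ?g (Gamma z)" using int by (simp add: has_bochner_integral_iff)
  then have "has_bochner_integral lborel (\<lambda>\<tau>. ?g (0 + s * \<tau>)) (Gamma z /\<^sub>R \<bar>s\<bar>)"
    using s by (subst lborel_has_bochner_integral_real_affine_iff[symmetric]) auto
  \<comment> \<open>The integrand has gained s^(z-1) and the integral 1/s; multiplying by s^(1-z)
    clears the former and leaves s^(-z) in the latter.\<close>
  then have "has_bochner_integral lborel (\<lambda>\<tau>. exp ((1 - z) * of_real (ln s)) * ?g (0 + s * \<tau>))
      (exp ((1 - z) * of_real (ln s)) * (Gamma z /\<^sub>R \<bar>s\<bar>))"
    by (intro has_bochner_integral_mult_right)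
  also have "exp ((1 - z) * of_real (ln s)) * (Gamma z /\<^sub>R \<bar>s\<bar>) = Gamma z * exp (- z * of_real (ln s))"
    using s by (simp add: scaleR_conv_of_real left_diff_distrib exp_diff exp_of_real exp_minus field_simps)
  also have "(\<lambda>\<tau>. exp ((1 - z) * of_real (ln s)) * ?g (0 + s * \<tau>)) =
      (\<lambda>\<tau>. indicator {0<..} \<tau> *\<^sub>R (exp ((z - 1) * of_real (ln \<tau>)) * of_real (exp (- s * \<tau>))))"
  proof
    fix \<tau> :: real
    show "exp ((1 - z) * of_real (ln s)) * ?g (0 + s * \<tau>) =
        indicator {0<..} \<tau> *\<^sub>R (exp ((z - 1) * of_real (ln \<tau>)) * of_real (exp (- s * \<tau>)))"
    proof (cases "\<tau> > 0")
      case True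
      with s have "exp ((1 - z) * of_real (ln s)) * exp ((z - 1) * of_real (ln (s * \<tau>))) =
          exp ((z - 1) * of_real (ln \<tau>))"
        by (simp add: ln_mult ring_distribs flip: exp_add)
      with True s show ?thesis by (simp add: zero_less_mult_iff flip: mult.assoc)
    qed (use s in \<open>simp add: zero_less_mult_iff\<close>)
  qed
  finally show ?thesis .
qed

text \<open>The antiderivative v^w / w vanishes at infinity. With w = z - N - 1 this is the
  integration in s on the contour side, and the factor -1/w lowers Gamma(N + 2 - z) to Gamma(N + 1 -
  z).\<close>

lemma has_bochner_integral_powr_to_inf:
  assumes w: "Re w < 0" and s: "s > 0"
  shows "has_bochner_integral lborel
      (\<lambda>v. indicator {s<..} v *\<^sub>R exp ((w - 1) * of_real (ln v))) (- exp (w * of_real (ln s)) / w)"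
    (is "has_bochner_integral _ (\<lambda>v. indicator _ v *\<^sub>R ?f v) _")
proof -
  have w0: "w \<noteq> 0" using w by auto
  have n: "norm (?f v) = v powr (Re w - 1)" if "v > 0" for v
    using that by (simp add: norm_exp_eq_Re powr_def)
  have "((\<lambda>v. v powr (Re w - 1)) has_integral - (s powr (Re w)) / Re w) {s..}"
    using has_integral_powr_to_inf[of "Re w - 1" s] w s by simp
  then have "(\<lambda>v. v powr (Re w - 1)) absolutely_integrable_on {s..}"
    by (intro nonnegative_absolutely_integrable_1) (auto simp: integrable_on_def)
  then have "set_integrable lebesgue {s<..} (\<lambda>v. v powr (Re w - 1))"
    by (rule set_integrable_subset) auto
  then have "set_integrable lborel {s<..} (\<lambda>v. v powr (Re w - 1))"
    unfolding set_integrable_def by (subst (asm) integrable_completion) auto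
  then have int: "set_integrable lborel {s<..} ?f"
  proof (rule set_integrable_bound)
    show "set_borel_measurable lborel {s<..} ?f" unfolding set_borel_measurable_def by measurable
    show "AE v in lborel. v \<in> {s<..} \<longrightarrow> norm (?f v) \<le> norm (v powr (Re w - 1))"
      using n s by (intro AE_I2) auto
  qed
  let ?F = "\<lambda>v. exp (w * of_real (ln v)) / w"
  have lim0: "(?F \<longlongrightarrow> 0) at_top"
  proof (rule Lim_null_comparison)
    show "eventually (\<lambda>v. norm (?F v) \<le> v powr Re w / norm w) at_top"
      using eventually_gt_at_top[of 0]
      by eventually_elim (simp add: norm_divide norm_exp_eq_Re powr_def)
    have "((\<lambda>v. v powr Re w) \<longlongrightarrow> 0) at_top" using w by (intro tendsto_neg_powr filterlim_ident)
    from tendsto_divide[OF this tendsto_const, of "norm w"] w0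
    show "((\<lambda>v. v powr Re w / norm w) \<longlongrightarrow> 0) at_top" by simp
  qed
  have "(LBINT v=ereal s..\<infinity>. ?f v) = 0 - ?F s"
  proof (rule interval_integral_FTC_integrable)
    fix v assume "ereal s < ereal v" "ereal v < \<infinity>"
    then have v: "v > 0" using s by simp
    have "((\<lambda>u. of_real (ln u) :: complex) has_vector_derivative of_real (1 / v)) (at v)"
      using DERIV_ln_divide[OF v] by (intro has_vector_derivative_of_real) simp
    moreover have "((\<lambda>u. exp (w * u) / w) has_field_derivative exp (w * of_real (ln v)) * w / w)
        (at (of_real (ln v)))"
      by (auto intro!: derivative_eq_intros)
    ultimately have "((\<lambda>u. exp (w * u) / w) \<circ> (\<lambda>u. of_real (ln u)) has_vector_derivative
        of_real (1 / v) * (exp (w * of_real (ln v)) * w / w)) (at v)"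
      by (rule field_vector_diff_chain_at)
    then
    have "((\<lambda>v. exp (w * of_real (ln v)) / w) has_vector_derivative
        of_real (1 / v) * (exp (w * of_real (ln v)) * w / w)) (at v)"
      by (simp only: o_def)
    also have "of_real (1 / v) * (exp (w * of_real (ln v)) * w / w) = ?f v"
      using v w0 by (simp add: left_diff_distrib exp_diff exp_of_real)
    finally show "((\<lambda>v. exp (w * of_real (ln v)) / w) has_vector_derivative ?f v) (at v)" .
    show "isCont ?f v" using v by (intro continuous_intros) auto
  next
    show "set_integrable lborel (einterval (ereal s) \<infinity>) ?f" using int by simp
    have "isCont ?F s" using s w0 by (intro continuous_intros) auto
    then have "(?F \<longlongrightarrow> ?F s) (at_right s)" 
      unfolding isCont_def by (rule filterlim_mono) (auto simp: at_within_le_at)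
    then show "((?F \<circ> real_of_ereal) \<longlongrightarrow> ?F s) (at_right (ereal s))"
      by (simp add: ereal_tendsto_simps)
    show "((?F \<circ> real_of_ereal) \<longlongrightarrow> 0) (at_left \<infinity>)"
      using lim0 by (simp add: ereal_tendsto_simps)
  qed auto
  then have "(LINT v|lborel. indicator {s<..} v *\<^sub>R ?f v) = - exp (w * of_real (ln s)) / w"
    by (simp add: interval_lebesgue_integral_def set_lebesgue_integral_def)
  with int show ?thesis by (simp add: has_bochner_integral_iff set_integrable_def)
qed

text \<open>Fubini with a uniform L1 bound on the kernel. Conditions are imposed only where
  \<open>f\<close> is nonzero, so that the weight itself can confine x, for instance to the positive
  half-line.\<close>

lemma has_bochner_integral_kernel:
  fixes f :: "real \<Rightarrow> complex" and k :: "real \<Rightarrow> real \<Rightarrow> complex"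
  assumes f: "integrable lborel f"
    and k[measurable]: "(\<lambda>(x, y). k x y) \<in> borel_measurable (lborel \<Otimes>\<^sub>M lborel)"
    and K: "\<And>x. f x \<noteq> 0 \<Longrightarrow> has_bochner_integral lborel (k x) (K x)"
    and C: "\<And>x. f x \<noteq> 0 \<Longrightarrow> (LINT y|lborel. norm (k x y)) \<le> C"
  shows "has_bochner_integral lborel (\<lambda>y. LINT x|lborel. f x * k x y) (LINT x|lborel. f x * K x)"
proof -
  have [measurable]: "f \<in> borel_measurable lborel" using f by auto
  have int: "integrable (lborel \<Otimes>\<^sub>M lborel) (\<lambda>(x, y). f x * k x y)"
  proof (rule lborel_pair.Fubini_integrable)
    have "(\<lambda>x. LINT y|lborel. norm (f x * k x y)) \<in> borel_measurable lborel" by measurable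
    moreover have "norm (LINT y|lborel. norm (f x * k x y)) \<le> norm (norm (f x) * C)" for x
    proof (cases "f x = 0")
      case False
      have "0 \<le> (LINT y|lborel. norm (k x y))" by (rule Bochner_Integration.integral_nonneg) simp
      with C[OF False] show ?thesis
        by (auto simp: norm_mult abs_mult intro!: mult_left_mono)
    qed simp
    ultimately show "integrable lborel (\<lambda>x. LINT y|lborel. norm (case (x, y) of (x, y) \<Rightarrow> f x * k x y))"
      unfolding prod.case
      by (intro Bochner_Integration.integrable_bound[OF integrable_mult_left[OF integrable_norm[OF f], of C]]) auto
    show "AE x in lborel. integrable lborel (\<lambda>y. case (x, y) of (x, y) \<Rightarrow> f x * k x y)"
    proof (rule AE_I2)
      fix x show "integrable lborel (\<lambda>y. case (x, y) of (x, y) \<Rightarrow> f x * k x y)"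
        using K[of x] by (cases "f x = 0") (auto simp: has_bochner_integral_iff)
    qed
  qed measurable
  have "(LINT y|lborel. LINT x|lborel. f x * k x y) = (LINT x|lborel. LINT y|lborel. f x * k x y)"
    by (rule lborel_pair.Fubini_integral[OF int])
  also have "\<dots> = (LINT x|lborel. f x * K x)"
  proof (rule Bochner_Integration.integral_cong[OF refl])
    fix x show "(LINT y|lborel. f x * k x y) = f x * K x"
      using K[of x] by (cases "f x = 0") (auto simp: has_bochner_integral_iff)
  qed
  finally show ?thesis using lborel_pair.integrable_snd[OF int] by (simp add: has_bochner_integral_iff)
qed

section \<open>The Fox-H kernel: holomorphy and decay\<close>

text \<open>Formally the Mellin transform of the Fox-H function. It is separated from the power of
  \<tau> because the Wright function contains the same kernel at 1 - u.\<close>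

definition fox_kernel :: "nat \<Rightarrow> nat \<Rightarrow> (nat \<Rightarrow> real) \<Rightarrow> (nat \<Rightarrow> real) \<Rightarrow> (nat \<Rightarrow> real) \<Rightarrow>
    (nat \<Rightarrow> real) \<Rightarrow> complex \<Rightarrow> complex" where
  "fox_kernel m p a \<alpha> b \<beta> s =
     (\<Prod>j=1..m. Gamma (of_real (b j) + of_real (\<beta> j) * s)) /
     (\<Prod>i=1..p. Gamma (of_real (a i) + of_real (\<alpha> i) * s))"

text \<open>\<open>rGamma z = inverse (Gamma z)\<close> holds at the poles too, where both sides are
  0; the denominator thus becomes a product of entire functions.\<close>

lemma fox_kernel_rGamma:
  "fox_kernel m p a \<alpha> b \<beta> s =
     (\<Prod>j=1..m. Gamma (of_real (b j) + of_real (\<beta> j) * s)) *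
     (\<Prod>i=1..p. rGamma (of_real (a i) + of_real (\<alpha> i) * s))"
  by (simp add: fox_kernel_def divide_inverse prod_inversef[symmetric] rGamma_inverse_Gamma o_def)

lemma fox_kernel_holomorphic:
  assumes "\<And>j. j \<in> {1..m} \<Longrightarrow> \<beta> j > 0" "\<And>j. j \<in> {1..m} \<Longrightarrow> l > - b j / \<beta> j"
  shows "fox_kernel m p a \<alpha> b \<beta> holomorphic_on {z. l \<le> Re z}"
proof -
  have "of_real (b j) + of_real (\<beta> j) * z \<notin> \<int>\<^sub>\<le>\<^sub>0" if "j \<in> {1..m}" "l \<le> Re z" for j z
  proof (rule Re_pos_not_nonpos_Int)
    have "- b j / \<beta> j < Re z" using assms(2)[OF that(1)] that(2) by linarith
    then show "Re (of_real (b j) + of_real (\<beta> j) * z) > 0"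
      using assms(1)[OF that(1)] by (simp add: field_simps)
  qed
  then show ?thesis
    unfolding fox_kernel_rGamma[abs_def] by (intro holomorphic_intros) auto
qed

text \<open>The rates of the kernel add up to -(pi/2) \<open>fox_astar\<close> <= 0, and Gamma(r -
  z) adds -pi/2. Half of the latter is kept as decay, the other half pays for all losses. With
  \<open>u < r\<close> the argument r - z stays in the right half-plane.\<close>

lemma fox_kernel_Gamma_strip_bound:
  assumes \<beta>: "\<And>j. j \<in> {1..m} \<Longrightarrow> \<beta> j > 0" "\<And>j. j \<in> {1..m} \<Longrightarrow> l > - b j / \<beta> j"
    and \<alpha>: "\<And>i. i \<in> {1..p} \<Longrightarrow> \<alpha> i > 0" and astar: "fox_astar m p \<alpha> \<beta> \<ge> 0" and u: "u < r"
  shows "strip_bound l u (- (pi/4)) (\<lambda>z. fox_kernel m p a \<alpha> b \<beta> z * Gamma (of_real r - z))"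
proof -
  \<comment> \<open>The sum of all coefficients of z, in absolute value, including the 1 of Gamma(r
    - z). A loss \<open>\<epsilon>\<close> per unit coefficient thus totals
    \<open>\<epsilon> * T = pi / 4\<close>.\<close>
  define T where "T = (\<Sum>j=1..m. \<beta> j) + (\<Sum>i=1..p. \<alpha> i) + 1"
  have T: "T > 0" using \<beta>(1) \<alpha> unfolding T_def by (intro add_nonneg_pos add_nonneg_nonneg sum_nonneg) (auto intro: less_imp_le)
  define \<epsilon> where "\<epsilon> = pi / 4 / T"
  have \<epsilon>: "\<epsilon> > 0" using T by (simp add: \<epsilon>_def)
  have 1: "strip_bound l u ((- pi/2 + \<epsilon>) * \<bar>\<beta> j\<bar>) (\<lambda>z. Gamma (of_real (b j) + of_real (\<beta> j) * z))"
    if j: "j \<in> {1..m}" for j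
  proof (rule strip_bound_affine[OF strip_bound_Gamma])
    show "0 < b j + \<beta> j * l" using \<beta>[OF j] by (simp add: field_simps)
    show "b j + \<beta> j * l \<le> b j + \<beta> j * x \<and> b j + \<beta> j * x \<le> b j + \<beta> j * u" if "l \<le> x" "x \<le> u" for x
      using \<beta>(1)[OF j] that by (auto intro!: mult_left_mono)
  qed (use \<epsilon> in simp)
  have 2: "strip_bound l u ((pi/2 + \<epsilon>) * \<bar>\<alpha> i\<bar>) (\<lambda>z. rGamma (of_real (a i) + of_real (\<alpha> i) * z))"
    if i: "i \<in> {1..p}" for i
  proof (rule strip_bound_affine[OF strip_bound_rGamma])
    show "a i + \<alpha> i * l \<le> a i + \<alpha> i * x \<and> a i + \<alpha> i * x \<le> a i + \<alpha> i * u" if "l \<le> x" "x \<le> u" for x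
      using \<alpha>[OF i] that by (auto intro!: mult_left_mono)
  qed (use \<epsilon> in simp)
  have 3: "strip_bound l u ((- pi/2 + \<epsilon>) * \<bar>-1\<bar>) (\<lambda>z. Gamma (of_real r + of_real (-1) * z))"
  proof (rule strip_bound_affine[OF strip_bound_Gamma])
    show "0 < r - u" using u by simp
    show "r - u \<le> r + -1 * x \<and> r + -1 * x \<le> r - l" if "l \<le> x" "x \<le> u" for x using that by auto
  qed (use \<epsilon> in simp)
  have "strip_bound l u ((\<Sum>j=1..m. (- pi/2 + \<epsilon>) * \<bar>\<beta> j\<bar>) + (\<Sum>i=1..p. (pi/2 + \<epsilon>) * \<bar>\<alpha> i\<bar>) + (- pi/2 + \<epsilon>) * \<bar>-1\<bar>)
      (\<lambda>z. fox_kernel m p a \<alpha> b \<beta> z * Gamma (of_real r + of_real (-1) * z))"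
    unfolding fox_kernel_rGamma by (intro strip_bound_mult strip_bound_prod 1 2 3) auto
  also have "(\<Sum>j=1..m. (- pi/2 + \<epsilon>) * \<bar>\<beta> j\<bar>) = (- pi/2 + \<epsilon>) * (\<Sum>j=1..m. \<beta> j)"
    unfolding sum_distrib_left by (intro sum.cong refl) (use \<beta>(1) in \<open>auto simp: abs_of_pos\<close>)
  also have "(\<Sum>i=1..p. (pi/2 + \<epsilon>) * \<bar>\<alpha> i\<bar>) = (pi/2 + \<epsilon>) * (\<Sum>i=1..p. \<alpha> i)"
    unfolding sum_distrib_left by (intro sum.cong refl) (use \<alpha> in \<open>auto simp: abs_of_pos\<close>)
  also have "(- pi/2 + \<epsilon>) * (\<Sum>j=1..m. \<beta> j) + (pi/2 + \<epsilon>) * (\<Sum>i=1..p. \<alpha> i) + (- pi/2 + \<epsilon>) * \<bar>-1\<bar>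
      = - (pi/2) * fox_astar m p \<alpha> \<beta> - pi/2 + \<epsilon> * T"
    by (simp add: fox_astar_def T_def field_simps)
  also have "\<epsilon> * T = pi / 4" using T by (simp add: \<epsilon>_def)
  finally have sb: "strip_bound l u (- (pi/2) * fox_astar m p \<alpha> \<beta> - pi/2 + pi/4)
      (\<lambda>z. fox_kernel m p a \<alpha> b \<beta> z * Gamma (of_real r + of_real (-1) * z))" .
  show ?thesis
  proof (rule strip_boundE[OF sb])
    fix C assume C: "C \<ge> 0" "\<And>x y. l \<le> x \<Longrightarrow> x \<le> u \<Longrightarrow> norm (fox_kernel m p a \<alpha> b \<beta> (Complex x y) *
        Gamma (of_real r + of_real (-1) * Complex x y)) \<le> C * exp ((- (pi/2) * fox_astar m p \<alpha> \<beta> - pi/2 + pi/4) * \<bar>y\<bar>)"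
    show ?thesis
    proof (rule strip_boundI[of _ _ _ C])
      fix x y assume xy: "l \<le> x" "x \<le> u"
      have "exp ((- (pi/2) * fox_astar m p \<alpha> \<beta> - pi/2 + pi/4) * \<bar>y\<bar>) \<le> exp (- (pi/4) * \<bar>y\<bar>)"
        unfolding exp_le_cancel_iff by (rule mult_right_mono) (use astar in auto)
      from mult_left_mono[OF this C(1)] C(2)[OF xy, of y]
      show "norm (fox_kernel m p a \<alpha> b \<beta> (Complex x y) * Gamma (of_real r - Complex x y)) \<le> C * exp (- (pi/4) * \<bar>y\<bar>)"
        by (simp add: mult_ac)
    qed
  qed
qed

lemma measurable_Complex_line:
  assumes "F holomorphic_on {z. l \<le> Re z}" "l \<le> x"
  shows "(\<lambda>y. F (Complex x y)) \<in> borel_measurable borel"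
  by (rule borel_measurable_continuous_onI)
    (use continuous_on_Complex_line[OF holomorphic_on_imp_continuous_on[OF assms(1)]] assms(2) in auto)

section \<open>Laplace transform of a density given by a Mellin-Barnes integral\<close>

text \<open>A single term of the series for exp (s \<tau>) is at most the whole. This makes the
  weighted Laplace integrals converge for any integrable density.\<close>

lemma power_exp_neg_le:
  fixes \<tau> s :: real
  assumes "\<tau> \<ge> 0" "s > 0"
  shows "\<tau> ^ N * exp (- s * \<tau>) \<le> fact N / s ^ N"
proof -
  have "(s * \<tau>) ^ N / fact N \<le> (\<Sum>n\<le>N. (s * \<tau>) ^ n / fact n)"
    using assms by (intro member_le_sum) auto
  also have "\<dots> \<le> exp (s * \<tau>)"
    using assms sum_le_suminf[of "\<lambda>n. (s * \<tau>) ^ n / fact n" "{..N}"]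
      summable_exp[of "s * \<tau>"]
    by (simp add: exp_def divide_inverse mult.commute)
  finally show ?thesis using assms by (simp add: field_simps power_mult_distrib exp_minus)
qed


lemma borel_measurable_Complex [measurable]:
  assumes [measurable]: "f \<in> borel_measurable M" "g \<in> borel_measurable M"
  shows "(\<lambda>x. Complex (f x) (g x)) \<in> borel_measurable M"
proof -
  have "(\<lambda>x. of_real (f x) + \<i> * of_real (g x)) \<in> borel_measurable M" by measurable
  then show ?thesis by (simp only: Complex_eq)
qed

text \<open>The integral for the density runs over \<open>\<gamma>\<close>, and the answer is wanted
  on \<open>\<delta>\<close>. Decay is assumed only jointly with a factor Gamma(r - z), so a contour
  may be moved only after the Laplace integration has produced such a factor.\<close>

lemma mellin_laplace:
  fixes D :: "real \<Rightarrow> real" and \<Theta> :: "complex \<Rightarrow> complex"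
  assumes D: "\<And>\<tau>. \<tau> > 0 \<Longrightarrow> of_real (D \<tau>) =
      (LINT t|lborel. \<Theta> (Complex \<gamma> t) * exp (- Complex \<gamma> t * of_real (ln \<tau>)))"
    and intD: "integrable lborel (\<lambda>\<tau>. indicator {0<..} \<tau> * D \<tau>)"
    and int\<Theta>: "integrable lborel (\<lambda>t. \<Theta> (Complex \<gamma> t))"
    and hol: "\<Theta> holomorphic_on {z. l \<le> Re z}" and l: "l \<le> \<gamma>" "l \<le> \<delta>" and \<delta>: "\<delta> < 1"
    and sb: "\<And>r u. u < r \<Longrightarrow> strip_bound l u (- \<theta>) (\<lambda>z. \<Theta> z * Gamma (of_real r - z))" and \<theta>: "\<theta> > 0"
    and s: "s > 0"
  shows "(LINT \<tau>|lborel. complex_of_real (indicator {0<..} \<tau> * D \<tau>) * of_real (exp (- s * \<tau>))) =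
    (LINT t|lborel. \<Theta> (Complex \<delta> t) * Gamma (1 - Complex \<delta> t) * exp ((Complex \<delta> t - 1) * of_real (ln s)))"
proof -
  \<comment> \<open>\<open>L\<close> is the weighted Laplace transform and \<open>W\<close> its
    contour integral on Re z = x. Both satisfy the same recursion: level N at s is the integral of
    level N + 1 over v > s.\<close>
  define L where "L N s = (LINT \<tau>|lborel. complex_of_real (indicator {0<..} \<tau> * D \<tau>) * of_real (\<tau> ^ N * exp (- s * \<tau>)))" for N s
  define W where "W N s x = (LINT t|lborel. \<Theta> (Complex x t) * Gamma (of_real (real N + 1) - Complex x t) *
      exp ((Complex x t - of_real (real N + 1)) * of_real (ln s)))" for N s x
  have mD[measurable]: "(\<lambda>\<tau>. indicator {0<..} \<tau> * D \<tau>) \<in> borel_measurable lborel" using intD by auto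
  have A: "L N s = W N s \<gamma>" if s: "s > 0" and N: "\<gamma> < real N + 1" for N s
  proof -
    define k where "k t \<tau> = indicator {0<..} \<tau> *\<^sub>R (exp ((of_real (real N + 1) - Complex \<gamma> t - 1) * of_real (ln \<tau>)) * of_real (exp (- s * \<tau>)) :: complex)" for t \<tau> :: real
    define K where "K t = Gamma (of_real (real N + 1) - Complex \<gamma> t) * exp (- (of_real (real N + 1) - Complex \<gamma> t) * of_real (ln s))" for t
    have K: "has_bochner_integral lborel (k t) (K t)" for t
      unfolding k_def K_def by (rule has_bochner_integral_Gamma) (use N s in auto)
    \<comment> \<open>The exponent has constant real part along the line, so t = 0 provides the
      uniform L1 bound required for Fubini.\<close>
    have nk: "norm (k t \<tau>) = norm (k 0 \<tau>)" for t \<tau>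
      by (simp add: k_def norm_mult norm_exp_eq_Re)
    have "has_bochner_integral lborel (\<lambda>\<tau>. LINT t|lborel. \<Theta> (Complex \<gamma> t) * k t \<tau>) (LINT t|lborel. \<Theta> (Complex \<gamma> t) * K t)"
    proof (rule has_bochner_integral_kernel[OF int\<Theta> _ K])
      show "(\<lambda>(x, y). k x y) \<in> borel_measurable (lborel \<Otimes>\<^sub>M lborel)"
        unfolding k_def by measurable
      show "(LINT y|lborel. norm (k x y)) \<le> (LINT y|lborel. norm (k 0 y))" for x
        by (subst nk) simp
    qed
    then have "(LINT \<tau>|lborel. LINT t|lborel. \<Theta> (Complex \<gamma> t) * k t \<tau>) = (LINT t|lborel. \<Theta> (Complex \<gamma> t) * K t)"
      by (simp only: has_bochner_integral_iff)
    also have "(LINT t|lborel. \<Theta> (Complex \<gamma> t) * K t) = W N s \<gamma>"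
      unfolding K_def W_def by (simp only: mult.assoc minus_diff_eq)
    finally have main: "(LINT \<tau>|lborel. LINT t|lborel. \<Theta> (Complex \<gamma> t) * k t \<tau>) = W N s \<gamma>" .
    have "(LINT t|lborel. \<Theta> (Complex \<gamma> t) * k t \<tau>) =
        complex_of_real (indicator {0<..} \<tau> * D \<tau>) * of_real (\<tau> ^ N * exp (- s * \<tau>))" for \<tau>
    proof (cases "\<tau> > 0")
      case True
      have e: "k t \<tau> = exp (- Complex \<gamma> t * of_real (ln \<tau>)) * of_real (\<tau> ^ N * exp (- s * \<tau>))" for t
      proof -
        have "of_real (\<tau> ^ N) = exp (of_real (real N) * of_real (ln \<tau>) :: complex)"
          using True by (simp add: exp_of_nat_mult exp_of_real)
        then show ?thesis using True
          by (simp add: k_def ring_distribs exp_add exp_diff exp_minus divide_inverse mult_ac)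
      qed
      show ?thesis using True unfolding e
        by (simp add: mult.assoc[symmetric] D)
    qed (simp add: k_def)
    with main show ?thesis by (simp only: L_def)
  qed
  \<comment> \<open>With y < N + 1 the strip stays to the left of the poles of the Gamma factor; the
    power of s is bounded on the strip and costs no rate.\<close>
  have shift: "W N s x = W N s y" if s: "s > 0" and x: "l \<le> x" "x \<le> y" "y < real N + 1" for N s x y
    unfolding W_def
  proof (rule vertical_line_shift)
    show "x \<le> y" by fact
    show "(\<lambda>z. \<Theta> z * Gamma (of_real (real N + 1) - z) * exp ((z - of_real (real N + 1)) * of_real (ln s)))
        holomorphic_on {z. x \<le> Re z \<and> Re z \<le> y}"
      by (intro holomorphic_intros holomorphic_on_subset[OF hol] Re_pos_not_nonpos_Int) (use x in auto)
    have e: "strip_bound x y 0 (\<lambda>z. exp ((z - of_real (real N + 1)) * of_real (ln s)))"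
    proof (rule strip_boundI)
      fix v t assume v: "x \<le> v" "v \<le> y"
      have "(v - (real N + 1)) * ln s \<le> (\<bar>x\<bar> + \<bar>y\<bar> + real N + 1) * \<bar>ln s\<bar>"
        by (rule order_trans[OF abs_ge_self]) (use v in \<open>auto simp: abs_mult intro!: mult_right_mono\<close>)
      then show "norm (exp ((Complex v t - of_real (real N + 1)) * of_real (ln s)))
          \<le> exp ((\<bar>x\<bar> + \<bar>y\<bar> + real N + 1) * \<bar>ln s\<bar>) * exp (0 * \<bar>t\<bar>)"
        by (simp add: norm_exp_eq_Re)
    qed
    have "strip_bound x y (- \<theta>) (\<lambda>z. \<Theta> z * Gamma (of_real (real N + 1) - z))"
    proof (rule strip_boundE[OF sb[OF x(3)]])
      fix C assume "\<And>v t. l \<le> v \<Longrightarrow> v \<le> y \<Longrightarrow>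
        norm (\<Theta> (Complex v t) * Gamma (of_real (real N + 1) - Complex v t)) \<le> C * exp (- \<theta> * \<bar>t\<bar>)"
      then show ?thesis using x(1) by (intro strip_boundI[of _ _ _ C]) auto
    qed
    from strip_bound_mult[OF this e]
    show "strip_bound x y (- \<theta>) (\<lambda>z. \<Theta> z * Gamma (of_real (real N + 1) - z) * exp ((z - of_real (real N + 1)) * of_real (ln s)))"
      by simp
  qed fact
  have stepL: "L N s = (LINT v|lborel. indicator {s<..} v *\<^sub>R L (Suc N) v)" if s: "s > 0" for N s
  proof -
    define f where "f \<tau> = complex_of_real (indicator {0<..} \<tau> * D \<tau>) * of_real (\<tau> ^ N * exp (- s * \<tau>))" for \<tau>
    \<comment> \<open>The exponential density of rate \<tau> started at s: it has mass 1 in v, and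
      its product with \<open>f \<tau>\<close> is the integrand of
      \<open>L (Suc N) v\<close>.\<close>
    define k where "k \<tau> v = indicator {s<..} v *\<^sub>R (of_real \<tau> * of_real (exp (- \<tau> * (v - s))) :: complex)" for \<tau> v :: real
    have f: "integrable lborel f"
    proof (rule Bochner_Integration.integrable_bound)
      show "integrable lborel (\<lambda>\<tau>. (indicator {0<..} \<tau> * D \<tau>) * (fact N / s ^ N))"
        by (intro integrable_mult_left intD)
      show "f \<in> borel_measurable lborel" unfolding f_def by measurable
      have "norm (f \<tau>) \<le> norm (indicator {0<..} \<tau> * D \<tau> * (fact N / s ^ N))" for \<tau>
      proof (cases "\<tau> > 0")
        case True
        with power_exp_neg_le[of \<tau> s N] s have "\<bar>\<tau> ^ N * exp (- s * \<tau>)\<bar> \<le> \<bar>fact N / s ^ N\<bar>" by simp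
        then show ?thesis unfolding f_def norm_mult norm_of_real real_norm_def abs_mult[of "_ * D \<tau>"]
          by (rule mult_left_mono) simp
      qed (simp add: f_def)
      then show "AE \<tau> in lborel. norm (f \<tau>) \<le> norm (indicator {0<..} \<tau> * D \<tau> * (fact N / s ^ N))" by simp
    qed
    have K: "has_bochner_integral lborel (k \<tau>) 1" if \<tau>: "\<tau> > 0" for \<tau>
    proof -
      have "has_bochner_integral lborel (\<lambda>v. indicator {0<..} v *\<^sub>R (exp ((1 - 1) * of_real (ln v)) * of_real (exp (- \<tau> * v))))
        (Gamma 1 * exp (- 1 * of_real (ln \<tau>)) :: complex)"
        by (rule has_bochner_integral_Gamma) (use \<tau> in auto)
      then have "has_bochner_integral lborel (\<lambda>v. indicator {0<..} (- s + 1 * v) *\<^sub>R (exp ((1 - 1) * of_real (ln (- s + 1 * v))) * of_real (exp (- \<tau> * (- s + 1 * v)))))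
        ((Gamma 1 * exp (- 1 * of_real (ln \<tau>)) :: complex) /\<^sub>R \<bar>1\<bar>)"
        by (subst (asm) lborel_has_bochner_integral_real_affine_iff[where c = 1 and t = "-s"]) auto
      from has_bochner_integral_mult_right[OF this, of "of_real \<tau>"]
      have "has_bochner_integral lborel (\<lambda>v. of_real \<tau> * (indicator {0<..} (- s + 1 * v) *\<^sub>R (exp ((1 - 1) * of_real (ln (- s + 1 * v))) * of_real (exp (- \<tau> * (- s + 1 * v))))))
        (of_real \<tau> * ((Gamma 1 * exp (- 1 * of_real (ln \<tau>)) :: complex) /\<^sub>R \<bar>1\<bar>))" by simp
      also have "(of_real \<tau> * ((Gamma 1 * exp (- 1 * of_real (ln \<tau>)) :: complex) /\<^sub>R \<bar>1\<bar>)) = 1"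
        using \<tau> by (simp add: exp_minus exp_of_real)
      also have "(\<lambda>v. of_real \<tau> * (indicator {0<..} (- s + 1 * v) *\<^sub>R (exp ((1 - 1) * of_real (ln (- s + 1 * v))) * of_real (exp (- \<tau> * (- s + 1 * v)))))) = k \<tau>"
        by (auto simp: k_def fun_eq_iff indicator_def)
      finally show ?thesis .
    qed
    have "has_bochner_integral lborel (\<lambda>v. LINT \<tau>|lborel. f \<tau> * k \<tau> v) (LINT \<tau>|lborel. f \<tau> * 1)"
    proof (rule has_bochner_integral_kernel[OF f])
      show "(\<lambda>(x, y). k x y) \<in> borel_measurable (lborel \<Otimes>\<^sub>M lborel)"
        unfolding k_def by measurable
      fix \<tau> assume "f \<tau> \<noteq> 0"
      then have \<tau>: "\<tau> > 0" by (auto simp: f_def indicator_def split: if_splits)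
      show "has_bochner_integral lborel (k \<tau>) 1" using K[OF \<tau>] .
      have "(LINT v|lborel. norm (k \<tau> v)) = (LINT v|lborel. Re (k \<tau> v))"
        by (intro Bochner_Integration.integral_cong) (use \<tau> in \<open>auto simp: k_def indicator_def norm_mult\<close>)
      also have "\<dots> = Re (LINT v|lborel. k \<tau> v)"
        using K[OF \<tau>] by (intro integral_Re) (simp add: has_bochner_integral_iff)
      finally show "(LINT v|lborel. norm (k \<tau> v)) \<le> 1"
        using K[OF \<tau>] by (simp add: has_bochner_integral_iff)
    qed
    then have main: "L N s = (LINT v|lborel. LINT \<tau>|lborel. f \<tau> * k \<tau> v)"
      by (simp add: has_bochner_integral_iff L_def f_def)
    have "(LINT \<tau>|lborel. f \<tau> * k \<tau> v) = indicator {s<..} v *\<^sub>R L (Suc N) v" for v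
    proof -
      have "f \<tau> * k \<tau> v = indicator {s<..} v *\<^sub>R (complex_of_real (indicator {0<..} \<tau> * D \<tau>) * of_real (\<tau> ^ Suc N * exp (- v * \<tau>)))" for \<tau>
      proof -
        have "exp (- s * \<tau>) * exp (- \<tau> * (v - s)) = exp (- v * \<tau>)"
          by (simp add: algebra_simps flip: exp_add)
        then have "of_real (exp (- s * \<tau>)) * of_real (exp (- \<tau> * (v - s))) = complex_of_real (exp (- v * \<tau>))"
          by (simp only: of_real_mult[symmetric])
        then show ?thesis by (simp add: f_def k_def mult_ac del: of_real_exp)
      qed
      then show ?thesis by (simp add: L_def)
    qed
    with main show ?thesis by (simp only:)
  qed
  have stepW: "W N s \<delta> = (LINT v|lborel. indicator {s<..} v *\<^sub>R W (Suc N) v \<delta>)" if s: "s > 0" for N s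
  proof -
    \<comment> \<open>The Gamma factor of level N + 1, hence the 2; the functional equation in
      \<open>K'\<close> takes it back to level N.\<close>
    define f where "f t = \<Theta> (Complex \<delta> t) * Gamma (of_real (real N + 2) - Complex \<delta> t)" for t
    define w where "w t = Complex \<delta> t - of_real (real N + 1)" for t
    define k where "k t v = indicator {s<..} v *\<^sub>R exp ((w t - 1) * of_real (ln v))" for t v :: real
    have rew: "Re (w t) < 0" for t using \<delta> by (simp add: w_def)
    have K: "has_bochner_integral lborel (k t) (- exp (w t * of_real (ln s)) / w t)" for t
      unfolding k_def by (rule has_bochner_integral_powr_to_inf[OF rew s])
    have nk: "norm (k t v) = norm (k 0 v)" for t v
      by (simp add: k_def norm_exp_eq_Re w_def)
    have f: "integrable lborel f"
      unfolding f_def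
    proof (rule strip_bound_integrable[OF sb \<theta> l(2) order_refl])
      have "(\<lambda>z. \<Theta> z * Gamma (of_real (real N + 2) - z)) holomorphic_on {z. l \<le> Re z \<and> Re z \<le> \<delta>}"
        by (intro holomorphic_intros holomorphic_on_subset[OF hol] Re_pos_not_nonpos_Int) (use \<delta> in auto)
      then have "continuous_on UNIV (\<lambda>t. \<Theta> (Complex \<delta> t) * Gamma (of_real (real N + 2) - Complex \<delta> t))"
        by (rule continuous_on_Complex_line[OF holomorphic_on_imp_continuous_on]) (use l in auto)
      then show "(\<lambda>t. \<Theta> (Complex \<delta> t) * Gamma (of_real (real N + 2) - Complex \<delta> t)) \<in> borel_measurable lborel"
        by (simp add: borel_measurable_continuous_onI)
    qed (use \<delta> in auto)
    have "has_bochner_integral lborel (\<lambda>v. LINT t|lborel. f t * k t v) (LINT t|lborel. f t * (- exp (w t * of_real (ln s)) / w t))"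
    proof (rule has_bochner_integral_kernel[OF f _ K])
      show "(\<lambda>(x, y). k x y) \<in> borel_measurable (lborel \<Otimes>\<^sub>M lborel)"
        unfolding k_def w_def by measurable
      show "(LINT y|lborel. norm (k x y)) \<le> (LINT y|lborel. norm (k 0 y))" for x
        by (subst nk) simp
    qed
    then have main: "(LINT t|lborel. f t * (- exp (w t * of_real (ln s)) / w t)) = (LINT v|lborel. LINT t|lborel. f t * k t v)"
      by (simp only: has_bochner_integral_iff)
    have K': "f t * (- exp (w t * of_real (ln s)) / w t) =
        \<Theta> (Complex \<delta> t) * Gamma (of_real (real N + 1) - Complex \<delta> t) * exp ((Complex \<delta> t - of_real (real N + 1)) * of_real (ln s))" for t
    proof -
      have w0: "w t \<noteq> 0" using rew[of t] by auto
      \<comment> \<open>The factor - w cancels the denominator created by integrating the power of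
        v.\<close>
      have "Gamma (- w t + 1) = - w t * Gamma (- w t)"
        by (rule Gamma_plus1) (use rew[of t] in \<open>auto intro!: Re_pos_not_nonpos_Int\<close>)
      moreover have "- w t + 1 = of_real (real N + 2) - Complex \<delta> t" by (simp add: w_def)
      ultimately have f_eq: "f t = \<Theta> (Complex \<delta> t) * (- w t * Gamma (- w t))" by (simp only: f_def)
      have e: "of_real (real N + 1) - Complex \<delta> t = - w t" by (simp only: w_def minus_diff_eq)
      show ?thesis unfolding f_eq e unfolding w_def[symmetric] using w0 by (simp add: field_simps)
    qed
    have "(LINT t|lborel. f t * k t v) = indicator {s<..} v *\<^sub>R W (Suc N) v \<delta>" for v
    proof -
      have "w t - 1 = Complex \<delta> t - of_real (real (Suc N) + 1)" for t by (simp add: w_def complex_eq_iff)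
      moreover have "of_real (real N + 2) = complex_of_real (real (Suc N) + 1)" by simp
      ultimately have "f t * k t v = indicator {s<..} v *\<^sub>R (\<Theta> (Complex \<delta> t) * Gamma (of_real (real (Suc N) + 1) - Complex \<delta> t) *
          exp ((Complex \<delta> t - of_real (real (Suc N) + 1)) * of_real (ln v)))" for t
        unfolding f_def k_def by (simp only: mult_scaleR_right)
      then show ?thesis unfolding W_def by simp
    qed
    with main show ?thesis by (simp only: K' W_def[symmetric])
  qed
  \<comment> \<open>At level N0 both lines lie to the left of the first pole N0 + 1. The induction
    then descends to 0 on the line \<open>\<delta>\<close> alone, which is admissible at every level
    because \<open>\<delta> < 1\<close>.\<close>
  obtain N0 :: nat where N0: "\<gamma> < N0" using reals_Archimedean2 by blast
  have "\<forall>s>0. L 0 s = W 0 s \<delta>"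
  proof (rule inc_induct[of 0 N0])
    show "\<forall>s>0. L N0 s = W N0 s \<delta>"
    proof (intro allI impI)
      fix s :: real assume s: "s > 0"
      have "L N0 s = W N0 s \<gamma>" using A[OF s, of N0] N0 by simp
      also have "\<dots> = W N0 s \<delta>"
      proof (cases "\<gamma> \<le> \<delta>")
        case True
        with l \<delta> show ?thesis by (intro shift s) auto
      next
        case False
        with l N0 show ?thesis by (intro shift[symmetric] s) auto
      qed
      finally show "L N0 s = W N0 s \<delta>" .
    qed
    show "\<forall>s>0. L n s = W n s \<delta>" if IH: "\<forall>s>0. L (Suc n) s = W (Suc n) s \<delta>" for n
    proof (intro allI impI)
      fix s :: real assume s: "s > 0"
      have "L n s = (LINT v|lborel. indicator {s<..} v *\<^sub>R L (Suc n) v)" by (rule stepL[OF s])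
      also have "\<dots> = (LINT v|lborel. indicator {s<..} v *\<^sub>R W (Suc n) v \<delta>)"
        by (intro Bochner_Integration.integral_cong) (use IH s in \<open>auto simp: indicator_def\<close>)
      also have "\<dots> = W n s \<delta>" by (rule stepW[OF s, symmetric])
      finally show "L n s = W n s \<delta>" .
    qed
  qed simp
  with s have "L 0 s = W 0 s \<delta>" by blast
  then show ?thesis by (simp add: L_def W_def)
qed

section \<open>Specialization to the Fox-H density and the Wright function\<close>

lemma fox_K_pos:
  assumes "\<forall>i\<in>{1..p}. \<alpha> i > 0 \<and> a i + \<alpha> i > 0" "\<forall>j\<in>{1..m}. \<beta> j > 0 \<and> b j + \<beta> j > 0"
  shows "fox_K m p a \<alpha> b \<beta> > 0"
  unfolding fox_K_def using assms by (intro divide_pos_pos prod_pos) auto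

lemma vertical_line_integral_normalized:
  "1 / (2 * of_real pi * \<i>) * vertical_line_integral c f =
     1 / of_real (2 * pi) * (LINT t|lborel. f (Complex c t))"
  unfolding vertical_line_integral_def integral_mult_left_zero by simp

lemma fox_H_altdef:
  assumes "\<tau> > 0"
  shows "fox_H \<gamma> m p a \<alpha> b \<beta> \<tau> = 1 / of_real (2 * pi) *
    (LINT t|lborel. fox_kernel m p a \<alpha> b \<beta> (Complex \<gamma> t) * exp (- Complex \<gamma> t * of_real (ln \<tau>)))"
  unfolding fox_H_def vertical_line_integral_normalized fox_kernel_def complex_powr_of_real_pos[OF assms] ..

text \<open>The substitution u = 1 - z turns \<open>b j + \<beta> j - \<beta> j * u\<close> into
  \<open>b j + \<beta> j * z\<close>, and likewise in the denominator; on the line it is the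
  reflection t -> -t.\<close>

lemma wright_Psi_altdef:
  assumes "s > 0"
  shows "wright_Psi c m p a \<alpha> b \<beta> (- s) = 1 / of_real (2 * pi) *
    (LINT t|lborel. fox_kernel m p a \<alpha> b \<beta> (Complex (1 - c) t) * Gamma (1 - Complex (1 - c) t) *
      exp ((Complex (1 - c) t - 1) * of_real (ln s)))"
proof -
  define f where "f t = fox_kernel m p a \<alpha> b \<beta> (Complex (1 - c) t) * Gamma (1 - Complex (1 - c) t) *
      exp ((Complex (1 - c) t - 1) * of_real (ln s))" for t
  have flip: "(LINT t|lborel. f t) = (LINT t|lborel. f (0 + -1 * t))"
    using lborel_integral_real_affine[of "-1" f 0] by simp
  have f_eq: "f (0 + -1 * t) = Gamma (Complex c t) *
          ((\<Prod>j=1..m. Gamma (of_real (b j + \<beta> j) - of_real (\<beta> j) * Complex c t)) /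
           (\<Prod>i=1..p. Gamma (of_real (a i + \<alpha> i) - of_real (\<alpha> i) * Complex c t))) *
          of_real (- (- s)) powr (- Complex c t)" for t
  proof -
    have z: "Complex (1 - c) (0 + -1 * t) = 1 - Complex c t" by (simp add: complex_eq_iff)
    have e: "of_real x + of_real y * (1 - Complex c t) = of_real (x + y) - of_real y * Complex c t" for x y :: real
      by (simp add: algebra_simps)
    show ?thesis unfolding f_def z fox_kernel_def e minus_minus complex_powr_of_real_pos[OF assms]
      by (simp add: mult_ac)
  qed
  have "wright_Psi c m p a \<alpha> b \<beta> (- s) = 1 / of_real (2 * pi) * (LINT t|lborel. f t)"
    using assms unfolding wright_Psi_def vertical_line_integral_normalized flip f_eq by simp
  then show ?thesis by (simp only: f_def)
qed

theorem fox_H_laplace: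
  assumes \<alpha>: "\<forall>i\<in>{1..p}. \<alpha> i > 0 \<and> a i + \<alpha> i > 0"
    and \<beta>: "\<forall>j\<in>{1..m}. \<beta> j > 0 \<and> b j + \<beta> j > 0"
    and astar: "fox_astar m p \<alpha> \<beta> \<ge> 0"
    and \<gamma>: "\<forall>j\<in>{1..m}. \<gamma> > - b j / \<beta> j"
    and nonneg: "\<forall>\<tau>>0. fox_H \<gamma> m p a \<alpha> b \<beta> \<tau> \<in> \<real>\<^sub>\<ge>\<^sub>0"
    and c: "0 < c" "\<forall>j\<in>{1..m}. c < (b j + \<beta> j) / \<beta> j"
    and P: "prob_space P"
    and Y: "distributed P lborel Y (\<lambda>\<tau>. ennreal
           (if \<tau> > 0 then 1 / fox_K m p a \<alpha> b \<beta> * Re (fox_H \<gamma> m p a \<alpha> b \<beta> \<tau>) else 0))"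
    and s: "s \<ge> 0"
  shows "complex_of_real (LINT \<omega>|P. exp (- s * Y \<omega>)) =
    1 / of_real (fox_K m p a \<alpha> b \<beta>) * wright_Psi c m p a \<alpha> b \<beta> (- s)"
proof -
  interpret prob_space P by fact
  let ?K = "fox_K m p a \<alpha> b \<beta>" and ?\<Theta> = "fox_kernel m p a \<alpha> b \<beta>"
  have K: "?K > 0" using \<alpha> \<beta> by (rule fox_K_pos)
  define d where "d \<tau> = (if \<tau> > 0 then 1 / ?K * Re (fox_H \<gamma> m p a \<alpha> b \<beta> \<tau>) else 0)" for \<tau>
  have d_nonneg: "0 \<le> d \<tau>" for \<tau>
    using nonneg K by (auto simp: d_def complex_nonneg_Reals_iff)
  have Yd: "distributed P lborel Y (\<lambda>\<tau>. ennreal (d \<tau>))" using Y unfolding d_def .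
  have exp_eq: "(LINT \<tau>|lborel. d \<tau> * g \<tau>) = (LINT \<omega>|P. g (Y \<omega>))" if "g \<in> borel_measurable borel" for g
    by (rule distributed_integral[OF Yd]) (use that d_nonneg in auto)
  have d1: "(LINT \<tau>|lborel. d \<tau>) = 1" using exp_eq[of "\<lambda>_. 1"] by (simp add: prob_space)
  \<comment> \<open>A non-integrable function has integral 0, so the value 1 forces
    integrability.\<close>
  then have intd: "integrable lborel d" using not_integrable_integral_eq[of lborel d] by fastforce
  show ?thesis
  proof (cases "s = 0")
    case True
    with K show ?thesis by (simp add: wright_Psi_def prob_space)
  next
    case False
    with s have s: "s > 0" by simp
    \<comment> \<open>The leftmost of the two lines involved. It is still to the right of the poles
      of the numerator, because the bound on c reads 1 - c > - b j / \<beta> j.\<close>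
    define l where "l = min \<gamma> (1 - c)"
    have lb: "l > - b j / \<beta> j" "\<beta> j > 0" if j: "j \<in> {1..m}" for j
    proof -
      show pos: "\<beta> j > 0" using \<beta> j by blast
      have "c < (b j + \<beta> j) / \<beta> j" using c(2) j by blast
      also have "\<dots> = 1 - (- b j / \<beta> j)" using pos by (simp add: field_simps)
      finally show "l > - b j / \<beta> j" using \<gamma> j by (auto simp: l_def)
    qed
    have \<alpha>': "\<alpha> i > 0" if "i \<in> {1..p}" for i using that \<alpha> by auto
    have hol: "?\<Theta> holomorphic_on {z. l \<le> Re z}"
      by (rule fox_kernel_holomorphic[OF lb(2) lb(1)])
    have [measurable]: "(\<lambda>t. ?\<Theta> (Complex \<gamma> t)) \<in> borel_measurable borel"
      by (rule measurable_Complex_line[OF hol]) (simp add: l_def)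
    have HD: "complex_of_real (2 * pi * ?K * d \<tau>) =
        (LINT t|lborel. ?\<Theta> (Complex \<gamma> t) * exp (- Complex \<gamma> t * of_real (ln \<tau>)))" if \<tau>: "\<tau> > 0" for \<tau>
    proof -
      have "fox_H \<gamma> m p a \<alpha> b \<beta> \<tau> = of_real (Re (fox_H \<gamma> m p a \<alpha> b \<beta> \<tau>))"
        using nonneg \<tau> by (auto simp: complex_nonneg_Reals_iff complex_eq_iff)
      also have "\<dots> = of_real (?K * d \<tau>)" using \<tau> K by (simp add: d_def)
      finally show ?thesis using fox_H_altdef[OF \<tau>, of \<gamma> m p a \<alpha> b \<beta>] by (simp add: field_simps)
    qed
    \<comment> \<open>The norm of the power of \<tau> is constant on the line, so without
      integrability the defining integral would fail for every \<tau> at once. It would then have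
      the default value 0, contradicting the total mass 1.\<close>
    have int\<Theta>: "integrable lborel (\<lambda>t. ?\<Theta> (Complex \<gamma> t))"
    proof (rule ccontr)
      assume ni: "\<not> integrable lborel (\<lambda>t. ?\<Theta> (Complex \<gamma> t))"
      have "d \<tau> = 0" for \<tau>
      proof (cases "\<tau> > 0")
        case True
        have "\<not> integrable lborel (\<lambda>t. ?\<Theta> (Complex \<gamma> t) * exp (- Complex \<gamma> t * of_real (ln \<tau>)))"
        proof
          assume "integrable lborel (\<lambda>t. ?\<Theta> (Complex \<gamma> t) * exp (- Complex \<gamma> t * of_real (ln \<tau>)))"
          then have "integrable lborel (\<lambda>t. exp (\<gamma> * ln \<tau>) *\<^sub>R (?\<Theta> (Complex \<gamma> t) * exp (- Complex \<gamma> t * of_real (ln \<tau>))))"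
            by (rule integrable_scaleR_right)
          then have "integrable lborel (\<lambda>t. ?\<Theta> (Complex \<gamma> t))"
            by (rule Bochner_Integration.integrable_bound)
              (auto simp: norm_mult norm_exp_eq_Re mult.left_commute[of "exp (\<gamma> * ln \<tau>)"] simp flip: exp_add)
          with ni show False by simp
        qed
        then have "complex_of_real (2 * pi * ?K * d \<tau>) = 0"
          unfolding HD[OF True] by (rule not_integrable_integral_eq)
        with K show ?thesis by simp
      qed (simp add: d_def)
      with d1 show False by simp
    qed
    have "(LINT \<tau>|lborel. complex_of_real (indicator {0<..} \<tau> * (2 * pi * ?K * d \<tau>)) * of_real (exp (- s * \<tau>))) =
      (LINT t|lborel. ?\<Theta> (Complex (1 - c) t) * Gamma (1 - Complex (1 - c) t) * exp ((Complex (1 - c) t - 1) * of_real (ln s)))"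
    proof (rule mellin_laplace[OF HD _ int\<Theta> hol])
      show "integrable lborel (\<lambda>\<tau>. indicator {0<..} \<tau> * (2 * pi * ?K * d \<tau>))"
      proof -
        have "integrable lborel (\<lambda>\<tau>. 2 * pi * ?K * d \<tau>)" by (intro integrable_mult_right intd)
        also have "(\<lambda>\<tau>. 2 * pi * ?K * d \<tau>) = (\<lambda>\<tau>. indicator {0<..} \<tau> * (2 * pi * ?K * d \<tau>))"
          by (auto simp: d_def indicator_def)
        finally show ?thesis .
      qed
      show "strip_bound l u (- (pi/4)) (\<lambda>z. ?\<Theta> z * Gamma (of_real r - z))" if "u < r" for r u
        by (rule fox_kernel_Gamma_strip_bound[OF lb(2) lb(1) \<alpha>' astar that])
    qed (use c s in \<open>auto simp: l_def\<close>)
    also have "\<dots> = of_real (2 * pi) * wright_Psi c m p a \<alpha> b \<beta> (- s)"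
      unfolding wright_Psi_altdef[OF s] by simp
    also have "(LINT \<tau>|lborel. complex_of_real (indicator {0<..} \<tau> * (2 * pi * ?K * d \<tau>)) * of_real (exp (- s * \<tau>))) =
        (LINT \<tau>|lborel. complex_of_real (2 * pi * ?K * (d \<tau> * exp (- s * \<tau>))))"
      by (intro Bochner_Integration.integral_cong) (auto simp: d_def indicator_def)
    also have "\<dots> = of_real (2 * pi * ?K * (LINT \<tau>|lborel. d \<tau> * exp (- s * \<tau>)))"
      unfolding integral_complex_of_real by simp
    also have "(LINT \<tau>|lborel. d \<tau> * exp (- s * \<tau>)) = (LINT \<omega>|P. exp (- s * Y \<omega>))"
      by (rule exp_eq) simp
    finally show ?thesis using K by (simp add: field_simps)
  qed
qed

section \<open>Uniqueness of multivariate characteristic functions\<close>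

text \<open>Tilting the measure by \<open>g\<close> turns a weighted characteristic function into an
  ordinary one.\<close>

lemma prob_space_density_distr:
  fixes g X :: "'a \<Rightarrow> real"
  assumes M: "finite_measure M" and [measurable]: "g \<in> borel_measurable M" "X \<in> borel_measurable M"
    and g: "\<And>\<omega>. 0 \<le> g \<omega>" "integrable M g" and r: "(LINT \<omega>|M. g \<omega>) = 1"
  defines "\<nu> \<equiv> distr (density M (\<lambda>\<omega>. ennreal (g \<omega>))) borel X"
  shows "real_distribution \<nu>"
    and "\<And>c. char \<nu> c = (LINT \<omega>|M. of_real (g \<omega>) * iexp (c * X \<omega>))"
    and "\<And>A. A \<in> sets borel \<Longrightarrow> measure \<nu> A = (LINT \<omega>|M. g \<omega> * indicator A (X \<omega>))"
proof -
  have "emeasure (density M (\<lambda>\<omega>. ennreal (g \<omega>))) (space M) = (\<integral>\<^sup>+\<omega>. ennreal (g \<omega>) \<partial>M)"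
    by (subst emeasure_density) (auto intro!: nn_integral_cong)
  also have "\<dots> = 1" using g r by (simp add: nn_integral_eq_integral)
  finally interpret D: prob_space "density M (\<lambda>\<omega>. ennreal (g \<omega>))" by (intro prob_spaceI) simp
  interpret \<nu>: prob_space \<nu> unfolding \<nu>_def by (rule D.prob_space_distr) simp
  show "real_distribution \<nu>" by (intro real_distribution.intro \<nu>.prob_space_axioms real_distribution_axioms.intro) (simp add: \<nu>_def)
  show "char \<nu> c = (LINT \<omega>|M. of_real (g \<omega>) * iexp (c * X \<omega>))" for c
    unfolding char_def \<nu>_def using g
    by (subst integral_distr, simp, simp, subst integral_density) (auto simp: scaleR_conv_of_real)
  show "measure \<nu> A = (LINT \<omega>|M. g \<omega> * indicator A (X \<omega>))" if [measurable]: "A \<in> sets borel" for A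
  proof -
    have "measure \<nu> A = (LINT x|\<nu>. indicator A x)" by (simp add: \<nu>_def)
    also have "\<dots> = (LINT \<omega>|M. g \<omega> *\<^sub>R indicator A (X \<omega>))"
      unfolding \<nu>_def using g by (subst integral_distr, simp, simp, subst integral_density) auto
    finally show ?thesis by simp
  qed
qed

text \<open>Equality at c = 0 says that both weights have the same mass r. Division by r leads to
  Levy's uniqueness theorem for the tilted laws; if r = 0, both weights vanish almost
  everywhere.\<close>

lemma weighted_char_unique_nonneg:
  fixes g X :: "'a \<Rightarrow> real" and h Y :: "'b \<Rightarrow> real"
  assumes MN: "prob_space M" "prob_space N"
    and [measurable]: "X \<in> borel_measurable M" "Y \<in> borel_measurable N" "g \<in> borel_measurable M" "h \<in> borel_measurable N"
    and g: "\<And>\<omega>. 0 \<le> g \<omega>" "\<And>\<omega>. g \<omega> \<le> C" and h: "\<And>\<omega>. 0 \<le> h \<omega>" "\<And>\<omega>. h \<omega> \<le> C"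
    and eq: "\<And>c. (LINT \<omega>|M. of_real (g \<omega>) * iexp (c * X \<omega>)) = (LINT \<omega>|N. of_real (h \<omega>) * iexp (c * Y \<omega>))"
    and A[measurable]: "A \<in> sets borel"
  shows "(LINT \<omega>|M. g \<omega> * indicator A (X \<omega>)) = (LINT \<omega>|N. h \<omega> * indicator A (Y \<omega>))"
proof -
  interpret M: prob_space M by fact
  interpret N: prob_space N by fact
  have ig: "integrable M g" by (rule M.integrable_const_bound[of _ C]) (use g in auto)
  have ih: "integrable N h" by (rule N.integrable_const_bound[of _ C]) (use h in auto)
  define r where "r = (LINT \<omega>|M. g \<omega>)"
  have r': "(LINT \<omega>|N. h \<omega>) = r"
  proof -
    have "complex_of_real r = of_real (LINT \<omega>|N. h \<omega>)"
      using eq[of 0] by (simp add: r_def flip: integral_complex_of_real)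
    then show ?thesis by simp
  qed
  have "r \<ge> 0" unfolding r_def by (rule Bochner_Integration.integral_nonneg) (use g in auto)
  show ?thesis
  proof (cases "r = 0")
    case True
    have "AE \<omega> in M. g \<omega> = 0"
      using integral_nonneg_eq_0_iff_AE[OF ig] g True by (auto simp: r_def)
    then have "(LINT \<omega>|M. g \<omega> * indicator A (X \<omega>)) = 0"
      by (intro integral_eq_zero_AE) auto
    moreover have "AE \<omega> in N. h \<omega> = 0"
      using integral_nonneg_eq_0_iff_AE[OF ih] h True r' by auto
    then have "(LINT \<omega>|N. h \<omega> * indicator A (Y \<omega>)) = 0"
      by (intro integral_eq_zero_AE) auto
    ultimately show ?thesis by simp
  next
    case False
    with \<open>r \<ge> 0\<close> have r: "r > 0" by simp
    note M = prob_space_density_distr[of M "\<lambda>\<omega>. g \<omega> / r" X]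
    note N = prob_space_density_distr[of N "\<lambda>\<omega>. h \<omega> / r" Y]
    let ?\<mu> = "distr (density M (\<lambda>\<omega>. ennreal (g \<omega> / r))) borel X"
    let ?\<nu> = "distr (density N (\<lambda>\<omega>. ennreal (h \<omega> / r))) borel Y"
    have M1: "finite_measure M" "(LINT \<omega>|M. g \<omega> / r) = 1" "integrable M (\<lambda>\<omega>. g \<omega> / r)"
      using r ig by (auto simp: r_def intro: M.finite_measure_axioms)
    have N1: "finite_measure N" "(LINT \<omega>|N. h \<omega> / r) = 1" "integrable N (\<lambda>\<omega>. h \<omega> / r)"
      using r ih r' by (auto intro: N.finite_measure_axioms)
    have "char ?\<mu> = char ?\<nu>"
    proof
      fix c
      have "char ?\<mu> c = (LINT \<omega>|M. of_real (g \<omega> / r) * iexp (c * X \<omega>))"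
        by (rule M(2)) (use M1 g r in auto)
      also have "\<dots> = (LINT \<omega>|M. of_real (g \<omega>) * iexp (c * X \<omega>)) / of_real r" by simp
      also have "\<dots> = (LINT \<omega>|N. of_real (h \<omega> / r) * iexp (c * Y \<omega>))" unfolding eq by simp
      also have "\<dots> = char ?\<nu> c" by (rule N(2)[symmetric]) (use N1 h r in auto)
      finally show "char ?\<mu> c = char ?\<nu> c" .
    qed
    then have eq: "?\<mu> = ?\<nu>"
      by (intro Levy_uniqueness M(1) N(1)) (use M1 N1 g h r in auto)
    have "(LINT \<omega>|M. g \<omega> / r * indicator A (X \<omega>)) = measure ?\<mu> A"
      by (rule M(3)[symmetric]) (use M1 g r in auto)
    also have "\<dots> = (LINT \<omega>|N. h \<omega> / r * indicator A (Y \<omega>))"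
      unfolding eq by (rule N(3)) (use N1 h r in auto)
    finally show ?thesis using r by simp
  qed
qed

lemma integral_add_half_cnj:
  fixes f g h :: "'a \<Rightarrow> complex"
  assumes "integrable M f" "integrable M g" "integrable M h"
  shows "(LINT x|M. f x + (g x + cnj (h x)) / 2) = (LINT x|M. f x) + ((LINT x|M. g x) + cnj (LINT x|M. h x)) / 2"
  using assms by simp

text \<open>The weight \<open>1 + Re g\<close> is nonnegative, so it defines a measure to which the one-dimensional
  uniqueness theorem applies.\<close>

lemma weighted_char_unique_Re:
  fixes X :: "'a \<Rightarrow> real" and Y :: "'b \<Rightarrow> real" and g :: "'a \<Rightarrow> complex" and h :: "'b \<Rightarrow> complex"
  assumes MN: "prob_space M" "prob_space N"
    and [measurable]: "X \<in> borel_measurable M" "Y \<in> borel_measurable N" "g \<in> borel_measurable M" "h \<in> borel_measurable N"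
    and g: "\<And>\<omega>. norm (g \<omega>) \<le> 1" and h: "\<And>\<omega>. norm (h \<omega>) \<le> 1"
    and eq1: "\<And>c. (LINT \<omega>|M. iexp (c * X \<omega>)) = (LINT \<omega>|N. iexp (c * Y \<omega>))"
    and eq: "\<And>c. (LINT \<omega>|M. g \<omega> * iexp (c * X \<omega>)) = (LINT \<omega>|N. h \<omega> * iexp (c * Y \<omega>))"
    and A[measurable]: "A \<in> sets borel"
  shows "(LINT \<omega>|M. Re (g \<omega>) * indicator A (X \<omega>)) = (LINT \<omega>|N. Re (h \<omega>) * indicator A (Y \<omega>))"
proof -
  interpret M: prob_space M by fact
  interpret N: prob_space N by fact
  have gR: "\<bar>Re (g \<omega>)\<bar> \<le> 1" for \<omega> using g[of \<omega>] abs_Re_le_cmod[of "g \<omega>"] by linarith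
  have hR: "\<bar>Re (h \<omega>)\<bar> \<le> 1" for \<omega> using h[of \<omega>] abs_Re_le_cmod[of "h \<omega>"] by linarith
  \<comment> \<open>Conjugating the weight amounts to conjugating the whole term at frequency -c, so
    the hypothesis at c and at -c determines the transform with weight Re w.\<close>
  have split: "of_real (1 + Re w) * iexp (c * x) = iexp (c * x) + (w * iexp (c * x) + cnj (w * iexp (- c * x))) / 2" for w c x
  proof -
    have "cnj (iexp (- c * x)) = iexp (c * x)" by (simp add: exp_cnj)
    then have e1: "cnj (w * iexp (- c * x)) = cnj w * iexp (c * x)" by (simp only: complex_cnj_mult)
    have e2: "of_real (Re w) = (w + cnj w) / 2" by (simp add: complex_add_cnj)
    show ?thesis unfolding e1 of_real_add of_real_1 e2 by (simp add: field_simps)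
  qed
  have M_int: "integrable M (\<lambda>\<omega>. iexp (c * X \<omega>))" "integrable M (\<lambda>\<omega>. g \<omega> * iexp (c * X \<omega>))" for c
    by (rule M.integrable_const_bound[of _ 1]; use g in \<open>simp add: norm_mult\<close>)+
  have N_int: "integrable N (\<lambda>\<omega>. iexp (c * Y \<omega>))" "integrable N (\<lambda>\<omega>. h \<omega> * iexp (c * Y \<omega>))" for c
    by (rule N.integrable_const_bound[of _ 1]; use h in \<open>simp add: norm_mult\<close>)+
  have M_eq: "(LINT \<omega>|M. of_real (1 + Re (g \<omega>)) * iexp (c * X \<omega>)) =
      (LINT \<omega>|M. iexp (c * X \<omega>)) + ((LINT \<omega>|M. g \<omega> * iexp (c * X \<omega>)) + cnj (LINT \<omega>|M. g \<omega> * iexp (- c * X \<omega>))) / 2" for c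
    unfolding split by (intro integral_add_half_cnj M_int)
  have N_eq: "(LINT \<omega>|N. of_real (1 + Re (h \<omega>)) * iexp (c * Y \<omega>)) =
      (LINT \<omega>|N. iexp (c * Y \<omega>)) + ((LINT \<omega>|N. h \<omega> * iexp (c * Y \<omega>)) + cnj (LINT \<omega>|N. h \<omega> * iexp (- c * Y \<omega>))) / 2" for c
    unfolding split by (intro integral_add_half_cnj N_int)
  have "(LINT \<omega>|M. (1 + Re (g \<omega>)) * indicator A (X \<omega>)) = (LINT \<omega>|N. (1 + Re (h \<omega>)) * indicator A (Y \<omega>))"
  proof (rule weighted_char_unique_nonneg[OF MN, of X Y _ _ 2])
    show "0 \<le> 1 + Re (g \<omega>)" "1 + Re (g \<omega>) \<le> 2" for \<omega> using gR[of \<omega>] by (auto simp: abs_le_iff)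
    show "0 \<le> 1 + Re (h \<omega>)" "1 + Re (h \<omega>) \<le> 2" for \<omega> using hR[of \<omega>] by (auto simp: abs_le_iff)
    show "(LINT \<omega>|M. of_real (1 + Re (g \<omega>)) * iexp (c * X \<omega>)) = (LINT \<omega>|N. of_real (1 + Re (h \<omega>)) * iexp (c * Y \<omega>))" for c
      unfolding M_eq N_eq eq eq1 ..
  qed simp_all
  \<comment> \<open>The contribution of the added constant 1, to be subtracted again.\<close>
  moreover have "(LINT \<omega>|M. 1 * indicator A (X \<omega>)) = (LINT \<omega>|N. 1 * indicator A (Y \<omega>) :: real)"
    by (rule weighted_char_unique_nonneg[OF MN, of X Y "\<lambda>_. 1" "\<lambda>_. 1" 1]) (use eq1 in simp_all)
  moreover have "(LINT \<omega>|M. (1 + Re (g \<omega>)) * indicator A (X \<omega>)) =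
      (LINT \<omega>|M. 1 * indicator A (X \<omega>)) + (LINT \<omega>|M. Re (g \<omega>) * indicator A (X \<omega>))"
    unfolding distrib_right
    by (intro Bochner_Integration.integral_add M.integrable_const_bound[of _ 1])
      (use gR in \<open>auto simp: indicator_def abs_mult\<close>)
  moreover have "(LINT \<omega>|N. (1 + Re (h \<omega>)) * indicator A (Y \<omega>)) =
      (LINT \<omega>|N. 1 * indicator A (Y \<omega>)) + (LINT \<omega>|N. Re (h \<omega>) * indicator A (Y \<omega>))"
    unfolding distrib_right
    by (intro Bochner_Integration.integral_add N.integrable_const_bound[of _ 1])
      (use hR in \<open>auto simp: indicator_def abs_mult\<close>)
  ultimately show ?thesis by simp
qed

text \<open>The imaginary part of \<open>g\<close> is the real part of \<open>- \<i> * g\<close>, so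
  two applications of the real version suffice.\<close>

lemma weighted_char_unique:
  fixes X :: "'a \<Rightarrow> real" and Y :: "'b \<Rightarrow> real" and g :: "'a \<Rightarrow> complex" and h :: "'b \<Rightarrow> complex"
  assumes MN: "prob_space M" "prob_space N"
    and [measurable]: "X \<in> borel_measurable M" "Y \<in> borel_measurable N" "g \<in> borel_measurable M" "h \<in> borel_measurable N"
    and g: "\<And>\<omega>. norm (g \<omega>) \<le> 1" and h: "\<And>\<omega>. norm (h \<omega>) \<le> 1"
    and eq1: "\<And>c. (LINT \<omega>|M. iexp (c * X \<omega>)) = (LINT \<omega>|N. iexp (c * Y \<omega>))"
    and eq: "\<And>c. (LINT \<omega>|M. g \<omega> * iexp (c * X \<omega>)) = (LINT \<omega>|N. h \<omega> * iexp (c * Y \<omega>))"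
    and A[measurable]: "A \<in> sets borel"
  shows "(LINT \<omega>|M. of_real (indicator A (X \<omega>)) * g \<omega>) = (LINT \<omega>|N. of_real (indicator A (Y \<omega>)) * h \<omega>)"
proof -
  interpret M: prob_space M by fact
  interpret N: prob_space N by fact
  have re: "(LINT \<omega>|M. Re (g \<omega>) * indicator A (X \<omega>)) = (LINT \<omega>|N. Re (h \<omega>) * indicator A (Y \<omega>))"
    by (rule weighted_char_unique_Re[OF MN _ _ _ _ g h eq1 eq A]) simp_all
  have im: "(LINT \<omega>|M. Re (- \<i> * g \<omega>) * indicator A (X \<omega>)) = (LINT \<omega>|N. Re (- \<i> * h \<omega>) * indicator A (Y \<omega>))"
  proof (rule weighted_char_unique_Re[OF MN _ _ _ _ _ _ eq1 _ A])
    show "(LINT \<omega>|M. - \<i> * g \<omega> * iexp (c * X \<omega>)) = (LINT \<omega>|N. - \<i> * h \<omega> * iexp (c * Y \<omega>))" for c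
      using eq[of c] by (simp add: mult.assoc)
  qed (use g h in \<open>simp_all add: norm_mult\<close>)
  have iM: "integrable M (\<lambda>\<omega>. of_real (indicator A (X \<omega>)) * g \<omega>)"
    by (rule M.integrable_const_bound[of _ 1]) (use g in \<open>auto simp: indicator_def\<close>)
  have iN: "integrable N (\<lambda>\<omega>. of_real (indicator A (Y \<omega>)) * h \<omega>)"
    by (rule N.integrable_const_bound[of _ 1]) (use h in \<open>auto simp: indicator_def\<close>)
  show ?thesis
    using re im apply (intro complex_eqI)
    apply (simp_all only: integral_Re[OF iM, symmetric] integral_Re[OF iN, symmetric]
        integral_Im[OF iM, symmetric] integral_Im[OF iN, symmetric])
    by (simp_all add: mult.commute)
qed

section \<open>From one coordinate to finitely many\<close>

lemma emeasure_distr_PiM_box: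
  fixes X :: "'t \<Rightarrow> 'a \<Rightarrow> real"
  assumes "prob_space M" "finite I"
    and [measurable]: "\<And>t. t \<in> I \<Longrightarrow> X t \<in> borel_measurable M" "\<And>t. t \<in> I \<Longrightarrow> A t \<in> sets borel"
  shows "emeasure (distr M (Pi\<^sub>M I (\<lambda>_. borel)) (\<lambda>\<omega>. \<lambda>t\<in>I. X t \<omega>)) (Pi\<^sub>E I A) =
      ennreal (LINT \<omega>|M. (\<Prod>t\<in>I. indicator (A t) (X t \<omega>)))"
proof -
  interpret M: prob_space M by fact
  have Ai: "Pi\<^sub>E I A \<in> sets (Pi\<^sub>M I (\<lambda>_. borel))"
    using assms(2) by (intro sets_PiM_I_finite) auto
  have m: "(\<lambda>\<omega>. \<lambda>t\<in>I. X t \<omega>) \<in> measurable M (Pi\<^sub>M I (\<lambda>_. borel))" by measurable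
  have S: "(\<lambda>\<omega>. \<lambda>t\<in>I. X t \<omega>) -` Pi\<^sub>E I A \<inter> space M \<in> sets M" by (rule measurable_sets[OF m Ai])
  have "emeasure (distr M (Pi\<^sub>M I (\<lambda>_. borel)) (\<lambda>\<omega>. \<lambda>t\<in>I. X t \<omega>)) (Pi\<^sub>E I A) =
      ennreal (measure M ((\<lambda>\<omega>. \<lambda>t\<in>I. X t \<omega>) -` Pi\<^sub>E I A \<inter> space M))"
    by (simp add: emeasure_distr[OF m Ai] M.emeasure_eq_measure)
  also have "measure M ((\<lambda>\<omega>. \<lambda>t\<in>I. X t \<omega>) -` Pi\<^sub>E I A \<inter> space M) =
      (LINT \<omega>|M. indicator ((\<lambda>\<omega>. \<lambda>t\<in>I. X t \<omega>) -` Pi\<^sub>E I A \<inter> space M) \<omega>)"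
    using S by simp
  also have "\<dots> = (LINT \<omega>|M. (\<Prod>t\<in>I. indicator (A t) (X t \<omega>)))"
  proof (rule Bochner_Integration.integral_cong[OF refl])
    fix \<omega> assume \<omega>: "\<omega> \<in> space M"
    show "indicator ((\<lambda>\<omega>. \<lambda>t\<in>I. X t \<omega>) -` Pi\<^sub>E I A \<inter> space M) \<omega> = (\<Prod>t\<in>I. indicator (A t) (X t \<omega>) :: real)"
      using \<omega> assms(2) by (cases "\<forall>t\<in>I. X t \<omega> \<in> A t") (auto simp: indicator_def PiE_iff prod_zero_iff)
  qed
  finally show ?thesis .
qed

text \<open>The exponential factors are replaced by indicators one coordinate at a time, with the remaining
  factors as a complex weight.\<close>

theorem distr_PiM_eqI_char:
  fixes X :: "'t \<Rightarrow> 'a \<Rightarrow> real" and Y :: "'t \<Rightarrow> 'b \<Rightarrow> real"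
  assumes MN: "prob_space M" "prob_space N" and I: "finite I"
    and X: "\<And>t. t \<in> I \<Longrightarrow> X t \<in> borel_measurable M" and Y: "\<And>t. t \<in> I \<Longrightarrow> Y t \<in> borel_measurable N"
    and eq: "\<And>c. (LINT \<omega>|M. iexp (\<Sum>t\<in>I. c t * X t \<omega>)) = (LINT \<omega>|N. iexp (\<Sum>t\<in>I. c t * Y t \<omega>))"
  shows "distr M (Pi\<^sub>M I (\<lambda>_. borel)) (\<lambda>\<omega>. \<lambda>t\<in>I. X t \<omega>) = distr N (Pi\<^sub>M I (\<lambda>_. borel)) (\<lambda>\<omega>. \<lambda>t\<in>I. Y t \<omega>)"
proof -
  interpret M: prob_space M by fact
  interpret N: prob_space N by fact
  have single: "(LINT \<omega>|M. iexp (c * X k \<omega>)) = (LINT \<omega>|N. iexp (c * Y k \<omega>))" if k: "k \<in> I" for c k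
  proof -
    have "(\<Sum>t\<in>I. (if t = k then c else 0) * f t) = c * f k" for f :: "'t \<Rightarrow> real"
      using I k by (simp add: if_distrib[of "\<lambda>x. x * _"] sum.delta cong: if_cong)
    with eq[of "\<lambda>t. if t = k then c else 0"] show ?thesis by simp
  qed
  \<comment> \<open>Coordinates in J carry indicators, those in I - J still carry exponentials with
    arbitrary frequencies. J = {} is the hypothesis, J = I gives the values on boxes.\<close>
  have step: "(LINT \<omega>|M. of_real (\<Prod>t\<in>J. indicator (A t) (X t \<omega>)) * iexp (\<Sum>t\<in>I-J. c t * X t \<omega>)) =
      (LINT \<omega>|N. of_real (\<Prod>t\<in>J. indicator (A t) (Y t \<omega>)) * iexp (\<Sum>t\<in>I-J. c t * Y t \<omega>))"
    if "J \<subseteq> I" and A: "\<And>t. A t \<in> sets borel" for J A c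
    using finite_subset[OF that(1) I] that(1)
  proof (induction J arbitrary: c rule: finite_induct)
    case empty
    show ?case using eq by simp
  next
    case (insert k J)
    then have k: "k \<in> I" "k \<notin> J" "J \<subseteq> I" by auto
    define gM where "gM \<omega> = of_real (\<Prod>t\<in>J. indicator (A t) (X t \<omega>)) * iexp (\<Sum>t\<in>I - insert k J. c t * X t \<omega>)" for \<omega>
    define gN where "gN \<omega> = of_real (\<Prod>t\<in>J. indicator (A t) (Y t \<omega>)) * iexp (\<Sum>t\<in>I - insert k J. c t * Y t \<omega>)" for \<omega>
    have IJ: "I - J = insert k (I - insert k J)" "finite (I - insert k J)" "k \<notin> I - insert k J"
      using k I by auto
    have ind: "norm (of_real (\<Prod>t\<in>J. indicator (A t) (f t)) * iexp x) \<le> 1" for f :: "'t \<Rightarrow> real" and x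
    proof -
      have "(\<Prod>t\<in>J. indicator (A t) (f t)) \<le> (1 :: real)"
        by (intro prod_le_1) (auto simp: indicator_def)
      moreover have "0 \<le> (\<Prod>t\<in>J. indicator (A t) (f t) :: real)" by (intro prod_nonneg) auto
      ultimately show ?thesis by (simp add: norm_mult del: of_real_prod)
    qed
    have "(LINT \<omega>|M. of_real (indicator (A k) (X k \<omega>)) * gM \<omega>) = (LINT \<omega>|N. of_real (indicator (A k) (Y k \<omega>)) * gN \<omega>)"
    proof (rule weighted_char_unique[OF MN X[OF k(1)] Y[OF k(1)] _ _ _ _ single[OF k(1)] _ A])
      have [measurable]: "X t \<in> borel_measurable M" "Y t \<in> borel_measurable N" if "t \<in> J" for t
        using that k X Y by auto
      have [measurable]: "X t \<in> borel_measurable M" "Y t \<in> borel_measurable N" if "t \<in> I - insert k J" for t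
        using that X Y by auto
      note A[measurable]
      show "gM \<in> borel_measurable M" unfolding gM_def by measurable
      show "gN \<in> borel_measurable N" unfolding gN_def by measurable
      show "norm (gM \<omega>) \<le> 1" for \<omega> unfolding gM_def by (rule ind)
      show "norm (gN \<omega>) \<le> 1" for \<omega> unfolding gN_def by (rule ind)
      fix d
      have s: "(\<Sum>t\<in>I - J. (c(k := d)) t * f t) = (\<Sum>t\<in>I - insert k J. c t * f t) + d * f k" for f :: "'t \<Rightarrow> real"
      proof -
        have "(\<Sum>t\<in>I - insert k J. (c(k := d)) t * f t) = (\<Sum>t\<in>I - insert k J. c t * f t)"
          by (intro sum.cong) auto
        then show ?thesis unfolding IJ(1) sum.insert[OF IJ(2,3)] by simp
      qed
      \<comment> \<open>The induction hypothesis at frequency d for the coordinate k; varying d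
        yields the whole weighted characteristic function of \<open>X k\<close>.\<close>
      show "(LINT \<omega>|M. gM \<omega> * iexp (d * X k \<omega>)) = (LINT \<omega>|N. gN \<omega> * iexp (d * Y k \<omega>))"
        using insert.IH[OF k(3), of "c(k := d)"]
        unfolding s gM_def gN_def of_real_add distrib_left exp_add mult.assoc .
    qed
    then show ?case using insert.hyps
      by (simp add: gM_def gN_def mult.assoc)
  qed
  note [measurable] = X Y
  show ?thesis
  proof (rule measure_eqI_PiM_finite[OF I])
    fix A :: "'t \<Rightarrow> real set" assume A: "\<And>i. i \<in> I \<Longrightarrow> A i \<in> sets borel"
    \<comment> \<open>Extends the box by the empty set off I, because \<open>step\<close> asks for
      measurable sets at all indices.\<close>
    define B where "B t = (if t \<in> I then A t else {})" for t
    have "(LINT \<omega>|M. complex_of_real (\<Prod>t\<in>I. indicator (B t) (X t \<omega>))) = (LINT \<omega>|N. of_real (\<Prod>t\<in>I. indicator (B t) (Y t \<omega>)))"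
      using step[of I B] A by (auto simp: B_def simp del: of_real_prod)
    then have "(LINT \<omega>|M. (\<Prod>t\<in>I. indicator (B t) (X t \<omega>)) :: real) = (LINT \<omega>|N. (\<Prod>t\<in>I. indicator (B t) (Y t \<omega>)))"
      unfolding integral_complex_of_real of_real_eq_iff .
    then have "(LINT \<omega>|M. (\<Prod>t\<in>I. indicator (A t) (X t \<omega>)) :: real) = (LINT \<omega>|N. (\<Prod>t\<in>I. indicator (A t) (Y t \<omega>)))"
      by (simp add: B_def)
    then show "emeasure (distr M (Pi\<^sub>M I (\<lambda>_. borel)) (\<lambda>\<omega>. \<lambda>t\<in>I. X t \<omega>)) (Pi\<^sub>E I A) =
        emeasure (distr N (Pi\<^sub>M I (\<lambda>_. borel)) (\<lambda>\<omega>. \<lambda>t\<in>I. Y t \<omega>)) (Pi\<^sub>E I A)"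
      using emeasure_distr_PiM_box[OF MN(1) I X, where A = A] emeasure_distr_PiM_box[OF MN(2) I Y, where A = A] A by simp
  next
    show "range (\<lambda>_::nat. Pi\<^sub>E I (\<lambda>_. UNIV)) \<subseteq> prod_algebra I (\<lambda>_. borel)"
      using I by (auto intro!: prod_algebraI_finite)
    show "(\<Union>i::nat. Pi\<^sub>E I (\<lambda>_. UNIV)) = space (Pi\<^sub>M I (\<lambda>_. borel))" by (simp add: space_PiM)
    show "emeasure (distr M (Pi\<^sub>M I (\<lambda>_. borel)) (\<lambda>\<omega>. \<lambda>t\<in>I. X t \<omega>)) (Pi\<^sub>E I (\<lambda>_. UNIV)) \<noteq> \<infinity>"
      using emeasure_distr_PiM_box[OF MN(1) I X, where A = "\<lambda>_. UNIV"] by simp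
  qed simp_all
qed

section \<open>The Mandelbrot-Van Ness kernel\<close>

text \<open>The truncated power x_+^r. At r = 0 it is the indicator of the positive half-line, so
  that H = 1/2 needs no formula of its own.\<close>

definition trunc_powr :: "real \<Rightarrow> real \<Rightarrow> real" where
  "trunc_powr r x = (if x > 0 then x powr r else 0)"

lemma borel_measurable_trunc_powr [measurable]: "trunc_powr r \<in> borel_measurable borel"
  unfolding trunc_powr_def by measurable

lemma trunc_powr_scale: "h > 0 \<Longrightarrow> trunc_powr r (h * x) = h powr r * trunc_powr r x"
  by (simp add: trunc_powr_def powr_mult zero_less_mult_iff)

lemma has_bochner_integral_nonneg_has_integral:
  fixes f :: "real \<Rightarrow> real"
  assumes "(f has_integral I) A" "\<And>x. x \<in> A \<Longrightarrow> 0 \<le> f x" "A \<in> sets borel" "f \<in> borel_measurable borel"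
  shows "has_bochner_integral lborel (\<lambda>x. indicator A x * f x) I"
proof -
  have m: "(\<lambda>x. indicator A x * f x) \<in> borel_measurable lborel" using assms(3,4) by simp
  have "f absolutely_integrable_on A"
    using assms by (intro nonnegative_absolutely_integrable_1) (auto simp: integrable_on_def)
  then have ai: "set_integrable lebesgue A f" .
  then have "integrable (completion lborel) (\<lambda>x. indicator A x * f x)" by (simp add: set_integrable_def)
  then have int: "integrable lborel (\<lambda>x. indicator A x * f x)" using integrable_completion[OF m] by simp
  have "(LINT x|lborel. indicator A x * f x) = (LINT x:A|lebesgue. f x)"
    using integral_completion[OF m] by (simp add: set_lebesgue_integral_def)
  also have "\<dots> = I"
    using set_lebesgue_integral_eq_integral(2)[OF ai] assms(1) by (simp add: integral_unique)
  finally show ?thesis using int by (simp add: has_bochner_integral_iff)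
qed

lemma has_bochner_integral_powr_from_0:
  assumes r: "r > -1"
  shows "has_bochner_integral lborel (\<lambda>u. indicator {0..<c} u * u powr r) (trunc_powr (r + 1) c / (r + 1))"
proof (cases "c > 0")
  case True
  have "has_bochner_integral lborel (\<lambda>u. indicator {0..c} u * u powr r) (c powr (r + 1) / (r + 1))"
    by (rule has_bochner_integral_nonneg_has_integral) (use has_integral_powr_from_0[OF r, of c] True in auto)
  moreover have "AE u in lborel. indicator {0..c} u * u powr r = indicator {0..<c} u * u powr r"
    using AE_lborel_singleton[of c] by eventually_elim (auto simp: indicator_def)
  ultimately show ?thesis
    using True by (subst has_bochner_integral_cong_AE[where g = "\<lambda>u. indicator {0..c} u * u powr r"])
      (auto simp: trunc_powr_def elim: eventually_mono)
qed (simp add: trunc_powr_def has_bochner_integral_zero)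

text \<open>Translated by x, the domain is [0, t - x) minus [0, - x). Truncated powers thus treat
  all positions of x relative to 0 and t at once, for both fractional operators.\<close>

lemma set_integral_indicator_powr:
  assumes r: "r > -1" and t: "t \<ge> 0"
  shows "(LBINT u:{x..}. indicator {0..<t} u * (u - x) powr r) =
    (trunc_powr (r + 1) (t - x) - trunc_powr (r + 1) (- x)) / (r + 1)"
proof -
  let ?g = "\<lambda>c u. indicator {0..<c} u * u powr r"
  have A: "has_bochner_integral lborel (\<lambda>u. ?g c (- x + 1 * u)) (trunc_powr (r + 1) c / (r + 1))" for c
    using lborel_has_bochner_integral_real_affine_iff[of 1 "?g c" _ "- x"] has_bochner_integral_powr_from_0[OF r, of c] by simp
  have eq: "indicator {x..} u *\<^sub>R (indicator {0..<t} u * (u - x) powr r) = ?g (t - x) (- x + 1 * u) - ?g (- x) (- x + 1 * u)" for u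
    using t by (auto simp: indicator_def)
  show ?thesis
    using has_bochner_integral_diff[OF A[of "t - x"] A[of "- x"]]
    unfolding set_lebesgue_integral_def eq has_bochner_integral_iff diff_divide_distrib by blast
qed

lemma deriv_trunc_powr:
  assumes "x \<noteq> a" 
  shows "((\<lambda>y. trunc_powr (r + 1) (a - y)) has_real_derivative - ((r + 1) * trunc_powr r (a - x))) (at x)"
proof (cases "x < a")
  case True
  have "((\<lambda>y. (a - y) powr (r + 1)) has_real_derivative - ((r + 1) * trunc_powr r (a - x))) (at x)"
    using DERIV_fun_powr[of "\<lambda>y. a - y" "-1" x "r + 1"] True
    by (auto simp: trunc_powr_def intro!: derivative_eq_intros)
  moreover have "eventually (\<lambda>y. y < a) (nhds x)"
    using True by (intro eventually_nhds_in_open[of "{..<a}", simplified]) auto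
  then have "eventually (\<lambda>y. (a - y) powr (r + 1) = trunc_powr (r + 1) (a - y)) (nhds x)"
    by eventually_elim (simp add: trunc_powr_def)
  ultimately show ?thesis using DERIV_cong_ev[OF refl _ refl] by fast
next
  case False
  with assms have x: "x > a" by simp
  have "((\<lambda>y. 0) has_real_derivative - ((r + 1) * trunc_powr r (a - x))) (at x)"
    using x by (simp add: trunc_powr_def)
  moreover have "eventually (\<lambda>y. y > a) (nhds x)"
    using x by (intro eventually_nhds_in_open[of "{a<..}", simplified]) auto
  then have "eventually (\<lambda>y. 0 = trunc_powr (r + 1) (a - y)) (nhds x)"
    by eventually_elim (simp add: trunc_powr_def)
  ultimately show ?thesis using DERIV_cong_ev[OF refl _ refl] by fast
qed

definition mvn_kernel :: "real \<Rightarrow> real \<Rightarrow> real \<Rightarrow> real" where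
  "mvn_kernel H t x = frac_K H / Gamma (H + 1/2) * (trunc_powr (H - 1/2) (t - x) - trunc_powr (H - 1/2) (- x))"

text \<open>The squared L2 norm of the unnormalized kernel at t = 1, as
  \<open>has_bochner_integral_trunc_powr_unit\<close> shows.\<close>

definition mvn_const :: "real \<Rightarrow> real" where
  "mvn_const H = (LBINT s:{0..}. ((1 + s) powr (H - 1 / 2) - s powr (H - 1 / 2))\<^sup>2) + 1 / (2 * H)"

lemma frac_K_altdef: "frac_K H = Gamma (H + 1/2) * mvn_const H powr (- 1 / 2)"
  by (simp add: frac_K_def mvn_const_def)

lemma frac_K_half: "frac_K (1/2) = 1"
proof -
  \<comment> \<open>Only almost everywhere: at s = 0 the convention \<open>0 powr 0 = 0\<close>
    makes the difference 1.\<close>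
  have "AE s in lborel. indicator {0..} s *\<^sub>R ((1 + s) powr (0::real) - s powr 0)\<^sup>2 = (0::real)"
    using AE_lborel_singleton[of 0] by eventually_elim (auto simp: indicator_def)
  then have "(LINT s|lborel. indicator {0..} s *\<^sub>R ((1 + s) powr (0::real) - s powr 0)\<^sup>2) = (0::real)"
    by (rule integral_eq_zero_AE)
  then have "mvn_const (1/2) = 1" by (simp add: mvn_const_def set_lebesgue_integral_def)
  then show ?thesis by (simp add: frac_K_altdef)
qed

text \<open>For H < 1/2 the derivative lowers the exponent from H + 1/2 and its factor cancels. For
  H > 1/2 the division by H - 1/2 is absorbed by the functional equation of Gamma. The excluded
  points are the corners or jumps of the truncated powers.\<close>

lemma frac_M_minus_indicator:
  assumes H: "0 < H" "H < 1" and t: "t \<ge> 0" and x: "x \<noteq> 0" "x \<noteq> t"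
  shows "frac_M_minus H (indicator {0..<t}) x = mvn_kernel H t x"
proof -
  consider "H < 1/2" | "H = 1/2" | "H > 1/2" by linarith
  then show ?thesis
  proof cases
    case 1
    let ?r = "- (1/2 - H)"
    have r: "?r > -1" using H by simp
    have "((\<lambda>y. (trunc_powr (?r + 1) (t - y) - trunc_powr (?r + 1) (0 - y)) / (?r + 1)) has_real_derivative
        (- ((?r + 1) * trunc_powr ?r (t - x)) - - ((?r + 1) * trunc_powr ?r (0 - x))) / (?r + 1)) (at x)"
      by (intro DERIV_cdivide DERIV_diff deriv_trunc_powr x)
    then have "deriv (\<lambda>y. (trunc_powr (?r + 1) (t - y) - trunc_powr (?r + 1) (- y)) / (?r + 1)) x =
        (- ((?r + 1) * trunc_powr ?r (t - x)) - - ((?r + 1) * trunc_powr ?r (- x))) / (?r + 1)"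
      by (intro DERIV_imp_deriv) simp
    also have "\<dots> = - (trunc_powr ?r (t - x) - trunc_powr ?r (- x))"
      using r by (simp add: field_simps)
    finally have D: "frac_D_minus (1/2 - H) (indicator {0..<t}) x =
        - 1 / Gamma (1 - (1/2 - H)) * - (trunc_powr ?r (t - x) - trunc_powr ?r (- x))"
      unfolding frac_D_minus_def set_integral_indicator_powr[OF r t] by (simp only:)
    have neg: "- 1 / G * - d = 1 / G * d" for G d :: real by simp
    have e: "1 - (1/2 - H) = H + 1/2" "?r = H - 1/2" by auto
    have "frac_D_minus (1/2 - H) (indicator {0..<t}) x =
        1 / Gamma (H + 1/2) * (trunc_powr (H - 1/2) (t - x) - trunc_powr (H - 1/2) (- x))"
      using D unfolding neg e .
    then show ?thesis using 1 by (simp add: frac_M_minus_def mvn_kernel_def)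
  next
    case 2
    show ?thesis using frac_K_half x t unfolding 2
      by (auto simp: frac_M_minus_def mvn_kernel_def trunc_powr_def indicator_def)
  next
    case 3
    let ?\<sigma> = "H - 1/2"
    have r: "?\<sigma> - 1 > -1" using 3 by simp
    have "Gamma (?\<sigma> + 1) = ?\<sigma> * Gamma ?\<sigma>"
      by (rule Gamma_plus1) (use 3 in \<open>auto dest: nonpos_Ints_nonpos\<close>)
    then have G: "Gamma (H + 1/2) = ?\<sigma> * Gamma ?\<sigma>" by (simp add: add.commute)
    have "frac_I_minus ?\<sigma> (indicator {0..<t}) x =
        1 / Gamma ?\<sigma> * ((trunc_powr (?\<sigma> - 1 + 1) (t - x) - trunc_powr (?\<sigma> - 1 + 1) (- x)) / (?\<sigma> - 1 + 1))"
      unfolding frac_I_minus_def set_integral_indicator_powr[OF r t] ..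
    then show ?thesis using 3 unfolding frac_M_minus_def mvn_kernel_def G by simp
  qed
qed

section \<open>Norms and inner products of the kernel\<close>

text \<open>Near 0 the square is bounded up to the term s^(2H-1), integrable since H > 0. At
  infinity the mean value theorem gives s^(2H-3), integrable since H < 1.\<close>

lemma powr_diff_square_integrable:
  fixes H :: real
  assumes H: "0 < H" "H < 1"
  shows "set_integrable lborel {0..} (\<lambda>s. ((1 + s) powr (H - 1 / 2) - s powr (H - 1 / 2))\<^sup>2)"
proof -
  let ?e = "H - 1/2"
  \<comment> \<open>On (0,1) the first two terms dominate the squares of the two powers, the third
    is the tail, and the last covers the null point s = 0 with a generous constant.\<close>
  let ?w = "\<lambda>s. indicator {0..<1} s * s powr 0 * 2 + indicator {0..<1} s * s powr (2 * ?e) + indicator {1..} s * s powr (2 * H - 3) + indicator {0} s * 4"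
  have w1: "integrable lborel (\<lambda>s. indicator {0..<1} s * s powr (0::real))"
    using has_bochner_integral_powr_from_0[of 0 1] by (simp add: has_bochner_integral_iff)
  have w2: "integrable lborel (\<lambda>s. indicator {0..<1} s * s powr (2 * ?e))"
    using has_bochner_integral_powr_from_0[of "2 * (H - 1/2)" 1] H by (simp add: has_bochner_integral_iff)
  have w3: "integrable lborel (\<lambda>s. indicator {1..} s * s powr (2 * H - 3))"
    using has_bochner_integral_nonneg_has_integral[OF has_integral_powr_to_inf[of "2 * H - 3" 1]] H
    by (simp add: has_bochner_integral_iff)
  have w4: "integrable lborel (indicator {0} :: real \<Rightarrow> real)" by simp
  note w = Bochner_Integration.integrable_add[OF Bochner_Integration.integrable_add[OF
    Bochner_Integration.integrable_add[OF integrable_mult_left[OF w1, of 2] w2] w3] integrable_mult_left[OF w4, of 4]]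
  show ?thesis
    unfolding set_integrable_def
  proof (rule Bochner_Integration.integrable_bound[OF w])
    have "indicator {0..} s * ((1 + s) powr ?e - s powr ?e)\<^sup>2 \<le> ?w s" for s
    proof (cases "0 < s \<and> s < 1")
      case True
      have "(1 + s) powr (2 * ?e) \<le> (1 + s) powr 1" using True H by (intro powr_mono) auto
      then have "(1 + s) powr (2 * ?e) \<le> 2" using True by simp
      moreover have "((1 + s) powr ?e - s powr ?e)\<^sup>2 \<le> ((1 + s) powr ?e)\<^sup>2 + (s powr ?e)\<^sup>2"
        by (simp add: power2_diff)
      moreover have "((1 + s) powr ?e)\<^sup>2 = (1 + s) powr (2 * ?e)" "(s powr ?e)\<^sup>2 = s powr (2 * ?e)"
        using True by (simp_all add: power2_eq_square flip: powr_add)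
      ultimately show ?thesis using True by simp
    next
      case False
      show ?thesis
      proof (cases "s \<ge> 1")
        case True
        have "\<exists>\<xi>. s < \<xi> \<and> \<xi> < 1 + s \<and> (1 + s) powr ?e - s powr ?e = (1 + s - s) * (?e * \<xi> powr (?e - 1))"
        proof (rule MVT2)
          fix x assume "s \<le> x"
          with True show "((\<lambda>u. u powr ?e) has_real_derivative ?e * x powr (?e - 1)) (at x)"
            by (intro has_real_derivative_powr) simp
        qed simp
        then obtain \<xi> where \<xi>: "s < \<xi>" "(1 + s) powr ?e - s powr ?e = ?e * \<xi> powr (?e - 1)" by auto
        have "\<bar>?e * \<xi> powr (?e - 1)\<bar> \<le> 1 * s powr (?e - 1)"
          unfolding abs_mult using \<xi> True H by (intro mult_mono) (auto intro!: powr_mono2')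
        then have "((1 + s) powr ?e - s powr ?e)\<^sup>2 \<le> (s powr (?e - 1))\<^sup>2"
          unfolding \<xi>(2) by (intro power2_le_iff_abs_le[THEN iffD2]) auto
        also have "\<dots> = s powr (2 * H - 3)"
          using True by (simp add: power2_eq_square algebra_simps flip: powr_add)
        finally show ?thesis using True by simp
      next
        case f: False
        with False have "s \<le> 0" by simp
        then show ?thesis by (cases "s = 0") auto
      qed
    qed
    then have "norm (indicator {0..} s *\<^sub>R ((1 + s) powr ?e - s powr ?e)\<^sup>2) \<le> norm (?w s)" for s
      unfolding real_norm_def real_scaleR_def
      by (subst abs_of_nonneg) (auto intro: order_trans[OF _ abs_ge_self])
    then show "AE s in lborel. norm (indicator {0..} s *\<^sub>R ((1 + s) powr ?e - s powr ?e)\<^sup>2) \<le> norm (?w s)"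
      by (intro AE_I2)
  qed simp
qed

lemma mvn_const_pos: assumes "0 < H" shows "mvn_const H > 0"
proof -
  have "0 \<le> (LBINT s:{0..}. ((1 + s) powr (H - 1 / 2) - s powr (H - 1 / 2))\<^sup>2)"
    unfolding set_lebesgue_integral_def by (rule Bochner_Integration.integral_nonneg) simp
  with assms show ?thesis by (simp add: mvn_const_def add_nonneg_pos)
qed

text \<open>With s = - x, the range s > 0 gives the integral in \<open>mvn_const\<close>. On -1 < s
  < 0 only the first power is left, and its square integrates to 1 / (2 H).\<close>

lemma has_bochner_integral_trunc_powr_unit:
  assumes H: "0 < H" "H < 1"
  shows "has_bochner_integral lborel (\<lambda>x. (trunc_powr (H - 1/2) (1 - x) - trunc_powr (H - 1/2) (- x))\<^sup>2) (mvn_const H)"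
proof -
  let ?e = "H - 1/2"
  let ?f = "\<lambda>s. indicator {0..} s *\<^sub>R ((1 + s) powr ?e - s powr ?e)\<^sup>2"
  let ?g = "\<lambda>s. indicator {0..<1} s * s powr (2 * ?e)"
  have f: "has_bochner_integral lborel ?f (LBINT s:{0..}. ((1 + s) powr ?e - s powr ?e)\<^sup>2)"
    using powr_diff_square_integrable[OF H] by (simp add: has_bochner_integral_iff set_integrable_def set_lebesgue_integral_def)
  have "has_bochner_integral lborel ?g (trunc_powr (2 * ?e + 1) 1 / (2 * ?e + 1))"
    by (rule has_bochner_integral_powr_from_0) (use H in simp)
  then have "has_bochner_integral lborel ?g (1 / (2 * H))" by (simp add: trunc_powr_def)
  then have "has_bochner_integral lborel (\<lambda>s. ?g (1 + 1 * s)) (1 / (2 * H))"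
    using lborel_has_bochner_integral_real_affine_iff[of 1 ?g _ 1] by simp
  from has_bochner_integral_add[OF f this]
  have "has_bochner_integral lborel (\<lambda>s. ?f s + ?g (1 + 1 * s)) (mvn_const H)" by (simp add: mvn_const_def)
  moreover have "AE s in lborel. ?f s + ?g (1 + 1 * s) = (trunc_powr ?e (1 + s) - trunc_powr ?e s)\<^sup>2"
    using AE_lborel_singleton[of 0] AE_lborel_singleton[of "-1"]
  proof eventually_elim
    case (elim s)
    have "(1 + s) powr (2 * ?e) = ((1 + s) powr ?e)\<^sup>2" if "s > -1"
      using that by (simp add: power2_eq_square flip: powr_add)
    then show ?case using elim by (auto simp: indicator_def trunc_powr_def)
  qed
  ultimately have "has_bochner_integral lborel (\<lambda>s. (trunc_powr ?e (1 + s) - trunc_powr ?e s)\<^sup>2) (mvn_const H)"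
    by (subst has_bochner_integral_cong_AE[where g = "\<lambda>s. ?f s + ?g (1 + 1 * s)"]) (auto elim: eventually_mono)
  then show ?thesis
    using lborel_has_bochner_integral_real_affine_iff[of "-1" "\<lambda>s. (trunc_powr ?e (1 + s) - trunc_powr ?e s)\<^sup>2" _ 0]
    by simp
qed

text \<open>Translation and dilation by h = a - b: homogeneity gives h^(2H-1) and the change of
  variables another h.\<close>

lemma has_bochner_integral_trunc_powr_diff:
  assumes H: "0 < H" "H < 1"
  shows "has_bochner_integral lborel (\<lambda>x. (trunc_powr (H - 1/2) (a - x) - trunc_powr (H - 1/2) (b - x))\<^sup>2)
    (mvn_const H * \<bar>a - b\<bar> powr (2 * H))"
proof -
  let ?e = "H - 1/2"
  have pos: "has_bochner_integral lborel (\<lambda>x. (trunc_powr ?e (a - x) - trunc_powr ?e (b - x))\<^sup>2)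
    (mvn_const H * (a - b) powr (2 * H))" if "a > b" for a b
  proof -
    define h where "h = a - b"
    have h: "h > 0" using that by (simp add: h_def)
    let ?u = "\<lambda>x. (trunc_powr ?e (1 - x) - trunc_powr ?e (- x))\<^sup>2"
    have "has_bochner_integral lborel (\<lambda>x. ?u (- b / h + (1 / h) * x)) (mvn_const H /\<^sub>R \<bar>1 / h\<bar>)"
      using has_bochner_integral_trunc_powr_unit[OF H] h
      by (subst lborel_has_bochner_integral_real_affine_iff[symmetric]) auto
    from has_bochner_integral_mult_right[OF this, of "h powr (2 * ?e)"]
    have "has_bochner_integral lborel (\<lambda>x. h powr (2 * ?e) * ?u (- b / h + (1 / h) * x)) (h powr (2 * ?e) * (mvn_const H /\<^sub>R \<bar>1 / h\<bar>))"
      by simp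
    also have "h powr (2 * ?e) * (mvn_const H /\<^sub>R \<bar>1 / h\<bar>) = mvn_const H * (h powr (2 * ?e) * h powr 1)"
      using h by simp
    also have "h powr (2 * ?e) * h powr 1 = h powr (2 * H)"
      unfolding powr_add[symmetric] by simp
    also have "(\<lambda>x. h powr (2 * ?e) * ?u (- b / h + (1 / h) * x)) = (\<lambda>x. (trunc_powr ?e (a - x) - trunc_powr ?e (b - x))\<^sup>2)"
    proof
      fix x
      have q: "h * (- b / h + (1 / h) * x) = x - b" using h by (simp add: ring_distribs)
      have "a - x = h * (1 - (- b / h + (1 / h) * x))" "b - x = h * (- (- b / h + (1 / h) * x))"
        unfolding right_diff_distrib mult_minus_right q by (simp_all add: h_def)
      then have "trunc_powr ?e (a - x) = h powr ?e * trunc_powr ?e (1 - (- b / h + (1 / h) * x))"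
        "trunc_powr ?e (b - x) = h powr ?e * trunc_powr ?e (- (- b / h + (1 / h) * x))"
        using trunc_powr_scale[OF h] by metis+
      moreover have "h powr (2 * ?e) = (h powr ?e)\<^sup>2" using h by (simp add: power2_eq_square flip: powr_add)
      ultimately show "h powr (2 * ?e) * ?u (- b / h + (1 / h) * x) = (trunc_powr ?e (a - x) - trunc_powr ?e (b - x))\<^sup>2"
        by (simp only: right_diff_distrib[symmetric] power_mult_distrib)
    qed
    finally show ?thesis by (simp add: h_def)
  qed
  consider "a > b" | "a = b" | "b > a" by linarith
  then show ?thesis
  proof cases
    case 1 then show ?thesis using pos[OF 1] by simp
  next
    case 2 then show ?thesis by (simp add: has_bochner_integral_zero)
  next
    case 3 then show ?thesis using pos[OF 3] by (simp add: power2_commute[of "trunc_powr _ (b - _)"] abs_if)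
  qed
qed

lemma borel_measurable_mvn_kernel [measurable]: "mvn_kernel H t \<in> borel_measurable borel"
  unfolding mvn_kernel_def by measurable

text \<open>Polarization: since the kernel vanishes at time 0, twice the product is the sum of the
  squared increments from 0 minus the squared increment between t and s. The normalization makes
  \<open>C\<^sup>2 * mvn_const H = 1\<close>.\<close>

theorem mvn_kernel_inner:
  assumes H: "0 < H" "H < 1"
  shows "has_bochner_integral lborel (\<lambda>x. mvn_kernel H t x * mvn_kernel H s x)
    (1 / 2 * (\<bar>t\<bar> powr (2 * H) + \<bar>s\<bar> powr (2 * H) - \<bar>t - s\<bar> powr (2 * H)))"
proof -
  let ?e = "H - 1/2"
  let ?S = "mvn_const H"
  define C where "C = frac_K H / Gamma (H + 1/2)"
  have S: "?S > 0" using mvn_const_pos H by simp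
  have "Gamma (H + 1/2) > 0" using H by (intro Gamma_real_pos) simp
  then have "C = ?S powr (- 1 / 2)" by (simp add: C_def frac_K_altdef)
  then have "C\<^sup>2 = ?S powr (-1)" by (simp add: power2_eq_square flip: powr_add)
  then have C: "C\<^sup>2 * ?S = 1" using S by (simp add: powr_minus)
  let ?d = "\<lambda>a b x. (trunc_powr ?e (a - x) - trunc_powr ?e (b - x))\<^sup>2"
  note D = has_bochner_integral_trunc_powr_diff[OF H]
  have k: "mvn_kernel H t x = C * (trunc_powr ?e (t - x) - trunc_powr ?e (0 - x))" for t x
    by (simp add: mvn_kernel_def C_def)
  have "has_bochner_integral lborel (\<lambda>x. C\<^sup>2 / 2 * (?d t 0 x + ?d s 0 x - ?d t s x))
      (C\<^sup>2 / 2 * (?S * \<bar>t - 0\<bar> powr (2 * H) + ?S * \<bar>s - 0\<bar> powr (2 * H) - ?S * \<bar>t - s\<bar> powr (2 * H)))"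
    by (intro has_bochner_integral_mult_right has_bochner_integral_diff has_bochner_integral_add D)
  also have "C\<^sup>2 / 2 * (?S * \<bar>t - 0\<bar> powr (2 * H) + ?S * \<bar>s - 0\<bar> powr (2 * H) - ?S * \<bar>t - s\<bar> powr (2 * H)) =
      (C\<^sup>2 * ?S) * (1 / 2 * (\<bar>t\<bar> powr (2 * H) + \<bar>s\<bar> powr (2 * H) - \<bar>t - s\<bar> powr (2 * H)))"
    by (simp add: algebra_simps)
  also have "(\<lambda>x. C\<^sup>2 / 2 * (?d t 0 x + ?d s 0 x - ?d t s x)) = (\<lambda>x. mvn_kernel H t x * mvn_kernel H s x)"
    by (simp add: k fun_eq_iff power2_eq_square field_simps)
  finally show ?thesis unfolding C by simp
qed

section \<open>Gaussian processes and independent random scaling\<close>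

text \<open>The mean condition turns the degenerate case into the constant 0, for which the normal
  formula holds with variance 0.\<close>

lemma gaussian_rv_char:
  assumes P: "prob_space P" and Z: "gaussian_rv P Z" and mean: "(LINT \<omega>|P. Z \<omega>) = 0"
  shows "integrable P (\<lambda>\<omega>. (Z \<omega>)\<^sup>2)"
    and "(LINT \<omega>|P. iexp (Z \<omega>)) = of_real (exp (- (LINT \<omega>|P. (Z \<omega>)\<^sup>2) / 2))"
proof -
  interpret prob_space P by fact
  have [measurable]: "Z \<in> borel_measurable P" using Z by (simp add: gaussian_rv_def)
  consider (const) c where "AE \<omega> in P. Z \<omega> = c"
    | (normal) \<mu> \<sigma> where "\<sigma> > 0" "distributed P lborel Z (\<lambda>x. ennreal (normal_density \<mu> \<sigma> x))"
    using Z by (auto simp: gaussian_rv_def)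
  then have "integrable P (\<lambda>\<omega>. (Z \<omega>)\<^sup>2) \<and> (LINT \<omega>|P. iexp (Z \<omega>)) = of_real (exp (- (LINT \<omega>|P. (Z \<omega>)\<^sup>2) / 2))"
  proof cases
    case const
    have "(LINT \<omega>|P. Z \<omega>) = (LINT \<omega>|P. c)" by (rule integral_cong_AE) (use const in auto)
    then have c: "c = 0" using mean by (simp add: prob_space)
    have "(LINT \<omega>|P. iexp (Z \<omega>)) = (LINT \<omega>|P. 1)" by (rule integral_cong_AE) (use const c in auto)
    moreover have "(LINT \<omega>|P. (Z \<omega>)\<^sup>2) = (LINT \<omega>|P. 0)" by (rule integral_cong_AE) (use const c in auto)
    moreover have "integrable P (\<lambda>\<omega>. (Z \<omega>)\<^sup>2) = integrable P (\<lambda>\<omega>. 0 :: real)"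
      by (rule integrable_cong_AE) (use const c in auto)
    ultimately show ?thesis by (simp add: prob_space)
  next
    case normal
    have \<mu>: "\<mu> = 0" using normal_distributed_expectation[OF normal] mean by simp
    have D: "distributed P lborel Z (\<lambda>x. ennreal (normal_density 0 \<sigma> x))" using normal(2) \<mu> by simp
    have var: "(LINT \<omega>|P. (Z \<omega>)\<^sup>2) = \<sigma>\<^sup>2"
      using normal_distributed_variance[OF normal] mean by simp
    have "integrable lborel (\<lambda>x. normal_density 0 \<sigma> x * x\<^sup>2)"
      using integrable_normal_moment[OF normal(1), of 0 2] by simp
    then have int: "integrable P (\<lambda>\<omega>. (Z \<omega>)\<^sup>2)"
      by (subst (asm) distributed_integrable[OF D]) auto
    have "distributed P lborel (\<lambda>x. 0 + (1 / \<sigma>) * Z x) (\<lambda>x. ennreal (normal_density (0 + (1 / \<sigma>) * 0) (\<bar>1 / \<sigma>\<bar> * \<sigma>) x))"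
      by (rule normal_density_affine[OF D]) (use normal(1) in auto)
    then have "distributed P lborel (\<lambda>x. Z x / \<sigma>) (\<lambda>x. ennreal (std_normal_density x))"
      using normal(1) by simp
    then have "std_normal_distribution = distr P lborel (\<lambda>x. Z x / \<sigma>)"
      by (rule distributed_distr_eq_density[symmetric])
    then have "char std_normal_distribution \<sigma> = (LINT \<omega>|P. iexp (\<sigma> * (Z \<omega> / \<sigma>)))"
      unfolding char_def using normal(1) by (simp add: integral_distr)
    then have "(LINT \<omega>|P. iexp (Z \<omega>)) = of_real (exp (- \<sigma>\<^sup>2 / 2))"
      using normal(1) by (simp add: char_std_normal_distribution)
    with int var show ?thesis by simp
  qed
  then show "integrable P (\<lambda>\<omega>. (Z \<omega>)\<^sup>2)"
    "(LINT \<omega>|P. iexp (Z \<omega>)) = of_real (exp (- (LINT \<omega>|P. (Z \<omega>)\<^sup>2) / 2))" by auto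
qed

lemma integrable_mult_square:
  fixes f g :: "'a \<Rightarrow> real"
  assumes [measurable]: "f \<in> borel_measurable M" "g \<in> borel_measurable M"
    and "integrable M (\<lambda>x. (f x)\<^sup>2)" "integrable M (\<lambda>x. (g x)\<^sup>2)"
  shows "integrable M (\<lambda>x. f x * g x)"
proof (rule Bochner_Integration.integrable_bound)
  show "integrable M (\<lambda>x. (f x)\<^sup>2 + (g x)\<^sup>2)" using assms by simp
  have "\<bar>f x * g x\<bar> \<le> \<bar>(f x)\<^sup>2 + (g x)\<^sup>2\<bar>" for x
  proof -
    have "2 * \<bar>f x\<bar> * \<bar>g x\<bar> \<le> \<bar>f x\<bar>\<^sup>2 + \<bar>g x\<bar>\<^sup>2" by (rule sum_squares_bound)
    then have "2 * \<bar>f x * g x\<bar> \<le> (f x)\<^sup>2 + (g x)\<^sup>2" by (simp add: abs_mult)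
    then show ?thesis using abs_ge_zero[of "f x * g x"] by linarith
  qed
  then show "AE x in M. norm (f x * g x) \<le> norm ((f x)\<^sup>2 + (g x)\<^sup>2)" by simp
qed simp

text \<open>Applied both to Brownian motion under P and to the kernels in L2 of the line, so that
  the same quadratic form appears on both sides.\<close>

lemma integral_square_sum:
  fixes f :: "'t \<Rightarrow> 'a \<Rightarrow> real"
  assumes "\<And>t s. t \<in> I \<Longrightarrow> s \<in> I \<Longrightarrow> has_bochner_integral M (\<lambda>x. f t x * f s x) (C t s)"
  shows "has_bochner_integral M (\<lambda>x. (\<Sum>t\<in>I. c t * f t x)\<^sup>2) (\<Sum>t\<in>I. \<Sum>s\<in>I. c t * c s * C t s)"
proof -
  have "has_bochner_integral M (\<lambda>x. \<Sum>t\<in>I. \<Sum>s\<in>I. (c t * c s) * (f t x * f s x)) (\<Sum>t\<in>I. \<Sum>s\<in>I. c t * c s * C t s)"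
    by (intro has_bochner_integral_sum has_bochner_integral_mult_right assms)
  also have "(\<lambda>x. \<Sum>t\<in>I. \<Sum>s\<in>I. (c t * c s) * (f t x * f s x)) = (\<lambda>x. (\<Sum>t\<in>I. c t * f t x)\<^sup>2)"
    by (simp add: fun_eq_iff power2_eq_square sum_product mult_ac)
  finally show ?thesis .
qed

section \<open>The covariance form of fractional Brownian motion\<close>

definition fbm_cov :: "real \<Rightarrow> real \<Rightarrow> real \<Rightarrow> real" where
  "fbm_cov H t s = 1 / 2 * (t powr (2 * H) + s powr (2 * H) - \<bar>t - s\<bar> powr (2 * H))"

lemma fbm_cov_scale:
  assumes "v > 0" "t \<ge> 0" "s \<ge> 0"
  shows "fbm_cov H (t * v) (s * v) = v powr (2 * H) * fbm_cov H t s"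
proof -
  have "\<bar>t * v - s * v\<bar> = \<bar>t - s\<bar> * v" using assms by (simp add: abs_mult flip: left_diff_distrib)
  then show ?thesis using assms by (simp add: fbm_cov_def powr_mult algebra_simps)
qed

definition fbm_form :: "real \<Rightarrow> real set \<Rightarrow> (real \<Rightarrow> real) \<Rightarrow> real" where
  "fbm_form H I c = (\<Sum>t\<in>I. \<Sum>s\<in>I. c t * c s * fbm_cov H t s)"

lemma fbm_measurable:
  assumes "fractional_Brownian_motion P H B" "t \<ge> 0"
  shows "B t \<in> borel_measurable P"
proof -
  have "gaussian_rv P (\<lambda>\<omega>. \<Sum>t\<in>{t}. 1 * B t \<omega>)"
    using assms unfolding fractional_Brownian_motion_def gaussian_process_def
    by (elim conjE allE[of _ "{t}"] allE[of _ "\<lambda>_. 1"]) auto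
  then show ?thesis by (simp add: gaussian_rv_def)
qed

lemma fbm_char:
  assumes P: "prob_space P" and B: "fractional_Brownian_motion P H B" and I: "finite I" "I \<subseteq> {0..}"
  shows "(LINT \<omega>|P. iexp (\<Sum>t\<in>I. c t * B t \<omega>)) = of_real (exp (- fbm_form H I c / 2))"
proof -
  interpret prob_space P by fact
  have g: "gaussian_rv P (\<lambda>\<omega>. \<Sum>t\<in>I. c t * B t \<omega>)" if "finite I" "I \<subseteq> {0..}" for I c
    using B that by (auto simp: fractional_Brownian_motion_def gaussian_process_def)
  have m0: "(LINT \<omega>|P. B t \<omega>) = 0" if "t \<ge> 0" for t
    using B that by (auto simp: fractional_Brownian_motion_def)
  have cov: "(LINT \<omega>|P. B t \<omega> * B s \<omega>) = fbm_cov H t s" if "t \<ge> 0" "s \<ge> 0" for t s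
    using B that by (auto simp: fractional_Brownian_motion_def fbm_cov_def)
  note meas = fbm_measurable[OF B]
  \<comment> \<open>Square integrability comes from Gaussianity of a single coordinate; the
    covariance identity alone does not give it, since non-integrable functions have integral
    0.\<close>
  have sq: "integrable P (\<lambda>\<omega>. (B t \<omega>)\<^sup>2)" if t: "t \<ge> 0" for t
    using gaussian_rv_char(1)[OF P g[of "{t}" "\<lambda>_. 1"]] m0[OF t] t by simp
  have int: "integrable P (B t)" if t: "t \<ge> 0" for t
    using integrable_mult_square[of "B t" P "\<lambda>_. 1"] meas[OF t] sq[OF t] by simp
  have I0: "t \<ge> 0" if "t \<in> I" for t using that I by auto
  have "(LINT \<omega>|P. (\<Sum>t\<in>I. c t * B t \<omega>)) = (\<Sum>t\<in>I. c t * (LINT \<omega>|P. B t \<omega>))"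
    using int I0 by (subst Bochner_Integration.integral_sum) auto
  also have "\<dots> = 0" using m0 I0 by simp
  finally have mean: "(LINT \<omega>|P. (\<Sum>t\<in>I. c t * B t \<omega>)) = 0" .
  have "has_bochner_integral P (\<lambda>\<omega>. (\<Sum>t\<in>I. c t * B t \<omega>)\<^sup>2) (\<Sum>t\<in>I. \<Sum>s\<in>I. c t * c s * fbm_cov H t s)"
    by (intro integral_square_sum)
      (use I0 cov meas sq in \<open>auto simp: has_bochner_integral_iff intro!: integrable_mult_square\<close>)
  then show ?thesis
    using gaussian_rv_char(2)[OF P g[OF I] mean] by (simp add: has_bochner_integral_iff fbm_form_def)
qed

section \<open>Joint measurability and conditioning on an independent variable\<close>

text \<open>Rounding the random time down to the grid of mesh 1 / (n + 1) leaves countably many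
  times; path continuity passes to the limit. Separate spaces \<open>K\<close> and \<open>N\<close>
  allow use on P as well as on a product with the path sigma-algebra.\<close>

lemma borel_measurable_continuous_process:
  assumes B: "\<And>t. t \<ge> 0 \<Longrightarrow> B t \<in> borel_measurable N"
    and cont: "\<And>\<omega>. \<omega> \<in> space N \<Longrightarrow> continuous_on {0..} (\<lambda>t. B t \<omega>)"
    and g[measurable]: "g \<in> borel_measurable K" and g0: "\<And>x. g x \<ge> (0 :: real)" and h[measurable]: "h \<in> measurable K N"
  shows "(\<lambda>x. B (g x) (h x) :: real) \<in> borel_measurable K"
proof (rule borel_measurable_LIMSEQ_real)
  let ?u = "\<lambda>n x. real (nat \<lfloor>(real n + 1) * g x\<rfloor>) / (real n + 1)"
  show "(\<lambda>x. B (?u n x) (h x)) \<in> borel_measurable K" for n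
  proof (rule measurable_compose_countable[where f = "\<lambda>i x. B (real i / (real n + 1)) (h x)" and g = "\<lambda>x. nat \<lfloor>(real n + 1) * g x\<rfloor>"])
    show "(\<lambda>x. B (real i / (real n + 1)) (h x)) \<in> borel_measurable K" for i :: nat
      by (rule measurable_compose[OF h B]) simp
    show "(\<lambda>x. nat \<lfloor>(real n + 1) * g x\<rfloor>) \<in> measurable K (count_space UNIV)" by measurable
  qed
  fix x assume x: "x \<in> space K"
  have u0: "?u n x \<ge> 0" for n by simp
  have "(\<lambda>n. ?u n x) \<longlonglongrightarrow> g x"
  proof (rule tendsto_sandwich)
    show "eventually (\<lambda>n. g x - 1 / (real n + 1) \<le> ?u n x) sequentially"
    proof (rule always_eventually, rule allI)
      fix n
      have "real (nat \<lfloor>(real n + 1) * g x\<rfloor>) = of_int \<lfloor>(real n + 1) * g x\<rfloor>" using g0[of x] by simp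
      moreover have "(real n + 1) * g x - 1 \<le> of_int \<lfloor>(real n + 1) * g x\<rfloor>" by linarith
      ultimately have "((real n + 1) * g x - 1) / (real n + 1) \<le> ?u n x" by (intro divide_right_mono) auto
      then show "g x - 1 / (real n + 1) \<le> ?u n x" by (simp add: diff_divide_distrib)
    qed
    show "eventually (\<lambda>n. ?u n x \<le> g x) sequentially"
    proof (rule always_eventually, rule allI)
      fix n
      have "real (nat \<lfloor>(real n + 1) * g x\<rfloor>) \<le> (real n + 1) * g x" using g0[of x] by simp
      then show "?u n x \<le> g x" by (simp add: field_simps)
    qed
    show "(\<lambda>n. g x - 1 / (real n + 1)) \<longlonglongrightarrow> g x" by real_asymp
  qed simp
  then show "(\<lambda>n. B (?u n x) (h x)) \<longlonglongrightarrow> B (g x) (h x)"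
    using cont[OF measurable_space[OF h x]] g0[of x] u0
    by (intro continuous_on_tendsto_compose[of "{0..}" "\<lambda>t. B t (h x)"]) auto
qed

text \<open>Only the sets of \<open>N\<close> matter here; the measure is supplied by
  \<open>distr P N\<close> of the identity, the restriction of P to this sub-sigma-algebra.\<close>

lemma
  fixes F :: "real \<times> 'w \<Rightarrow> complex"
  assumes P: "prob_space P" and N: "space N = space P" "sets N \<subseteq> sets P"
    and F[measurable]: "F \<in> borel_measurable (borel \<Otimes>\<^sub>M N)"
  shows section_integral_distr: "(LINT \<omega>|distr P N (\<lambda>\<omega>. \<omega>). F (y, \<omega>)) = (LINT \<omega>|P. F (y, \<omega>))"
    and borel_measurable_section_integral: "(\<lambda>y. LINT \<omega>|P. F (y, \<omega>)) \<in> borel_measurable borel"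
proof -
  interpret prob_space P by fact
  have [measurable]: "(\<lambda>\<omega>. \<omega>) \<in> measurable P N"
    using N sets.sets_into_space by (intro measurableI) auto
  interpret N: prob_space "distr P N (\<lambda>\<omega>. \<omega>)" by (rule prob_space_distr) simp
  show eq: "(LINT \<omega>|distr P N (\<lambda>\<omega>. \<omega>). F (y, \<omega>)) = (LINT \<omega>|P. F (y, \<omega>))" for y
  proof -
    have "(\<lambda>\<omega>. F (y, \<omega>)) \<in> borel_measurable N" by measurable
    then show ?thesis by (subst integral_distr) auto
  qed
  have "(\<lambda>y. LINT \<omega>|distr P N (\<lambda>\<omega>. \<omega>). F (y, \<omega>)) \<in> borel_measurable borel" by measurable
  then show "(\<lambda>y. LINT \<omega>|P. F (y, \<omega>)) \<in> borel_measurable borel" unfolding eq .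
qed

text \<open>The pair (Y, \<omega>) has a product law when \<omega> is observed through
  \<open>N\<close> only; the rest is Fubini. With P in place of \<open>N\<close> this fails in
  general, as Y is itself a function of \<omega>.\<close>

lemma indep_expectation_iterated:
  fixes F :: "real \<times> 'w \<Rightarrow> complex"
  assumes P: "prob_space P" and Y[measurable]: "Y \<in> borel_measurable P"
    and N: "space N = space P"
    and indep: "prob_space.indep_set P (sets (vimage_algebra (space P) Y borel)) (sets N)"
    and F[measurable]: "F \<in> borel_measurable (borel \<Otimes>\<^sub>M N)" and bound: "\<And>x. norm (F x) \<le> 1"
  shows "(LINT \<omega>|P. F (Y \<omega>, \<omega>)) = (LINT \<omega>'|P. LINT \<omega>|P. F (Y \<omega>', \<omega>))"
proof -
  interpret prob_space P by fact
  have NP: "sets N \<subseteq> sets P" using indep_setD_ev2[OF indep] .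
  have id[measurable]: "(\<lambda>\<omega>. \<omega>) \<in> measurable P N"
    using NP N sets.sets_into_space by (intro measurableI) auto
  interpret Y: prob_space "distr P borel Y" by (rule prob_space_distr) simp
  interpret N: prob_space "distr P N (\<lambda>\<omega>. \<omega>)" by (rule prob_space_distr) simp
  interpret YN: pair_prob_space "distr P borel Y" "distr P N (\<lambda>\<omega>. \<omega>)" ..
  have D: "distr P borel Y \<Otimes>\<^sub>M distr P N (\<lambda>\<omega>. \<omega>) = distr P (borel \<Otimes>\<^sub>M N) (\<lambda>\<omega>. (Y \<omega>, \<omega>))"
  proof (rule pair_measure_eqI)
    fix A B assume A: "A \<in> sets (distr P borel Y)" and B: "B \<in> sets (distr P N (\<lambda>\<omega>. \<omega>))"
    have B': "B \<inter> space P = B" using B N sets.sets_into_space[of B N] by auto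
    have "Y -` A \<inter> space P \<in> sets (vimage_algebra (space P) Y borel)"
      using A by (intro in_vimage_algebra) simp
    then have "prob ((Y -` A \<inter> space P) \<inter> B) = prob (Y -` A \<inter> space P) * prob B"
      using B by (intro indep_setD[OF indep]) simp_all
    moreover have "(\<lambda>\<omega>. (Y \<omega>, \<omega>)) -` (A \<times> B) \<inter> space P = (Y -` A \<inter> space P) \<inter> B"
      using B' by auto
    moreover have "A \<times> B \<in> sets (borel \<Otimes>\<^sub>M N)" using A B by simp
    ultimately show "emeasure (distr P borel Y) A * emeasure (distr P N (\<lambda>\<omega>. \<omega>)) B =
        emeasure (distr P (borel \<Otimes>\<^sub>M N) (\<lambda>\<omega>. (Y \<omega>, \<omega>))) (A \<times> B)"
      using A B B' by (simp add: emeasure_distr emeasure_eq_measure ennreal_mult)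
  qed (auto intro: Y.sigma_finite_measure_axioms N.sigma_finite_measure_axioms)
  have "(LINT \<omega>|P. F (Y \<omega>, \<omega>)) = (LINT z|distr P (borel \<Otimes>\<^sub>M N) (\<lambda>\<omega>. (Y \<omega>, \<omega>)). F z)"
    by (subst integral_distr) auto
  also have "\<dots> = (LINT z|(distr P borel Y \<Otimes>\<^sub>M distr P N (\<lambda>\<omega>. \<omega>)). F z)" unfolding D ..
  also have "\<dots> = (LINT y|distr P borel Y. LINT \<omega>|distr P N (\<lambda>\<omega>. \<omega>). F (y, \<omega>))"
    by (rule YN.integral_fst'[symmetric], rule YN.integrable_const_bound[of _ 1]) (use bound in auto)
  also have "\<dots> = (LINT y|distr P borel Y. LINT \<omega>|P. F (y, \<omega>))"
    unfolding section_integral_distr[OF P N NP F] ..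
  also have "\<dots> = (LINT \<omega>'|P. LINT \<omega>|P. F (Y \<omega>', \<omega>))"
    by (rule integral_distr[OF _ borel_measurable_section_integral[OF P N NP F]]) simp
  finally show ?thesis .
qed

section \<open>Schwartz functions and limits in mean square\<close>

lemma higher_deriv_linear:
  fixes f g :: "real \<Rightarrow> real"
  assumes "\<And>n x. (deriv ^^ n) f field_differentiable at x" "\<And>n x. (deriv ^^ n) g field_differentiable at x"
  shows "(deriv ^^ n) (\<lambda>x. r * f x + s * g x) = (\<lambda>x. r * (deriv ^^ n) f x + s * (deriv ^^ n) g x)"
proof (induction n)
  case (Suc n)
  show ?case
  proof
    fix x
    have "((\<lambda>x. r * (deriv ^^ n) f x + s * (deriv ^^ n) g x) has_field_derivative
        r * deriv ((deriv ^^ n) f) x + s * deriv ((deriv ^^ n) g) x) (at x)"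
      by (intro DERIV_add DERIV_cmult) (use assms DERIV_deriv_iff_field_differentiable in blast)+
    then show "(deriv ^^ Suc n) (\<lambda>x. r * f x + s * g x) x = r * (deriv ^^ Suc n) f x + s * (deriv ^^ Suc n) g x"
      by (simp add: Suc.IH DERIV_imp_deriv)
  qed
qed simp

lemma schwartz_linear:
  assumes f: "f \<in> schwartz" and g: "g \<in> schwartz"
  shows "(\<lambda>x. r * f x + s * g x) \<in> schwartz"
proof -
  have d: "(deriv ^^ n) f field_differentiable at x" "(deriv ^^ n) g field_differentiable at x" for n x
    using f g by (auto simp: schwartz_def)
  have b: "bounded (range (\<lambda>x. x ^ k * (deriv ^^ n) f x))" "bounded (range (\<lambda>x. x ^ k * (deriv ^^ n) g x))" for k n
    using f g by (auto simp: schwartz_def)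
  have "bounded (range (\<lambda>x. x ^ k * (r * (deriv ^^ n) f x + s * (deriv ^^ n) g x)))" for k n
  proof -
    obtain A where A: "\<And>x. \<bar>x ^ k * (deriv ^^ n) f x\<bar> \<le> A" using b(1)[of k n] by (auto simp: bounded_iff)
    obtain C where C: "\<And>x. \<bar>x ^ k * (deriv ^^ n) g x\<bar> \<le> C" using b(2)[of k n] by (auto simp: bounded_iff)
    have "\<bar>x ^ k * (r * (deriv ^^ n) f x + s * (deriv ^^ n) g x)\<bar> \<le> \<bar>r\<bar> * A + \<bar>s\<bar> * C" for x
    proof -
      have "x ^ k * (r * (deriv ^^ n) f x + s * (deriv ^^ n) g x) =
          r * (x ^ k * (deriv ^^ n) f x) + s * (x ^ k * (deriv ^^ n) g x)" by (simp add: algebra_simps)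
      also have "\<bar>\<dots>\<bar> \<le> \<bar>r\<bar> * \<bar>x ^ k * (deriv ^^ n) f x\<bar> + \<bar>s\<bar> * \<bar>x ^ k * (deriv ^^ n) g x\<bar>"
        by (rule order_trans[OF abs_triangle_ineq]) (simp only: abs_mult[of r] abs_mult[of s] order_refl)
      also have "\<dots> \<le> \<bar>r\<bar> * A + \<bar>s\<bar> * C" by (intro add_mono mult_left_mono A C) auto
      finally show ?thesis .
    qed
    then show ?thesis unfolding bounded_iff by auto
  qed
  moreover have "(\<lambda>x. r * (deriv ^^ n) f x + s * (deriv ^^ n) g x) field_differentiable at x" for n x
    by (intro derivative_intros d)
  ultimately show ?thesis by (simp add: schwartz_def higher_deriv_linear[OF d])
qed

lemma schwartz_zero: "(\<lambda>x. 0) \<in> schwartz"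
proof -
  have "(deriv ^^ n) (\<lambda>x. 0) = (\<lambda>x. 0 :: real)" for n by (induction n) auto
  then show ?thesis by (simp add: schwartz_def)
qed

lemma schwartz_sum:
  assumes "finite I" "\<And>t. t \<in> I \<Longrightarrow> \<phi> t \<in> schwartz"
  shows "(\<lambda>x. \<Sum>t\<in>I. c t * \<phi> t x) \<in> schwartz"
  using assms
proof (induction I rule: finite_induct)
  case (insert k I)
  then show ?case using schwartz_linear[of "\<phi> k" "\<lambda>x. \<Sum>t\<in>I. c t * \<phi> t x" "c k" 1] by simp
qed (simp add: schwartz_zero)

lemma tempered_sum:
  assumes \<omega>: "\<omega> \<in> tempered" and "finite I" "\<And>t. t \<in> I \<Longrightarrow> \<phi> t \<in> schwartz"
  shows "\<omega> (\<lambda>x. \<Sum>t\<in>I. c t * \<phi> t x) = (\<Sum>t\<in>I. c t * \<omega> (\<phi> t))"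
proof -
  have lin: "\<omega> (\<lambda>x. r * f x + s * g x) = r * \<omega> f + s * \<omega> g" if "f \<in> schwartz" "g \<in> schwartz" for f g r s
    using \<omega> that unfolding tempered_def by blast
  show ?thesis
    using assms(2,3)
  proof (induction I rule: finite_induct)
    case empty
    show ?case using lin[OF schwartz_zero schwartz_zero, of 0 0] by simp
  next
    case (insert k I)
    then have "\<omega> (\<lambda>x. c k * \<phi> k x + 1 * (\<Sum>t\<in>I. c t * \<phi> t x)) = c k * \<omega> (\<phi> k) + 1 * \<omega> (\<lambda>x. \<Sum>t\<in>I. c t * \<phi> t x)"
      by (intro lin schwartz_sum) auto
    then show ?case using insert by simp
  qed
qed

lemma schwartz_measurable: "f \<in> schwartz \<Longrightarrow> f \<in> borel_measurable borel"
proof -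
  assume "f \<in> schwartz"
  then have "(deriv ^^ 0) f field_differentiable at x" for x unfolding schwartz_def by blast
  then have "continuous_on UNIV f"
    by (intro continuous_at_imp_continuous_on) (auto intro: field_differentiable_imp_continuous_at)
  then show ?thesis by (rule borel_measurable_continuous_onI)
qed

lemma fox_H_measure_space:
  assumes "sets M = sets cylinder_algebra"
  shows "space M = tempered" and "\<phi> \<in> schwartz \<Longrightarrow> (\<lambda>\<omega>. \<omega> \<phi>) \<in> borel_measurable M"
proof -
  have "space M = space cylinder_algebra" by (rule sets_eq_imp_space_eq[OF assms])
  also have "\<dots> = tempered"
    by (auto simp: cylinder_algebra_def space_restrict_space space_PiM tempered_def PiE_def)
  finally show "space M = tempered" .
  show "(\<lambda>\<omega>. \<omega> \<phi>) \<in> borel_measurable M" if "\<phi> \<in> schwartz"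
    unfolding measurable_cong_sets[OF assms refl] cylinder_algebra_def
    by (intro measurable_restrict_space1 measurable_component_singleton that)
qed

section \<open>Limits in mean square\<close>

text \<open>Cauchy-Schwarz for a sum of \<open>card I\<close> terms; extended integrals spare all
  integrability conditions.\<close>

lemma nn_integral_square_sum_tendsto_0:
  fixes f :: "'t \<Rightarrow> nat \<Rightarrow> 'a \<Rightarrow> real"
  assumes I: "finite I" and m: "\<And>t n. t \<in> I \<Longrightarrow> f t n \<in> borel_measurable M"
    and lim: "\<And>t. t \<in> I \<Longrightarrow> (\<lambda>n. \<integral>\<^sup>+x. ennreal ((f t n x)\<^sup>2) \<partial>M) \<longlonglongrightarrow> 0"
  shows "(\<lambda>n. \<integral>\<^sup>+x. ennreal ((\<Sum>t\<in>I. c t * f t n x)\<^sup>2) \<partial>M) \<longlonglongrightarrow> 0"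
proof (rule tendsto_sandwich[OF _ _ tendsto_const])
  have le: "ennreal ((\<Sum>t\<in>I. c t * f t n x)\<^sup>2) \<le> (\<Sum>t\<in>I. ennreal (card I * (c t)\<^sup>2) * ennreal ((f t n x)\<^sup>2))" for n x
  proof -
    have "(\<Sum>t\<in>I. c t * f t n x)\<^sup>2 \<le> card I * (\<Sum>t\<in>I. (c t * f t n x)\<^sup>2)"
      using sum_squared_le_sum_of_squares[of "\<lambda>t. c t * f t n x" I] by (simp add: mult.commute)
    also have "\<dots> = (\<Sum>t\<in>I. (card I * (c t)\<^sup>2) * (f t n x)\<^sup>2)"
      by (simp add: sum_distrib_left power_mult_distrib mult.assoc)
    finally have "ennreal ((\<Sum>t\<in>I. c t * f t n x)\<^sup>2) \<le> ennreal (\<Sum>t\<in>I. (card I * (c t)\<^sup>2) * (f t n x)\<^sup>2)"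
      by (rule ennreal_leI)
    also have "\<dots> = (\<Sum>t\<in>I. ennreal ((card I * (c t)\<^sup>2) * (f t n x)\<^sup>2))"
      by (rule sum_ennreal[symmetric]) auto
    finally show ?thesis by (simp add: ennreal_mult)
  qed
  have "(\<integral>\<^sup>+x. ennreal ((\<Sum>t\<in>I. c t * f t n x)\<^sup>2) \<partial>M) \<le>
      (\<Sum>t\<in>I. ennreal (card I * (c t)\<^sup>2) * (\<integral>\<^sup>+x. ennreal ((f t n x)\<^sup>2) \<partial>M))" for n
  proof -
    have "(\<integral>\<^sup>+x. ennreal ((\<Sum>t\<in>I. c t * f t n x)\<^sup>2) \<partial>M) \<le>
        (\<integral>\<^sup>+x. (\<Sum>t\<in>I. ennreal (card I * (c t)\<^sup>2) * ennreal ((f t n x)\<^sup>2)) \<partial>M)"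
      by (intro nn_integral_mono le)
    also have "\<dots> = (\<Sum>t\<in>I. \<integral>\<^sup>+x. ennreal (card I * (c t)\<^sup>2) * ennreal ((f t n x)\<^sup>2) \<partial>M)"
      by (rule nn_integral_sum) (use m in auto)
    also have "\<dots> = (\<Sum>t\<in>I. ennreal (card I * (c t)\<^sup>2) * (\<integral>\<^sup>+x. ennreal ((f t n x)\<^sup>2) \<partial>M))"
      by (intro sum.cong refl nn_integral_cmult) (use m in auto)
    finally show ?thesis .
  qed
  then show "eventually (\<lambda>n. (\<integral>\<^sup>+x. ennreal ((\<Sum>t\<in>I. c t * f t n x)\<^sup>2) \<partial>M) \<le>
      (\<Sum>t\<in>I. ennreal (card I * (c t)\<^sup>2) * (\<integral>\<^sup>+x. ennreal ((f t n x)\<^sup>2) \<partial>M))) sequentially" by simp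
  have "(\<lambda>n. \<Sum>t\<in>I. ennreal (card I * (c t)\<^sup>2) * (\<integral>\<^sup>+x. ennreal ((f t n x)\<^sup>2) \<partial>M)) \<longlonglongrightarrow>
      (\<Sum>t\<in>I. ennreal (card I * (c t)\<^sup>2) * 0)"
    by (intro tendsto_sum ennreal_tendsto_cmult lim) auto
  then show "(\<lambda>n. \<Sum>t\<in>I. ennreal (card I * (c t)\<^sup>2) * (\<integral>\<^sup>+x. ennreal ((f t n x)\<^sup>2) \<partial>M)) \<longlonglongrightarrow> 0" by simp
qed simp

text \<open>An extended integral tending to 0 is eventually finite, hence from some index on a
  genuine Lebesgue integral.\<close>

lemma nn_integral_square_tendsto_0D:
  fixes D :: "nat \<Rightarrow> 'a \<Rightarrow> real"
  assumes [measurable]: "\<And>n. D n \<in> borel_measurable M"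
    and lim: "(\<lambda>n. \<integral>\<^sup>+x. ennreal ((D n x)\<^sup>2) \<partial>M) \<longlonglongrightarrow> 0"
  shows "eventually (\<lambda>n. integrable M (\<lambda>x. (D n x)\<^sup>2)) sequentially"
    and "(\<lambda>n. LINT x|M. (D n x)\<^sup>2) \<longlonglongrightarrow> 0"
proof -
  have "eventually (\<lambda>n. (\<integral>\<^sup>+x. ennreal ((D n x)\<^sup>2) \<partial>M) < 1) sequentially"
    using lim by (rule order_tendstoD) simp
  then show ev: "eventually (\<lambda>n. integrable M (\<lambda>x. (D n x)\<^sup>2)) sequentially"
  proof eventually_elim
    case (elim n)
    then have "(\<integral>\<^sup>+x. ennreal ((D n x)\<^sup>2) \<partial>M) < \<infinity>" by (rule order_less_trans) simp
    then show ?case by (intro integrableI_nonneg) auto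
  qed
  have "(\<lambda>n. enn2real (\<integral>\<^sup>+x. ennreal ((D n x)\<^sup>2) \<partial>M)) \<longlonglongrightarrow> enn2real 0"
    by (rule tendsto_enn2real) (use lim in auto)
  then show "(\<lambda>n. LINT x|M. (D n x)\<^sup>2) \<longlonglongrightarrow> 0"
    by (simp add: integral_eq_nn_integral)
qed

text \<open>With the choice \<open>\<epsilon> = sqrt d + 1 / (n + 1)\<close> both error terms of a Young type bound
  \<open>\<epsilon> C + d / \<epsilon>\<close> vanish in the limit.\<close>

lemma young_bound_tendsto_0:
  fixes d :: "nat \<Rightarrow> real"
  assumes d: "d \<longlonglongrightarrow> 0" "\<And>n. d n \<ge> 0"
    and b: "eventually (\<lambda>n. \<forall>\<epsilon>>0. norm (x n) \<le> \<epsilon> * C + A * d n + d n / \<epsilon>) sequentially"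
  shows "x \<longlonglongrightarrow> 0"
proof (rule Lim_null_comparison)
  let ?\<epsilon> = "\<lambda>n. sqrt (d n) + 1 / (real n + 1)"
  show "eventually (\<lambda>n. norm (x n) \<le> ?\<epsilon> n * C + A * d n + sqrt (d n)) sequentially"
    using b
  proof eventually_elim
    case (elim n)
    have e: "?\<epsilon> n > 0" using d(2)[of n] by (intro add_nonneg_pos) auto
    have "d n = sqrt (d n) * sqrt (d n)" using d(2)[of n] by simp
    also have "\<dots> \<le> sqrt (d n) * ?\<epsilon> n" using d(2)[of n] by (intro mult_left_mono) auto
    finally have "d n / ?\<epsilon> n \<le> sqrt (d n)" using e by (simp add: divide_le_eq)
    with elim e show ?case by (smt (verit))
  qed
  have "(\<lambda>n. sqrt (d n)) \<longlonglongrightarrow> 0" using tendsto_real_sqrt[OF d(1)] by simp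
  moreover have "(\<lambda>n. 1 / (real n + 1)) \<longlonglongrightarrow> 0" by real_asymp
  ultimately have "(\<lambda>n. ?\<epsilon> n * C + A * d n + sqrt (d n)) \<longlonglongrightarrow> (0 + 0) * C + A * 0 + 0"
    by (intro tendsto_intros d)
  then show "(\<lambda>n. ?\<epsilon> n * C + A * d n + sqrt (d n)) \<longlonglongrightarrow> 0" by simp
qed

text \<open>The difference of the squares is 2 g (f_n - g) + (f_n - g)^2, and the cross term is
  split by Young's inequality with weights \<open>sqrt \<epsilon>\<close> and
  \<open>1 / sqrt \<epsilon>\<close>.\<close>

lemma integral_square_tendsto:
  fixes f :: "nat \<Rightarrow> 'a \<Rightarrow> real"
  assumes [measurable]: "\<And>n. f n \<in> borel_measurable M" "g \<in> borel_measurable M"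
    and g: "integrable M (\<lambda>x. (g x)\<^sup>2)"
    and lim: "(\<lambda>n. \<integral>\<^sup>+x. ennreal ((f n x - g x)\<^sup>2) \<partial>M) \<longlonglongrightarrow> 0"
  shows "(\<lambda>n. LINT x|M. (f n x)\<^sup>2) \<longlonglongrightarrow> (LINT x|M. (g x)\<^sup>2)"
proof -
  define d where "d n = (LINT x|M. (f n x - g x)\<^sup>2)" for n
  have D: "eventually (\<lambda>n. integrable M (\<lambda>x. (f n x - g x)\<^sup>2)) sequentially" "d \<longlonglongrightarrow> 0"
    unfolding d_def using nn_integral_square_tendsto_0D[OF _ lim] by auto
  have "(\<lambda>n. (LINT x|M. (f n x)\<^sup>2) - (LINT x|M. (g x)\<^sup>2)) \<longlonglongrightarrow> 0"
  proof (rule young_bound_tendsto_0[OF D(2)])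
    show "d n \<ge> 0" for n unfolding d_def by (rule Bochner_Integration.integral_nonneg) simp
    show "eventually (\<lambda>n. \<forall>\<epsilon>>0. norm ((LINT x|M. (f n x)\<^sup>2) - (LINT x|M. (g x)\<^sup>2)) \<le>
        \<epsilon> * (LINT x|M. (g x)\<^sup>2) + 1 * d n + d n / \<epsilon>) sequentially"
      using D(1)
    proof (eventually_elim, intro allI impI)
      fix n and \<epsilon> :: real assume int: "integrable M (\<lambda>x. (f n x - g x)\<^sup>2)" and \<epsilon>: "\<epsilon> > 0"
      have fg: "integrable M (\<lambda>x. g x * (f n x - g x))"
        by (rule integrable_mult_square) (use g int in auto)
      have eq: "(f n x)\<^sup>2 = (g x)\<^sup>2 + 2 * (g x * (f n x - g x)) + (f n x - g x)\<^sup>2" for x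
        by (simp add: power2_eq_square algebra_simps)
      have "(LINT x|M. (f n x)\<^sup>2) = (LINT x|M. (g x)\<^sup>2) + 2 * (LINT x|M. g x * (f n x - g x)) + d n"
        unfolding eq d_def using g fg int by simp
      moreover have "\<bar>2 * (LINT x|M. g x * (f n x - g x))\<bar> \<le> \<epsilon> * (LINT x|M. (g x)\<^sup>2) + d n / \<epsilon>"
      proof -
        have "\<bar>2 * (LINT x|M. g x * (f n x - g x))\<bar> = \<bar>LINT x|M. 2 * (g x * (f n x - g x))\<bar>" by simp
        also have "\<dots> \<le> (LINT x|M. \<bar>2 * (g x * (f n x - g x))\<bar>)" by (rule integral_abs_bound)
        also have "\<dots> \<le> (LINT x|M. \<epsilon> * (g x)\<^sup>2 + (f n x - g x)\<^sup>2 / \<epsilon>)"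
        proof (rule integral_mono)
          fix x
          have "2 * (sqrt \<epsilon> * \<bar>g x\<bar>) * (\<bar>f n x - g x\<bar> / sqrt \<epsilon>) \<le> (sqrt \<epsilon> * \<bar>g x\<bar>)\<^sup>2 + (\<bar>f n x - g x\<bar> / sqrt \<epsilon>)\<^sup>2"
            by (rule sum_squares_bound)
          then show "\<bar>2 * (g x * (f n x - g x))\<bar> \<le> \<epsilon> * (g x)\<^sup>2 + (f n x - g x)\<^sup>2 / \<epsilon>"
            using \<epsilon> by (simp add: power_mult_distrib power_divide abs_mult)
        qed (use g int fg in auto)
        also have "\<dots> = \<epsilon> * (LINT x|M. (g x)\<^sup>2) + d n / \<epsilon>" unfolding d_def using g int by simp
        finally show ?thesis .
      qed
      ultimately show "norm ((LINT x|M. (f n x)\<^sup>2) - (LINT x|M. (g x)\<^sup>2)) \<le> \<epsilon> * (LINT x|M. (g x)\<^sup>2) + 1 * d n + d n / \<epsilon>"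
        using \<open>\<And>n. d n \<ge> 0\<close>[of n] unfolding real_norm_def by (simp add: abs_le_iff)
    qed
  qed
  then show ?thesis by (rule LIM_zero_cancel)
qed

text \<open>The map \<open>iexp\<close> is 1-Lipschitz, and |u| <= \<epsilon> + u^2 / \<epsilon>
  turns the first-order bound into mean squares.\<close>

lemma iexp_integral_tendsto:
  fixes U :: "nat \<Rightarrow> 'a \<Rightarrow> real"
  assumes M: "prob_space M" and [measurable]: "\<And>n. U n \<in> borel_measurable M" "V \<in> borel_measurable M"
    and lim: "(\<lambda>n. \<integral>\<^sup>+x. ennreal ((U n x - V x)\<^sup>2) \<partial>M) \<longlonglongrightarrow> 0"
  shows "(\<lambda>n. LINT x|M. iexp (U n x)) \<longlonglongrightarrow> (LINT x|M. iexp (V x))"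
proof -
  interpret prob_space M by fact
  define d where "d n = (LINT x|M. (U n x - V x)\<^sup>2)" for n
  have D: "eventually (\<lambda>n. integrable M (\<lambda>x. (U n x - V x)\<^sup>2)) sequentially" "d \<longlonglongrightarrow> 0"
    unfolding d_def using nn_integral_square_tendsto_0D[OF _ lim] by auto
  have i: "integrable M (\<lambda>x. iexp (U n x))" "integrable M (\<lambda>x. iexp (V x))" for n
    by (rule integrable_const_bound[of _ 1]; simp)+
  have "(\<lambda>n. (LINT x|M. iexp (U n x)) - (LINT x|M. iexp (V x))) \<longlonglongrightarrow> 0"
  proof (rule young_bound_tendsto_0[OF D(2)])
    show "d n \<ge> 0" for n unfolding d_def by (rule Bochner_Integration.integral_nonneg) simp
    show "eventually (\<lambda>n. \<forall>\<epsilon>>0. norm ((LINT x|M. iexp (U n x)) - (LINT x|M. iexp (V x))) \<le>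
        \<epsilon> * 1 + 0 * d n + d n / \<epsilon>) sequentially"
      using D(1)
    proof (eventually_elim, intro allI impI)
      fix n and \<epsilon> :: real assume int: "integrable M (\<lambda>x. (U n x - V x)\<^sup>2)" and \<epsilon>: "\<epsilon> > 0"
      have "norm ((LINT x|M. iexp (U n x)) - (LINT x|M. iexp (V x))) = norm (LINT x|M. iexp (U n x) - iexp (V x))"
        using i by simp
      also have "\<dots> \<le> (LINT x|M. norm (iexp (U n x) - iexp (V x)))" by (rule integral_norm_bound)
      also have "\<dots> \<le> (LINT x|M. \<epsilon> + (U n x - V x)\<^sup>2 / \<epsilon>)"
      proof (rule integral_mono)
        fix x
        have "iexp (U n x) - iexp (V x) = iexp (V x) * (iexp (U n x - V x) - 1)"
          by (simp add: right_diff_distrib flip: exp_add)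
        then have "norm (iexp (U n x) - iexp (V x)) = norm (iexp (U n x - V x) - 1)"
          by (simp add: norm_mult)
        also have "\<dots> \<le> \<bar>U n x - V x\<bar>" using iexp_approx1[of "U n x - V x" 0] by simp
        also have "\<dots> \<le> \<epsilon> + (U n x - V x)\<^sup>2 / \<epsilon>"
        proof -
          have "2 * \<epsilon> * \<bar>U n x - V x\<bar> \<le> \<epsilon>\<^sup>2 + \<bar>U n x - V x\<bar>\<^sup>2" by (rule sum_squares_bound)
          moreover have "0 \<le> \<epsilon> * \<bar>U n x - V x\<bar>" using \<epsilon> by simp
          ultimately have "\<epsilon> * \<bar>U n x - V x\<bar> \<le> \<epsilon>\<^sup>2 + (U n x - V x)\<^sup>2" by simp
          then show ?thesis using \<epsilon> by (simp add: field_simps power2_eq_square)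
        qed
        finally show "norm (iexp (U n x) - iexp (V x)) \<le> \<epsilon> + (U n x - V x)\<^sup>2 / \<epsilon>" .
      qed (use i int in auto)
      also have "\<dots> = \<epsilon> * 1 + 0 * d n + d n / \<epsilon>" unfolding d_def using int by (simp add: prob_space)
      finally show "norm ((LINT x|M. iexp (U n x)) - (LINT x|M. iexp (V x))) \<le> \<epsilon> * 1 + 0 * d n + d n / \<epsilon>" .
    qed
  qed
  then show ?thesis by (rule LIM_zero_cancel)
qed

section \<open>Characteristic functions of the three processes\<close>

lemma laplace_tendsto:
  fixes s :: "nat \<Rightarrow> real"
  assumes P: "prob_space P" and [measurable]: "Y \<in> borel_measurable P" and pos: "AE \<omega> in P. Y \<omega> > 0"
    and s: "\<And>n. s n \<ge> 0" "s \<longlonglongrightarrow> r"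
  shows "(\<lambda>n. LINT \<omega>|P. exp (- s n * Y \<omega>)) \<longlonglongrightarrow> (LINT \<omega>|P. exp (- r * Y \<omega>))"
proof -
  interpret prob_space P by fact
  show ?thesis
  proof (rule integral_dominated_convergence[where w = "\<lambda>_. 1"])
    show "AE \<omega> in P. (\<lambda>n. exp (- s n * Y \<omega>)) \<longlonglongrightarrow> exp (- r * Y \<omega>)"
      by (intro AE_I2 tendsto_intros s)
    show "AE \<omega> in P. norm (exp (- s n * Y \<omega>)) \<le> 1" for n
      using pos by eventually_elim (use s(1)[of n] in simp)
  qed simp_all
qed

text \<open>The approximants supplied by the definition of the process converge simultaneously on
  the line and under M. Their linear combinations are again Schwartz functions, so the
  characteristic functional can be evaluated along them.\<close>

lemma fox_H_process_char:
  assumes M: "fox_H_measure c m p a \<alpha> b \<beta> M" and H: "0 < H" "H < 1" and X: "is_fox_H_process H M X"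
    and P: "prob_space P" and Y: "Y \<in> borel_measurable P" "AE \<omega> in P. Y \<omega> > 0"
    and L: "\<And>s. s \<ge> 0 \<Longrightarrow> complex_of_real (LINT \<omega>|P. exp (- s * Y \<omega>)) =
      1 / of_real (fox_K m p a \<alpha> b \<beta>) * wright_Psi c m p a \<alpha> b \<beta> (- s)"
    and I: "finite I" "I \<subseteq> {0..}"
  shows "(LINT \<omega>|M. iexp (\<Sum>t\<in>I. d t * X t \<omega>)) = of_real (LINT \<omega>|P. exp (- (fbm_form H I d / 2) * Y \<omega>))"
proof -
  have M': "prob_space M" "sets M = sets cylinder_algebra" using M by (auto simp: fox_H_measure_def)
  note sp = fox_H_measure_space[OF M'(2)]
  have I0: "t \<ge> 0" if "t \<in> I" for t using I that by auto
  have "\<forall>t\<in>I. \<exists>\<phi>. (\<forall>n. \<phi> n \<in> schwartz) \<and>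
      (\<lambda>n. \<integral>\<^sup>+x. ennreal ((\<phi> n x - frac_M_minus H (indicator {0..<t}) x)\<^sup>2) \<partial>lborel) \<longlonglongrightarrow> 0 \<and>
      (\<lambda>n. \<integral>\<^sup>+\<omega>. ennreal ((\<omega> (\<phi> n) - X t \<omega>)\<^sup>2) \<partial>M) \<longlonglongrightarrow> 0"
    using X I0 unfolding is_fox_H_process_def is_L2_pairing_def by blast
  then obtain \<phi> where \<phi>: "\<And>t n. t \<in> I \<Longrightarrow> \<phi> t n \<in> schwartz"
      "\<And>t. t \<in> I \<Longrightarrow> (\<lambda>n. \<integral>\<^sup>+x. ennreal ((\<phi> t n x - frac_M_minus H (indicator {0..<t}) x)\<^sup>2) \<partial>lborel) \<longlonglongrightarrow> 0"
      "\<And>t. t \<in> I \<Longrightarrow> (\<lambda>n. \<integral>\<^sup>+\<omega>. ennreal ((\<omega> (\<phi> t n) - X t \<omega>)\<^sup>2) \<partial>M) \<longlonglongrightarrow> 0"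
    by (auto dest!: bchoice)
  have Xm: "X t \<in> borel_measurable M" if "t \<in> I" for t
    using X I0[OF that] by (auto simp: is_fox_H_process_def is_L2_pairing_def)
  have \<phi>m: "\<phi> t n \<in> borel_measurable lborel" if "t \<in> I" for t n
    using schwartz_measurable[OF \<phi>(1)[OF that]] by simp
  define \<Phi> where "\<Phi> n x = (\<Sum>t\<in>I. d t * \<phi> t n x)" for n x
  define k where "k x = (\<Sum>t\<in>I. d t * mvn_kernel H t x)" for x
  have \<Phi>: "\<Phi> n \<in> schwartz" for n
    unfolding \<Phi>_def by (intro schwartz_sum I \<phi>)
  have km: "k \<in> borel_measurable lborel" unfolding k_def by measurable
  have "(\<lambda>n. \<integral>\<^sup>+x. ennreal ((\<phi> t n x - mvn_kernel H t x)\<^sup>2) \<partial>lborel) \<longlonglongrightarrow> 0" if t: "t \<in> I" for t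
  proof -
    have "AE x in lborel. frac_M_minus H (indicator {0..<t}) x = mvn_kernel H t x"
      using AE_lborel_singleton[of 0] AE_lborel_singleton[of t]
      by eventually_elim (use H I0[OF t] in \<open>auto intro!: frac_M_minus_indicator\<close>)
    then have "(\<integral>\<^sup>+x. ennreal ((\<phi> t n x - frac_M_minus H (indicator {0..<t}) x)\<^sup>2) \<partial>lborel) =
        (\<integral>\<^sup>+x. ennreal ((\<phi> t n x - mvn_kernel H t x)\<^sup>2) \<partial>lborel)" for n
      by (intro nn_integral_cong_AE) (auto elim: eventually_mono)
    with \<phi>(2)[OF t] show ?thesis by simp
  qed
  then have "(\<lambda>n. \<integral>\<^sup>+x. ennreal ((\<Sum>t\<in>I. d t * (\<phi> t n x - mvn_kernel H t x))\<^sup>2) \<partial>lborel) \<longlonglongrightarrow> 0"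
    using \<phi>m by (intro nn_integral_square_sum_tendsto_0 I) auto
  then have "(\<lambda>n. \<integral>\<^sup>+x. ennreal ((\<Phi> n x - k x)\<^sup>2) \<partial>lborel) \<longlonglongrightarrow> 0"
    by (simp add: \<Phi>_def k_def right_diff_distrib sum_subtractf)
  moreover have k2: "has_bochner_integral lborel (\<lambda>x. (k x)\<^sup>2) (fbm_form H I d)"
    unfolding k_def fbm_form_def
  proof (rule integral_square_sum)
    fix t s assume "t \<in> I" "s \<in> I"
    with mvn_kernel_inner[OF H, of t s] I0[of t] I0[of s]
    show "has_bochner_integral lborel (\<lambda>x. mvn_kernel H t x * mvn_kernel H s x) (fbm_cov H t s)"
      by (simp add: fbm_cov_def)
  qed
  ultimately have "(\<lambda>n. LINT x|lborel. (\<Phi> n x)\<^sup>2) \<longlonglongrightarrow> (LINT x|lborel. (k x)\<^sup>2)"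
    using schwartz_measurable[OF \<Phi>] km by (intro integral_square_tendsto) (auto simp: has_bochner_integral_iff)
  then have "(\<lambda>n. 1 / 2 * (LINT x|lborel. (\<Phi> n x)\<^sup>2)) \<longlonglongrightarrow> 1 / 2 * (LINT x|lborel. (k x)\<^sup>2)"
    by (intro tendsto_intros)
  also have "1 / 2 * (LINT x|lborel. (k x)\<^sup>2) = fbm_form H I d / 2"
    using k2 by (simp add: has_bochner_integral_iff)
  \<comment> \<open>Continuity in the argument is obtained on the Laplace side, by dominated
    convergence, rather than from the contour integral of \<open>wright_Psi\<close>.\<close>
  finally have "(\<lambda>n. complex_of_real (LINT \<omega>|P. exp (- (1 / 2 * (LINT x|lborel. (\<Phi> n x)\<^sup>2)) * Y \<omega>))) \<longlonglongrightarrow>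
      of_real (LINT \<omega>|P. exp (- (fbm_form H I d / 2) * Y \<omega>))"
    by (intro tendsto_of_real laplace_tendsto P Y) (simp add: Bochner_Integration.integral_nonneg)
  moreover have "complex_of_real (LINT \<omega>|P. exp (- (1 / 2 * (LINT x|lborel. (\<Phi> n x)\<^sup>2)) * Y \<omega>)) =
      (LINT \<omega>|M. iexp (\<omega> (\<Phi> n)))" for n
  proof -
    have "(LINT \<omega>|M. iexp (\<omega> (\<Phi> n))) = 1 / of_real (fox_K m p a \<alpha> b \<beta>) *
        wright_Psi c m p a \<alpha> b \<beta> (- (1 / 2) * (LBINT x. \<Phi> n x * \<Phi> n x))"
      using M \<Phi>[of n] unfolding fox_H_measure_def by blast
    also have "- (1 / 2) * (LBINT x. \<Phi> n x * \<Phi> n x) = - (1 / 2 * (LINT x|lborel. (\<Phi> n x)\<^sup>2))"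
      by (simp add: power2_eq_square)
    finally show ?thesis by (subst L) (simp_all add: Bochner_Integration.integral_nonneg)
  qed
  ultimately have lim1: "(\<lambda>n. LINT \<omega>|M. iexp (\<omega> (\<Phi> n))) \<longlonglongrightarrow> of_real (LINT \<omega>|P. exp (- (fbm_form H I d / 2) * Y \<omega>))"
    by simp
  have "(\<lambda>n. \<integral>\<^sup>+\<omega>. ennreal ((\<Sum>t\<in>I. d t * (\<omega> (\<phi> t n) - X t \<omega>))\<^sup>2) \<partial>M) \<longlonglongrightarrow> 0"
    using sp(2)[OF \<phi>(1)] Xm \<phi>(3) by (intro nn_integral_square_sum_tendsto_0 I) auto
  also have "(\<lambda>n. \<integral>\<^sup>+\<omega>. ennreal ((\<Sum>t\<in>I. d t * (\<omega> (\<phi> t n) - X t \<omega>))\<^sup>2) \<partial>M) =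
      (\<lambda>n. \<integral>\<^sup>+\<omega>. ennreal ((\<omega> (\<Phi> n) - (\<Sum>t\<in>I. d t * X t \<omega>))\<^sup>2) \<partial>M)"
  proof (rule ext, rule nn_integral_cong)
    fix n \<omega> assume "\<omega> \<in> space M"
    then have "\<omega> (\<Phi> n) = (\<Sum>t\<in>I. d t * \<omega> (\<phi> t n))"
      unfolding \<Phi>_def sp(1) by (intro tempered_sum I \<phi>)
    then show "ennreal ((\<Sum>t\<in>I. d t * (\<omega> (\<phi> t n) - X t \<omega>))\<^sup>2) = ennreal ((\<omega> (\<Phi> n) - (\<Sum>t\<in>I. d t * X t \<omega>))\<^sup>2)"
      by (simp add: right_diff_distrib sum_subtractf)
  qed
  finally have "(\<lambda>n. LINT \<omega>|M. iexp (\<omega> (\<Phi> n))) \<longlonglongrightarrow> (LINT \<omega>|M. iexp (\<Sum>t\<in>I. d t * X t \<omega>))"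
    using sp(2)[OF \<Phi>] Xm by (intro iexp_integral_tendsto M') auto
  with lim1 show ?thesis using LIMSEQ_unique by blast
qed

section \<open>Scaling relations and the two processes built from fractional Brownian motion\<close>

lemma fbm_form_scale: "fbm_form H I (\<lambda>t. c t * r) = r\<^sup>2 * fbm_form H I c"
  by (simp add: fbm_form_def sum_distrib_left power2_eq_square mult_ac)

lemma fbm_form_time_scale:
  assumes v: "v > 0" and I: "I \<subseteq> {0..}"
  shows "fbm_form H ((\<lambda>t. t * v) ` I) (\<lambda>u. c (u / v)) = v powr (2 * H) * fbm_form H I c"
proof -
  have inj: "inj_on (\<lambda>t. t * v) I" using v by (auto intro: inj_onI)
  have "fbm_form H ((\<lambda>t. t * v) ` I) (\<lambda>u. c (u / v)) = (\<Sum>t\<in>I. \<Sum>s\<in>I. c t * c s * fbm_cov H (t * v) (s * v))"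
    unfolding fbm_form_def sum.reindex[OF inj] o_def using v by simp
  also have "\<dots> = (\<Sum>t\<in>I. \<Sum>s\<in>I. v powr (2 * H) * (c t * c s * fbm_cov H t s))"
    using I v by (intro sum.cong refl) (auto simp: fbm_cov_scale subset_eq)
  finally show ?thesis by (simp add: fbm_form_def sum_distrib_left)
qed

text \<open>Freezing Y at y > 0 leaves a Gaussian sum of variance y times
  \<open>fbm_form H I c\<close>: in one case through the coefficients, scaled by sqrt y, in the
  other through the times, scaled by y^(1/(2H)).\<close>

lemma
  assumes P: "prob_space P" and Y: "Y \<in> borel_measurable P" "AE \<omega> in P. Y \<omega> > 0" and H: "0 < H"
    and B: "fractional_Brownian_motion P H B"
    and indep: "prob_space.indep_set P
           (sets (vimage_algebra (space P) Y borel))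
           (sets (vimage_algebra (space P) (\<lambda>\<omega>. \<lambda>t\<in>{0..}. B t \<omega>) (Pi\<^sub>M {0..} (\<lambda>_. borel))))"
  shows fbm_time_changed_measurable:
      "\<And>t. t \<ge> 0 \<Longrightarrow> (\<lambda>\<omega>. B (t * Y \<omega> powr (1 / (2 * H))) \<omega>) \<in> borel_measurable P"
    and fbm_scaled_char: "\<And>(I :: real set) c. finite I \<Longrightarrow> I \<subseteq> {0..} \<Longrightarrow>
      (LINT \<omega>|P. iexp (\<Sum>t\<in>I. c t * (sqrt (Y \<omega>) * B t \<omega>))) = of_real (LINT \<omega>|P. exp (- (fbm_form H I c / 2) * Y \<omega>))"
    and fbm_time_changed_char: "\<And>(I :: real set) c. finite I \<Longrightarrow> I \<subseteq> {0..} \<Longrightarrow>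
      (LINT \<omega>|P. iexp (\<Sum>t\<in>I. c t * B (t * Y \<omega> powr (1 / (2 * H))) \<omega>)) = of_real (LINT \<omega>|P. exp (- (fbm_form H I c / 2) * Y \<omega>))"
proof -
  interpret prob_space P by fact
  note [measurable] = Y(1)
  let ?Bv = "\<lambda>\<omega>. \<lambda>t\<in>{0..}. B t \<omega>"
  define N where "N = vimage_algebra (space P) ?Bv (Pi\<^sub>M {0..} (\<lambda>_. borel))"
  have spN: "space N = space P" by (simp add: N_def)
  have indepN: "indep_set (sets (vimage_algebra (space P) Y borel)) (sets N)"
    using indep unfolding N_def .
  have BN: "B t \<in> borel_measurable N" if t: "t \<ge> 0" for t
  proof -
    have v: "?Bv \<in> measurable N (Pi\<^sub>M {0..} (\<lambda>_. borel))"
      unfolding N_def by (rule measurable_vimage_algebra1) (auto simp: space_PiM)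
    have "(\<lambda>\<omega>. ?Bv \<omega> t) \<in> borel_measurable N"
      by (rule measurable_compose[OF v measurable_component_singleton]) (use t in auto)
    with t show ?thesis by simp
  qed
  have cont: "continuous_on {0..} (\<lambda>t. B t \<omega>)" if "\<omega> \<in> space P" for \<omega>
    using B that by (auto simp: fractional_Brownian_motion_def)
  note BP = fbm_measurable[OF B]
  show "(\<lambda>\<omega>. B (t * Y \<omega> powr (1 / (2 * H))) \<omega>) \<in> borel_measurable P" if t: "t \<ge> 0" for t
    by (rule borel_measurable_continuous_process[where N = P]) (use BP cont t in auto)
  fix I :: "real set" and c assume I: "finite I" "I \<subseteq> {0..}"
  have I0: "t \<ge> 0" if "t \<in> I" for t using that I by auto
  \<comment> \<open>The inner formula is asked only for y > 0, since Y is positive almost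
    surely.\<close>
  have iterate: "(LINT \<omega>|P. F (Y \<omega>) \<omega>) = of_real (LINT \<omega>|P. exp (- (fbm_form H I c / 2) * Y \<omega>))"
    if F: "(\<lambda>(y, \<omega>). F y \<omega>) \<in> borel_measurable (borel \<Otimes>\<^sub>M N)" "\<And>y \<omega>. norm (F y \<omega>) \<le> 1"
      and inner: "\<And>y. y > 0 \<Longrightarrow> (LINT \<omega>|P. F y \<omega>) = of_real (exp (- (fbm_form H I c / 2) * y))"
    for F :: "real \<Rightarrow> 'a \<Rightarrow> complex"
  proof -
    let ?F = "\<lambda>(y, \<omega>). F y \<omega>"
    have [measurable]: "(\<lambda>y. LINT \<omega>|P. F y \<omega>) \<in> borel_measurable borel"
      using borel_measurable_section_integral[OF P spN indep_setD_ev2[OF indepN] F(1)] by (simp only: prod.case)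
    have "(LINT \<omega>|P. ?F (Y \<omega>, \<omega>)) = (LINT \<omega>'|P. LINT \<omega>|P. ?F (Y \<omega>', \<omega>))"
      by (rule indep_expectation_iterated[OF P Y(1) spN indepN F(1)]) (simp add: F(2) split: prod.split)
    then have "(LINT \<omega>|P. F (Y \<omega>) \<omega>) = (LINT \<omega>'|P. LINT \<omega>|P. F (Y \<omega>') \<omega>)" by (simp only: prod.case)
    also have "\<dots> = (LINT \<omega>|P. of_real (exp (- (fbm_form H I c / 2) * Y \<omega>)))"
    proof (rule integral_cong_AE)
      show "AE \<omega>' in P. (LINT \<omega>|P. F (Y \<omega>') \<omega>) = of_real (exp (- (fbm_form H I c / 2) * Y \<omega>'))"
        using Y(2) by eventually_elim (rule inner)
    qed measurable
    finally show ?thesis by (simp only: integral_complex_of_real)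
  qed
  have norm1: "norm (iexp x) \<le> 1" for x by simp
  show "(LINT \<omega>|P. iexp (\<Sum>t\<in>I. c t * (sqrt (Y \<omega>) * B t \<omega>))) = of_real (LINT \<omega>|P. exp (- (fbm_form H I c / 2) * Y \<omega>))"
  proof (rule iterate[of "\<lambda>y \<omega>. iexp (\<Sum>t\<in>I. c t * (sqrt y * B t \<omega>))"])
    have [measurable]: "B t \<in> borel_measurable N" if "t \<in> I" for t using BN I0 that by simp
    show "(\<lambda>(y, \<omega>). iexp (\<Sum>t\<in>I. c t * (sqrt y * B t \<omega>))) \<in> borel_measurable (borel \<Otimes>\<^sub>M N)"
      by measurable
    show "norm (iexp (\<Sum>t\<in>I. c t * (sqrt y * B t \<omega>))) \<le> 1" for y \<omega> by (rule norm1)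
    fix y :: real assume y: "y > 0"
    have "(LINT \<omega>|P. iexp (\<Sum>t\<in>I. c t * (sqrt y * B t \<omega>))) = (LINT \<omega>|P. iexp (\<Sum>t\<in>I. (c t * sqrt y) * B t \<omega>))"
      by (simp only: mult.assoc)
    also have "\<dots> = of_real (exp (- fbm_form H I (\<lambda>t. c t * sqrt y) / 2))" by (rule fbm_char[OF P B I])
    also have "- fbm_form H I (\<lambda>t. c t * sqrt y) / 2 = - (fbm_form H I c / 2) * y"
      using y by (simp add: fbm_form_scale)
    finally show "(LINT \<omega>|P. iexp (\<Sum>t\<in>I. c t * (sqrt y * B t \<omega>))) = of_real (exp (- (fbm_form H I c / 2) * y))" .
  qed
  define F where "F y \<omega> = iexp (\<Sum>t\<in>I. c t * B (t * y powr (1 / (2 * H))) \<omega>)" for y \<omega>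
  have "(LINT \<omega>|P. F (Y \<omega>) \<omega>) = of_real (LINT \<omega>|P. exp (- (fbm_form H I c / 2) * Y \<omega>))"
  proof (rule iterate)
    have [measurable]: "(\<lambda>z. B (t * fst z powr (1 / (2 * H))) (snd z)) \<in> borel_measurable (borel \<Otimes>\<^sub>M N)" if t: "t \<in> I" for t
    proof (rule borel_measurable_continuous_process[OF BN cont])
      show "(\<lambda>z. t * fst z powr (1 / (2 * H))) \<in> borel_measurable (borel \<Otimes>\<^sub>M N)" by measurable
      show "snd \<in> measurable (borel \<Otimes>\<^sub>M N) N" by (rule measurable_snd)
      show "0 \<le> t * fst z powr (1 / (2 * H))" for z using I0[OF t] by simp
    qed (simp_all add: spN)
    show "(\<lambda>(y, \<omega>). F y \<omega>) \<in> borel_measurable (borel \<Otimes>\<^sub>M N)"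
      unfolding case_prod_beta F_def by measurable
    show "norm (F y \<omega>) \<le> 1" for y \<omega> unfolding F_def by (rule norm1)
    fix y :: real assume y: "y > 0"
    \<comment> \<open>Chosen so that v^(2H) = y, the factor gained by the covariance under time
      scaling.\<close>
    define v where "v = y powr (1 / (2 * H))"
    have v: "v > 0" "v powr (2 * H) = y" using y H by (simp_all add: v_def powr_powr)
    have inj: "inj_on (\<lambda>t. t * v) I" using v by (auto intro: inj_onI)
    have "(LINT \<omega>|P. iexp (\<Sum>t\<in>I. c t * B (t * v) \<omega>)) = (LINT \<omega>|P. iexp (\<Sum>u\<in>(\<lambda>t. t * v) ` I. c (u / v) * B u \<omega>))"
      unfolding sum.reindex[OF inj] o_def using v by simp
    also have "\<dots> = of_real (exp (- fbm_form H ((\<lambda>t. t * v) ` I) (\<lambda>u. c (u / v)) / 2))"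
      by (rule fbm_char[OF P B]) (use I I0 v in \<open>auto intro!: mult_nonneg_nonneg\<close>)
    also have "- fbm_form H ((\<lambda>t. t * v) ` I) (\<lambda>u. c (u / v)) / 2 = - (fbm_form H I c / 2) * y"
      unfolding fbm_form_time_scale[OF v(1) I(2)] v(2) by simp
    finally show "(LINT \<omega>|P. F y \<omega>) = of_real (exp (- (fbm_form H I c / 2) * y))"
      unfolding v_def F_def .
  qed
  then show "(LINT \<omega>|P. iexp (\<Sum>t\<in>I. c t * B (t * Y \<omega> powr (1 / (2 * H))) \<omega>)) =
      of_real (LINT \<omega>|P. exp (- (fbm_form H I c / 2) * Y \<omega>))"
    unfolding F_def .
qed

section \<open>Equality of the finite-dimensional distributions\<close>

theorem proposition3p9:
  fixes m p :: nat and a \<alpha> b \<beta> :: "nat \<Rightarrow> real" and \<gamma> c H :: real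
    and M :: "((real \<Rightarrow> real) \<Rightarrow> real) measure"
    and X :: "real \<Rightarrow> ((real \<Rightarrow> real) \<Rightarrow> real) \<Rightarrow> real"
    and P :: "'w measure" and Y :: "'w \<Rightarrow> real" and B :: "real \<Rightarrow> 'w \<Rightarrow> real"
  assumes "\<forall>i\<in>{1..p}. \<alpha> i > 0 \<and> a i + \<alpha> i > 0"
    and "\<forall>j\<in>{1..m}. \<beta> j > 0 \<and> b j + \<beta> j > 0"
    and "fox_astar m p \<alpha> \<beta> > 0 \<or> (fox_astar m p \<alpha> \<beta> = 0 \<and> fox_mu m p a b < -1)"
    and "\<forall>j\<in>{1..m}. \<gamma> > - b j / \<beta> j"
    and "\<forall>\<tau>>0. fox_H \<gamma> m p a \<alpha> b \<beta> \<tau> \<in> \<real>\<^sub>\<ge>\<^sub>0"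
    and "0 < c" and "\<forall>j\<in>{1..m}. c < (b j + \<beta> j) / \<beta> j"
    and "0 < H" and "H < 1"
    and "fox_H_measure c m p a \<alpha> b \<beta> M"
    and "is_fox_H_process H M X"
    and "prob_space P"
    and "AE \<omega> in P. Y \<omega> > 0"
    and "distributed P lborel Y (\<lambda>\<tau>. ennreal
           (if \<tau> > 0 then 1 / fox_K m p a \<alpha> b \<beta> * Re (fox_H \<gamma> m p a \<alpha> b \<beta> \<tau>) else 0))"
    and "fractional_Brownian_motion P H B"
    and "prob_space.indep_set P
           (sets (vimage_algebra (space P) Y borel))
           (sets (vimage_algebra (space P) (\<lambda>\<omega>. \<lambda>t\<in>{0..}. B t \<omega>)
             (Pi\<^sub>M {0..} (\<lambda>_. borel))))"
  shows "same_fdd {0..} M X P (\<lambda>t \<omega>. sqrt (Y \<omega>) * B t \<omega>) \<and>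
         same_fdd {0..} P (\<lambda>t \<omega>. sqrt (Y \<omega>) * B t \<omega>)
                        P (\<lambda>t \<omega>. B (t * Y \<omega> powr (1 / (2 * H))) \<omega>)"
proof -
  have P: "prob_space P" by fact
  have M: "prob_space M" using assms(10) by (simp add: fox_H_measure_def)
  have Y: "Y \<in> borel_measurable P" using distributed_measurable[OF assms(14)] by simp
  have astar: "fox_astar m p \<alpha> \<beta> \<ge> 0" using assms(3) by auto
  note L = fox_H_laplace[OF assms(1,2) astar assms(4-7) P assms(14)]
  have X: "X t \<in> borel_measurable M" if "t \<in> {0..}" for t
    using assms(11) that by (auto simp: is_fox_H_process_def is_L2_pairing_def)
  have S: "(\<lambda>\<omega>. sqrt (Y \<omega>) * B t \<omega>) \<in> borel_measurable P" if "t \<in> {0..}" for t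
    using fbm_measurable[OF assms(15), of t] Y that by simp
  have T: "(\<lambda>\<omega>. B (t * Y \<omega> powr (1 / (2 * H))) \<omega>) \<in> borel_measurable P" if "t \<in> {0..}" for t
    using fbm_time_changed_measurable[OF P Y assms(13,8,15,16)] that by simp
  have charX: "(LINT \<omega>|M. iexp (\<Sum>t\<in>I. d t * X t \<omega>)) = of_real (LINT \<omega>|P. exp (- (fbm_form H I d / 2) * Y \<omega>))"
    if "finite I" "I \<subseteq> {0..}" for I d
    using fox_H_process_char[OF assms(10,8,9,11) P Y assms(13) L that] .
  note charS = fbm_scaled_char[OF P Y assms(13,8,15,16)]
  note charT = fbm_time_changed_char[OF P Y assms(13,8,15,16)]
  have "distr M (Pi\<^sub>M I (\<lambda>_. borel)) (\<lambda>\<omega>. \<lambda>t\<in>I. X t \<omega>) =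
      distr P (Pi\<^sub>M I (\<lambda>_. borel)) (\<lambda>\<omega>. \<lambda>t\<in>I. sqrt (Y \<omega>) * B t \<omega>)" if I: "finite I" "I \<subseteq> {0..}" for I
    by (rule distr_PiM_eqI_char[OF M P I(1)]) (use X S I in \<open>auto simp only: charX[OF I] charS[OF I]\<close>)
  moreover have "distr P (Pi\<^sub>M I (\<lambda>_. borel)) (\<lambda>\<omega>. \<lambda>t\<in>I. sqrt (Y \<omega>) * B t \<omega>) =
      distr P (Pi\<^sub>M I (\<lambda>_. borel)) (\<lambda>\<omega>. \<lambda>t\<in>I. B (t * Y \<omega> powr (1 / (2 * H))) \<omega>)" if I: "finite I" "I \<subseteq> {0..}" for I
    by (rule distr_PiM_eqI_char[OF P P I(1)]) (use S T I in \<open>auto simp only: charS[OF I] charT[OF I]\<close>)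
  ultimately show ?thesis
    unfolding same_fdd_def using X S T by blast
qed

end
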